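(* There exist algorithms which, given a finite simplicial graph $\Gamma$ and a finite set of words in $W_\Gamma$ generating a subgroup $G$ that is quasiconvex in the right-angled Coxeter group $W_\Gamma$, solve the following problems: (1) Determine whether or not $G$ is torsion-free. (2) Determine the index of $G$ in $W_\Gamma$ (even if infinite). (3) Given a word $w$ representing an element $g\in W_\Gamma$, determine whether or not a positive power of $g$ is in $G$. (4) Determine whether or not $G$ is normal in $W_\Gamma$.
   Context: For a finite simplicial graph $\Gamma$, $W_\Gamma=\langle V(\Gamma)\mid s^2=1 \ (s\in V(\Gamma)),\ st=ts \text{ if } s,t \text{ are adjacent}\rangle$. A word in $W_\Gamma$ is a finite (possibly empty) sequence of letters in $V(\Gamma)$. A subgroup $G<W_\Gamma$ is quasiconvex if there is $M\ge0$ such that every geodesic with endpoints in $G$ in the Cayley graph of $W_\Gamma$ with respect to $V(\Gamma)$ lies in the $M$-neighborhood of $G$. The quasiconvexity of $G$ is a promise on the input; the constant $M$ is not part of the input. *)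

theory Defs
  imports
    "HOL-Algebra.Algebra"
    "HOL-Library.Nat_Bijection"
    "HOL-Library.Extended_Nat"
    "Graph_Theory.Pair_Digraph"
begin

section \<open>Right-angled Coxeter groups\<close>

text \<open>
  A finite simplicial graph is a \<^locale>\<open>pair_graph\<close>: a finite vertex set with a symmetric and
  irreflexive set of arcs, each edge being represented by both of its orientations.

  As the generators are involutions, inverse letters are not needed. The group presented by
  $\langle V \mid s^2 = 1,\ st = ts \rangle$ is the monoid of words over $V$ modulo the least
  congruence containing the relations; see \<open>racg_universal\<close> below for its universal property.
\<close>

inductive racg_eq :: "'v pair_pre_digraph \<Rightarrow> 'v list \<Rightarrow> 'v list \<Rightarrow> bool"
  for \<Gamma> :: "'v pair_pre_digraph" where
  square: "s \<in> pverts \<Gamma> \<Longrightarrow> racg_eq \<Gamma> [s, s] []"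
| commute: "(s, t) \<in> parcs \<Gamma> \<Longrightarrow> racg_eq \<Gamma> [s, t] [t, s]"
| refl: "w \<in> lists (pverts \<Gamma>) \<Longrightarrow> racg_eq \<Gamma> w w"
| sym: "racg_eq \<Gamma> u v \<Longrightarrow> racg_eq \<Gamma> v u"
| trans: "racg_eq \<Gamma> u v \<Longrightarrow> racg_eq \<Gamma> v w \<Longrightarrow> racg_eq \<Gamma> u w"
| append: "racg_eq \<Gamma> u u' \<Longrightarrow> racg_eq \<Gamma> v v' \<Longrightarrow> racg_eq \<Gamma> (u @ v) (u' @ v')"

definition racg_rel :: "'v pair_pre_digraph \<Rightarrow> 'v list rel" where
  "racg_rel \<Gamma> = {(u, v). racg_eq \<Gamma> u v}"

definition racg_word :: "'v pair_pre_digraph \<Rightarrow> 'v list \<Rightarrow> 'v list set" where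
  "racg_word \<Gamma> w = racg_rel \<Gamma> `` {w}"

definition racg :: "'v pair_pre_digraph \<Rightarrow> 'v list set monoid" where
  "racg \<Gamma> = \<lparr> carrier = lists (pverts \<Gamma>) // racg_rel \<Gamma>,
              monoid.mult = (\<lambda>A B. \<Union>u\<in>A. \<Union>v\<in>B. racg_word \<Gamma> (u @ v)),
              one = racg_word \<Gamma> [] \<rparr>"

definition racg_gens :: "'v pair_pre_digraph \<Rightarrow> 'v list set set" where
  "racg_gens \<Gamma> = (\<lambda>s. racg_word \<Gamma> [s]) ` pverts \<Gamma>"

definition word_subgroup :: "'v pair_pre_digraph \<Rightarrow> 'v list set \<Rightarrow> 'v list set set" where
  "word_subgroup \<Gamma> S = generate (racg \<Gamma>) (racg_word \<Gamma> ` S)"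

context pair_wf_digraph
begin

lemma racg_eq_lists:
  "racg_eq G u v \<Longrightarrow> u \<in> lists (pverts G) \<and> v \<in> lists (pverts G)"
  by (induction rule: racg_eq.induct) (auto dest: wellformed')

lemma equiv_racg_rel: "equiv (lists (pverts G)) (racg_rel G)"
proof (rule equivI)
  show "racg_rel G \<subseteq> lists (pverts G) \<times> lists (pverts G)"
    by (auto simp: racg_rel_def dest: racg_eq_lists)
  show "refl_on (lists (pverts G)) (racg_rel G)"
    by (rule refl_onI) (simp add: racg_rel_def racg_eq.refl)
  show "sym (racg_rel G)"
    by (rule symI) (simp add: racg_rel_def racg_eq.sym)
  show "trans (racg_rel G)"
    by (rule transI) (simp add: racg_rel_def, rule racg_eq.trans)
qed

lemma racg_word_eq_iff:
  assumes "u \<in> lists (pverts G)" "v \<in> lists (pverts G)"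
  shows "racg_word G u = racg_word G v \<longleftrightarrow> racg_eq G u v"
  using eq_equiv_class_iff[OF equiv_racg_rel assms] by (simp add: racg_word_def racg_rel_def)

lemma racg_word_eqI: "racg_eq G u v \<Longrightarrow> racg_word G u = racg_word G v"
  using racg_eq_lists racg_word_eq_iff by blast

lemma carrier_racg: "carrier (racg G) = racg_word G ` lists (pverts G)"
  by (auto simp: racg_def racg_word_def quotient_def)

lemma one_racg: "\<one>\<^bsub>racg G\<^esub> = racg_word G []"
  by (simp add: racg_def)

lemma mult_racg:
  assumes "u \<in> lists (pverts G)" "v \<in> lists (pverts G)"
  shows "racg_word G u \<otimes>\<^bsub>racg G\<^esub> racg_word G v = racg_word G (u @ v)"
proof -
  have inner: "racg_word G (u' @ v') = racg_word G (u @ v)"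
    if "racg_eq G u u'" "racg_eq G v v'" for u' v'
    using that by (intro racg_word_eqI racg_eq.sym[OF racg_eq.append])
  have mem: "x \<in> racg_word G w \<longleftrightarrow> racg_eq G w x" for x w
    by (simp add: racg_word_def racg_rel_def)
  have refl: "racg_eq G u u" "racg_eq G v v"
    using assms by (simp_all add: racg_eq.refl)
  have "racg_word G u \<otimes>\<^bsub>racg G\<^esub> racg_word G v
      = (\<Union>u'\<in>racg_word G u. \<Union>v'\<in>racg_word G v. racg_word G (u' @ v'))"
    by (simp add: racg_def)
  also have "\<dots> = (\<Union>u'\<in>racg_word G u. \<Union>v'\<in>racg_word G v. racg_word G (u @ v))"
    by (intro SUP_cong HOL.refl inner) (simp_all add: mem)
  also have "\<dots> = racg_word G (u @ v)"
    using refl by (simp add: mem[symmetric]) blast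
  finally show ?thesis .
qed

lemma racg_eq_rev: "w \<in> lists (pverts G) \<Longrightarrow> racg_eq G (rev w @ w) []"
proof (induction w)
  case Nil
  then show ?case by (simp add: racg_eq.refl)
next
  case (Cons s w)
  then have "racg_eq G (rev w @ [s, s] @ w) (rev w @ [] @ w)"
    by (intro racg_eq.append racg_eq.square racg_eq.refl) (auto simp: in_lists_conv_set)
  moreover have "racg_eq G (rev w @ [] @ w) []"
    using Cons by simp
  ultimately show ?case using racg_eq.trans by fastforce
qed

lemma group_racg: "group (racg G)"
proof (rule groupI)
  fix x assume "x \<in> carrier (racg G)"
  then obtain w where w: "w \<in> lists (pverts G)" "x = racg_word G w"
    by (auto simp: carrier_racg)
  then have "racg_word G (rev w) \<otimes>\<^bsub>racg G\<^esub> x = \<one>\<^bsub>racg G\<^esub>"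
    by (subst w(2), subst mult_racg)
      (auto simp: one_racg in_lists_conv_set intro!: racg_word_eqI racg_eq_rev)
  then show "\<exists>y\<in>carrier (racg G). y \<otimes>\<^bsub>racg G\<^esub> x = \<one>\<^bsub>racg G\<^esub>"
    using w by (intro bexI[of _ "racg_word G (rev w)"]) (auto simp: carrier_racg in_lists_conv_set)
next
  fix x y z assume "x \<in> carrier (racg G)" "y \<in> carrier (racg G)" "z \<in> carrier (racg G)"
  then obtain u v w where
    "u \<in> lists (pverts G)" "v \<in> lists (pverts G)" "w \<in> lists (pverts G)"
    "x = racg_word G u" "y = racg_word G v" "z = racg_word G w"
    unfolding carrier_racg by blast
  then show "x \<otimes>\<^bsub>racg G\<^esub> y \<otimes>\<^bsub>racg G\<^esub> z = x \<otimes>\<^bsub>racg G\<^esub> (y \<otimes>\<^bsub>racg G\<^esub> z)"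
    by (simp add: mult_racg)
qed (auto simp: carrier_racg one_racg mult_racg in_lists_conv_set intro!: imageI)

lemma racg_relations:
  "s \<in> pverts G \<Longrightarrow> racg_word G [s] \<otimes>\<^bsub>racg G\<^esub> racg_word G [s] = \<one>\<^bsub>racg G\<^esub>"
  "(s, t) \<in> parcs G \<Longrightarrow>
     racg_word G [s] \<otimes>\<^bsub>racg G\<^esub> racg_word G [t] = racg_word G [t] \<otimes>\<^bsub>racg G\<^esub> racg_word G [s]"
proof -
  show "racg_word G [s] \<otimes>\<^bsub>racg G\<^esub> racg_word G [s] = \<one>\<^bsub>racg G\<^esub>" if "s \<in> pverts G"
    using that by (simp add: mult_racg one_racg racg_word_eqI racg_eq.square)
  assume st: "(s, t) \<in> parcs G"
  with wellformed'[OF st] show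
    "racg_word G [s] \<otimes>\<^bsub>racg G\<^esub> racg_word G [t] = racg_word G [t] \<otimes>\<^bsub>racg G\<^esub> racg_word G [s]"
    by (simp add: mult_racg racg_word_eqI racg_eq.commute)
qed

lemma generate_racg_gens: "generate (racg G) (racg_gens G) = carrier (racg G)"
proof
  interpret W: group "racg G" by (rule group_racg)
  show "generate (racg G) (racg_gens G) \<subseteq> carrier (racg G)"
    by (rule W.generate_incl) (auto simp: racg_gens_def carrier_racg)
  have "racg_word G w \<in> generate (racg G) (racg_gens G)" if "w \<in> lists (pverts G)" for w
    using that
  proof (induction w)
    case Nil
    show ?case using generate.one[of "racg G"] by (simp add: one_racg)
  next
    case (Cons s w)
    have "racg_word G [s] \<in> generate (racg G) (racg_gens G)"
      using Cons.hyps by (intro generate.incl) (simp add: racg_gens_def)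
    from generate.eng[OF this Cons.IH]
    show ?case using Cons.hyps by (simp add: mult_racg)
  qed
  then show "carrier (racg G) \<subseteq> generate (racg G) (racg_gens G)"
    by (auto simp: carrier_racg)
qed

text \<open>Uniqueness of the homomorphism is immediate from \<open>generate_racg_gens\<close>.\<close>

lemma racg_universal:
  assumes "group H" and \<phi>: "\<phi> \<in> pverts G \<rightarrow> carrier H"
    and sq: "\<And>s. s \<in> pverts G \<Longrightarrow> \<phi> s \<otimes>\<^bsub>H\<^esub> \<phi> s = \<one>\<^bsub>H\<^esub>"
    and comm: "\<And>s t. (s, t) \<in> parcs G \<Longrightarrow> \<phi> s \<otimes>\<^bsub>H\<^esub> \<phi> t = \<phi> t \<otimes>\<^bsub>H\<^esub> \<phi> s"
  shows "\<exists>f\<in>hom (racg G) H. \<forall>s\<in>pverts G. f (racg_word G [s]) = \<phi> s"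
proof -
  interpret H: group H by fact
  define ev where "ev w = foldr (\<lambda>s x. \<phi> s \<otimes>\<^bsub>H\<^esub> x) w \<one>\<^bsub>H\<^esub>" for w
  have ev_Cons: "ev (s # w) = \<phi> s \<otimes>\<^bsub>H\<^esub> ev w" for s w
    by (simp add: ev_def)
  have ev_carrier: "ev w \<in> carrier H" if "w \<in> lists (pverts G)" for w
    using that \<phi> by (induction w) (auto simp: ev_def)
  have ev_append: "ev (u @ v) = ev u \<otimes>\<^bsub>H\<^esub> ev v"
    if "u \<in> lists (pverts G)" "v \<in> lists (pverts G)" for u v
    using that(1)
  proof (induction u)
    case Nil
    show ?case using ev_carrier[OF that(2)] by (simp add: ev_def)
  next
    case (Cons s u)
    then show ?case
      using ev_carrier[of u] ev_carrier[OF that(2)] \<phi> by (simp add: ev_Cons Pi_iff H.m_assoc)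
  qed
  have ev_eq: "ev u = ev v" if "racg_eq G u v" for u v
    using that
  proof (induction rule: racg_eq.induct)
    case (square s)
    then show ?case using sq[of s] \<phi> by (auto simp: ev_def Pi_iff)
  next
    case (commute s t)
    then show ?case using comm[of s t] wellformed'[of s t] \<phi> by (simp add: ev_def Pi_iff)
  next
    case (append u u' v v')
    then show ?case by (metis ev_append racg_eq_lists)
  qed auto
  define f where "f A = ev (SOME w. w \<in> A)" for A
  have f: "f (racg_word G w) = ev w" if "w \<in> lists (pverts G)" for w
  proof -
    have "w \<in> racg_word G w"
      using that by (simp add: racg_word_def racg_rel_def racg_eq.refl)
    then have "(SOME u. u \<in> racg_word G w) \<in> racg_word G w"
      by (rule someI)
    then have "racg_eq G w (SOME u. u \<in> racg_word G w)"
      by (simp add: racg_word_def racg_rel_def)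
    from ev_eq[OF this] show ?thesis by (simp add: f_def)
  qed
  have "f \<in> hom (racg G) H"
  proof (rule homI)
    fix x assume "x \<in> carrier (racg G)"
    then show "f x \<in> carrier H"
      unfolding carrier_racg using f ev_carrier by (metis imageE)
  next
    fix x y assume "x \<in> carrier (racg G)" "y \<in> carrier (racg G)"
    then obtain u v where
      "u \<in> lists (pverts G)" "v \<in> lists (pverts G)" "x = racg_word G u" "y = racg_word G v"
      unfolding carrier_racg by blast
    then show "f (x \<otimes>\<^bsub>racg G\<^esub> y) = f x \<otimes>\<^bsub>H\<^esub> f y"
      by (simp add: mult_racg f ev_append)
  qed
  moreover have "f (racg_word G [s]) = \<phi> s" if "s \<in> pverts G" for s
    using that \<phi> by (auto simp: f ev_def Pi_iff)
  ultimately show ?thesis by blast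
qed

end

section \<open>Cayley graphs and quasiconvexity\<close>

definition cayley_graph :: "('a, 'b) monoid_scheme \<Rightarrow> 'a set \<Rightarrow> 'a pair_pre_digraph" where
  "cayley_graph G S = \<lparr> pverts = carrier G,
     parcs = {(g, h). g \<in> carrier G \<and> (\<exists>s\<in>S. h = g \<otimes>\<^bsub>G\<^esub> s \<or> h = g \<otimes>\<^bsub>G\<^esub> inv\<^bsub>G\<^esub> s)} \<rparr>"

definition graph_dist :: "'a pair_pre_digraph \<Rightarrow> 'a \<Rightarrow> 'a \<Rightarrow> enat" where
  "graph_dist C u v = (INF p\<in>{p. pre_digraph.awalk (with_proj C) u p v}. enat (length p))"

definition geodesic :: "'a pair_pre_digraph \<Rightarrow> 'a \<Rightarrow> ('a \<times> 'a) list \<Rightarrow> 'a \<Rightarrow> bool" where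
  "geodesic C u p v \<longleftrightarrow>
     pre_digraph.awalk (with_proj C) u p v \<and> enat (length p) = graph_dist C u v"

text \<open>
  Only the vertices of a geodesic are required to be close to the subgroup. Interior points of
  edges are within distance 1/2 of a vertex, so including them, or allowing real constants, only
  affects the value of \<open>M\<close>.
\<close>

definition quasiconvex :: "('a, 'b) monoid_scheme \<Rightarrow> 'a set \<Rightarrow> 'a set \<Rightarrow> bool" where
  "quasiconvex G S H \<longleftrightarrow>
     (\<exists>M::nat. \<forall>u\<in>H. \<forall>v\<in>H. \<forall>p. geodesic (cayley_graph G S) u p v \<longrightarrow>
        (\<forall>x\<in>set (pawalk_verts u p). \<exists>h\<in>H. graph_dist (cayley_graph G S) x h \<le> enat M))"

section \<open>Torsion and index\<close>

definition torsion_free :: "('a, 'b) monoid_scheme \<Rightarrow> bool" where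
  "torsion_free G \<longleftrightarrow>
     (\<forall>x\<in>carrier G. x \<noteq> \<one>\<^bsub>G\<^esub> \<longrightarrow> (\<forall>n::nat. n > 0 \<longrightarrow> x [^]\<^bsub>G\<^esub> n \<noteq> \<one>\<^bsub>G\<^esub>))"

definition subgroup_index :: "('a, 'b) monoid_scheme \<Rightarrow> 'a set \<Rightarrow> enat" where
  "subgroup_index G H =
     (if finite (rcosets\<^bsub>G\<^esub> H) then enat (card (rcosets\<^bsub>G\<^esub> H)) else \<infinity>)"

section \<open>Algorithms\<close>

text \<open>
  Algorithms are partial recursive functions on natural numbers, with \<^const>\<open>None\<close> standing for divergence. All
  functions are unary, several arguments being passed via \<^const>\<open>prod_encode\<close>. Projections,
  the identity and substitution for several arguments are obtained from \<open>left\<close>, \<open>right\<close>, \<open>pair\<close>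
  and \<open>comp\<close>. In \<open>mu\<close>, the search diverges as soon as one of the tested values does.
\<close>

definition minimize :: "(nat \<Rightarrow> nat option) \<Rightarrow> nat option" where
  "minimize t =
     (if \<exists>n. t n = Some 0 \<and> (\<forall>m<n. t m \<noteq> None) then Some (LEAST n. t n = Some 0) else None)"

inductive partial_recursive :: "(nat \<Rightarrow> nat option) \<Rightarrow> bool" where
  zero: "partial_recursive (\<lambda>_. Some 0)"
| succ: "partial_recursive (\<lambda>n. Some (Suc n))"
| left: "partial_recursive (\<lambda>n. Some (fst (prod_decode n)))"
| right: "partial_recursive (\<lambda>n. Some (snd (prod_decode n)))"
| pair: "partial_recursive f \<Longrightarrow> partial_recursive g \<Longrightarrow>
    partial_recursive
      (\<lambda>n. Option.bind (f n) (\<lambda>a. Option.bind (g n) (\<lambda>b. Some (prod_encode (a, b)))))"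
| comp: "partial_recursive f \<Longrightarrow> partial_recursive g \<Longrightarrow>
    partial_recursive (\<lambda>n. Option.bind (g n) f)"
| prec: "partial_recursive f \<Longrightarrow> partial_recursive g \<Longrightarrow>
    partial_recursive (\<lambda>n. case prod_decode n of (a, k) \<Rightarrow>
      rec_nat (f a) (\<lambda>y r. Option.bind r (\<lambda>i. g (prod_encode (a, prod_encode (y, i))))) k)"
| mu: "partial_recursive f \<Longrightarrow>
    partial_recursive (\<lambda>a. minimize (\<lambda>n. f (prod_encode (a, n))))"

text \<open>
  \<open>F\<close> is computed by an algorithm on all instances satisfying the promise \<open>P\<close>; nothing is required
  of the algorithm, not even termination, on other inputs.
\<close>

definition computable_on :: "'i set \<Rightarrow> ('i \<Rightarrow> nat) \<Rightarrow> ('o \<Rightarrow> nat) \<Rightarrow> ('i \<Rightarrow> 'o) \<Rightarrow> bool" where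
  "computable_on P enc_in enc_out F \<longleftrightarrow>
     (\<exists>f. partial_recursive f \<and> (\<forall>x\<in>P. f (enc_in x) = Some (enc_out (F x))))"

section \<open>Instances\<close>

text \<open>The vertices of input graphs are natural numbers, which covers all finite simplicial
  graphs up to isomorphism. An instance is a graph with a finite set of words over its vertices.\<close>

type_synonym inst = "nat pair_pre_digraph \<times> nat list set"

definition quasiconvex_instances :: "inst set" where
  "quasiconvex_instances = {(\<Gamma>, S). pair_graph \<Gamma> \<and> finite S \<and> S \<subseteq> lists (pverts \<Gamma>) \<and>
     quasiconvex (racg \<Gamma>) (racg_gens \<Gamma>) (word_subgroup \<Gamma> S)}"

fun inst_encode :: "inst \<Rightarrow> nat" where
  "inst_encode (\<Gamma>, S) =
     prod_encode (prod_encode (set_encode (pverts \<Gamma>), set_encode (prod_encode ` parcs \<Gamma>)),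
       set_encode (list_encode ` S))"

fun inst_word_encode :: "inst \<times> nat list \<Rightarrow> nat" where
  "inst_word_encode (I, w) = prod_encode (inst_encode I, list_encode w)"

fun enat_encode :: "enat \<Rightarrow> nat" where
  "enat_encode \<infinity> = 0"
| "enat_encode (enat n) = Suc n"

end

theory Submission
  imports Defs "HOL-Library.More_List"
begin

text \<open>
  Every answer is certified by a finite object that can be recognized by a semidecidable test, so
  an algorithm searches through all candidates. Positive membership in \<open>G\<close>, torsion, powers in \<open>G\<close>
  and normality are semidecidable outright. The remaining answers use a finite partial automaton whose
  states are cosets of \<open>G\<close>, whose letters act as partial involutions, and in which squares
  of commuting letters close up. The language of such an automaton is closed under deleting \<open>ss\<close> and
  swapping commuting letters, so by the solution of the word problem a reduced word represents an
  element of \<open>G\<close> iff it labels a loop at the base state.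

  The automaton exists because \<open>G\<close> is quasiconvex: take the cosets contained in the convex hull of \<open>G\<close>,
  the intersection of the half-spaces containing \<open>G\<close>. A point of the hull at distance \<open>n\<close> from \<open>G\<close>
  forces some geodesic between points of \<open>G\<close> to reach distance \<open>n / |V|\<close> from \<open>G\<close>, so there are only
  finitely many such cosets.

  Given the automaton, torsion shows up as a loop labelled by a clique, since every element of finite
  order is conjugate to a product of pairwise commuting letters; the index is infinite iff
  some state lacks an edge labelled by a non-central letter; and if a power of \<open>g\<close> lies in \<open>G\<close>, then some
  \<open>g\<^sup>2\<^sup>n\<close> with \<open>n\<close> at most the number of states does, because \<open>g\<^sup>2\<close> can be written \<open>x v x\<^sup>-\<^sup>1\<close>
  with all \<open>x v\<^sup>n x\<^sup>-\<^sup>1\<close> reduced.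
\<close>

section \<open>Recursive functions and semidecidable predicates\<close>

text \<open>The constant of quasiconvexity is unknown, so it must not enter the algorithm. Every
  certificate that passes the test yields correct answers; quasiconvexity and the hull only
  guarantee that the search ends. The test itself needs no bound, since membership of the edge
  elements in \<open>G\<close> is searched for as well. The obstacle is that the automaton is
  partial: a word for an element of \<open>G\<close> may leave it through a detour
  \<open>s s\<close> along a missing edge. A run that stays inside survives cancellations and swaps,
  so the reduced form is the one to read. The closing of squares is what makes swaps harmless near
  missing edges. For the same reason torsion elements and powers are brought into the form of a
  conjugate that is reduced as a whole: the conjugating word leads to a state, and the rest is a
  loop there. The hull automaton may miss edges in spite of finite index, namely in central
  directions. A finite index is therefore read off a total automaton on all cosets.\<close>

abbreviation lft :: "nat \<Rightarrow> nat" where "lft n \<equiv> fst (prod_decode n)"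
abbreviation rgt :: "nat \<Rightarrow> nat" where "rgt n \<equiv> snd (prod_decode n)"

definition recf :: "(nat \<Rightarrow> nat) \<Rightarrow> bool" where
  "recf f \<longleftrightarrow> partial_recursive (\<lambda>n. Some (f n))"

definition recl :: "(nat \<Rightarrow> nat list) \<Rightarrow> bool" where
  "recl f \<longleftrightarrow> recf (\<lambda>x. list_encode (f x))"

definition dec :: "(nat \<Rightarrow> bool) \<Rightarrow> bool" where
  "dec P \<longleftrightarrow> recf (\<lambda>x. of_bool (P x))"

definition semidec :: "(nat \<Rightarrow> bool) \<Rightarrow> bool" where
  "semidec P \<longleftrightarrow> (\<exists>D. dec D \<and> (\<forall>x. P x \<longleftrightarrow> (\<exists>n. D (prod_encode (x, n)))))"

named_theorems rec_intros

section \<open>Closure properties of total recursive functions\<close>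

lemma recf_comp: "recf f \<Longrightarrow> recf g \<Longrightarrow> recf (\<lambda>x. f (g x))"
  unfolding recf_def by (drule (1) partial_recursive.comp) simp

lemma recf_lft [rec_intros]: "recf f \<Longrightarrow> recf (\<lambda>x. lft (f x))"
  by (rule recf_comp[of lft]) (simp_all add: recf_def partial_recursive.left)

lemma recf_rgt [rec_intros]: "recf f \<Longrightarrow> recf (\<lambda>x. rgt (f x))"
  by (rule recf_comp[of rgt]) (simp_all add: recf_def partial_recursive.right)

lemma recf_Suc [rec_intros]: "recf f \<Longrightarrow> recf (\<lambda>x. Suc (f x))"
  by (rule recf_comp[of Suc]) (simp_all add: recf_def partial_recursive.succ)

lemma recf_pair [rec_intros]: "recf f \<Longrightarrow> recf g \<Longrightarrow> recf (\<lambda>x. prod_encode (f x, g x))"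
  unfolding recf_def by (drule (1) partial_recursive.pair) simp

lemma recf_id [rec_intros]: "recf (\<lambda>x. x)"
proof -
  have "recf (\<lambda>x. prod_encode (lft x, rgt x))"
    using partial_recursive.pair[OF partial_recursive.left partial_recursive.right]
    by (simp add: recf_def)
  then show ?thesis by simp
qed

lemma recf_const [rec_intros]: "recf (\<lambda>x. c)"
  by (induction c) (auto simp: recf_def partial_recursive.zero intro: recf_Suc[unfolded recf_def])

text \<open>Passing the whole input as parameter of the recursion lets base, step and number of
  rounds all depend on it. Base and step are total, so each \<open>Option.bind\<close> of
  \<open>prec\<close> disappears.\<close>

lemma recf_rec_nat [rec_intros]:
  assumes "recf a" "recf (\<lambda>z. g (lft z) (lft (rgt z)) (rgt (rgt z)))" "recf k"
  shows "recf (\<lambda>x. rec_nat (a x) (g x) (k x))"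
proof -
  have "partial_recursive (\<lambda>n. case prod_decode n of (x, k) \<Rightarrow>
      rec_nat (Some (a x)) (\<lambda>y r. Option.bind r (\<lambda>i. Some (g (lft (prod_encode (x, prod_encode (y, i))))
        (lft (rgt (prod_encode (x, prod_encode (y, i))))) (rgt (rgt (prod_encode (x, prod_encode (y, i)))))))) k)"
    (is "partial_recursive ?F")
    using partial_recursive.prec[of "\<lambda>x. Some (a x)"
        "\<lambda>z. Some (g (lft z) (lft (rgt z)) (rgt (rgt z)))"] assms
    by (simp add: recf_def)
  moreover have "?F = (\<lambda>n. Some (rec_nat (a (lft n)) (g (lft n)) (rgt n)))"
  proof
    fix n
    have "rec_nat (Some (a x)) (\<lambda>y r. Option.bind r (\<lambda>i. Some (g x y i))) k
        = Some (rec_nat (a x) (g x) k)" for x k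
      by (induction k) auto
    then show "?F n = Some (rec_nat (a (lft n)) (g (lft n)) (rgt n))"
      by (simp add: case_prod_beta)
  qed
  ultimately have "recf (\<lambda>n. rec_nat (a (lft n)) (g (lft n)) (rgt n))"
    by (simp add: recf_def)
  from recf_comp[OF this recf_pair[OF recf_id assms(3)]] show ?thesis by simp
qed

lemma recf_add [rec_intros]:
  assumes "recf f" "recf g"
  shows "recf (\<lambda>x. f x + g x)"
proof -
  have eq: "m + n = rec_nat m (\<lambda>_ r. Suc r) n" for m n by (induction n) auto
  show ?thesis unfolding eq by (intro rec_intros assms)
qed

lemma recf_pred [rec_intros]:
  assumes "recf f"
  shows "recf (\<lambda>x. f x - 1)"
proof -
  have eq: "n - 1 = rec_nat 0 (\<lambda>y _. y) n" for n :: nat by (cases n) auto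
  show ?thesis unfolding eq by (intro rec_intros assms)
qed

lemma recf_diff [rec_intros]:
  assumes "recf f" "recf g"
  shows "recf (\<lambda>x. f x - g x)"
proof -
  have eq: "m - n = rec_nat m (\<lambda>_ r. r - 1) n" for m n :: nat by (induction n) auto
  show ?thesis by (subst eq) (intro rec_intros assms)
qed

lemma recf_mult [rec_intros]:
  assumes "recf f" "recf g"
  shows "recf (\<lambda>x. f x * g x)"
proof -
  have eq: "m * n = rec_nat 0 (\<lambda>_ r. r + m) n" for m n :: nat by (induction n) auto
  show ?thesis unfolding eq by (intro rec_intros assms recf_comp[OF assms(1)])
qed

section \<open>Decidable predicates\<close>

lemma dec_not [rec_intros]:
  assumes "dec P"
  shows "dec (\<lambda>x. \<not> P x)"
proof -
  have eq: "of_bool (\<not> p) = (1::nat) - of_bool p" for p by simp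
  show ?thesis unfolding dec_def eq by (intro rec_intros assms[unfolded dec_def])
qed

lemma dec_conj [rec_intros]: "dec P \<Longrightarrow> dec Q \<Longrightarrow> dec (\<lambda>x. P x \<and> Q x)"
  unfolding dec_def of_bool_conj by (rule recf_mult)

lemma dec_disj [rec_intros]:
  assumes "dec P" "dec Q"
  shows "dec (\<lambda>x. P x \<or> Q x)"
proof -
  have eq: "p \<or> q \<longleftrightarrow> \<not> (\<not> p \<and> \<not> q)" for p q by blast
  show ?thesis by (subst eq) (intro dec_not dec_conj assms)
qed

lemma dec_eq0: "recf f \<Longrightarrow> dec (\<lambda>x. f x = 0)"
proof -
  have "of_bool (n = 0) = 1 - n" for n :: nat by auto
  then show "recf f \<Longrightarrow> dec (\<lambda>x. f x = 0)"
    unfolding dec_def by (auto intro!: rec_intros)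
qed

lemma dec_le [rec_intros]: "recf f \<Longrightarrow> recf g \<Longrightarrow> dec (\<lambda>x. f x \<le> g x)"
  using dec_eq0[OF recf_diff] by simp

lemma dec_less [rec_intros]: "recf f \<Longrightarrow> recf g \<Longrightarrow> dec (\<lambda>x. f x < g x)"
  using dec_not[OF dec_le, of g f] by (simp add: not_le)

lemma dec_eq [rec_intros]: "recf f \<Longrightarrow> recf g \<Longrightarrow> dec (\<lambda>x. f x = g x)"
  using dec_conj[OF dec_le dec_le, of f g g f] by (simp add: eq_iff)

lemma dec_comp: "dec P \<Longrightarrow> recf g \<Longrightarrow> dec (\<lambda>x. P (g x))"
  unfolding dec_def by (rule recf_comp)

lemma recf_if [rec_intros]:
  assumes "dec P" "recf f" "recf g"
  shows "recf (\<lambda>x. if P x then f x else g x)"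
proof -
  have "(if P x then f x else g x) = of_bool (P x) * f x + (1 - of_bool (P x)) * g x" for x
    by simp
  then show ?thesis using assms by (auto simp: dec_def intro!: rec_intros)
qed

lemma dec_ball [rec_intros]:
  assumes "recf b" "dec (\<lambda>z. P (lft z) (rgt z))"
  shows "dec (\<lambda>x. \<forall>y<b x. P x y)"
proof -
  have "rec_nat (1::nat) (\<lambda>y r. r * of_bool (P x y)) n = of_bool (\<forall>y<n. P x y)" for x n
    by (induction n) (auto simp: less_Suc_eq)
  then have "(\<lambda>x. of_bool (\<forall>y<b x. P x y)) = (\<lambda>x. rec_nat (1::nat) (\<lambda>y r. r * of_bool (P x y)) (b x))"
    by simp
  moreover have "recf \<dots>"
    using recf_comp[OF assms(2)[unfolded dec_def], of "\<lambda>z. prod_encode (lft z, lft (rgt z))"]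
    by (intro rec_intros assms(1)) (simp add: rec_intros)
  ultimately show ?thesis by (simp add: dec_def)
qed

lemma dec_bex [rec_intros]:
  assumes "recf b" "dec (\<lambda>z. P (lft z) (rgt z))"
  shows "dec (\<lambda>x. \<exists>y<b x. P x y)"
  using dec_not[OF dec_ball[OF assms(1) dec_not[OF assms(2)]]] by simp

text \<open>The second recursion counts the odd numbers below \<open>n\<close>.\<close>

lemma half_parity_rec:
  "(n::nat) mod 2 = rec_nat 0 (\<lambda>_ r. 1 - r) n" "n div 2 = rec_nat 0 (\<lambda>y r. r + y mod 2) n"
proof -
  show "n mod 2 = rec_nat 0 (\<lambda>_ r. 1 - r) n"
    by (induction n) (auto simp: mod_Suc)
  show "n div 2 = rec_nat 0 (\<lambda>y r. r + y mod 2) n"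
  proof (induction n)
    case (Suc n)
    have "Suc n div 2 = n div 2 + n mod 2" by presburger
    with Suc show ?case by simp
  qed simp
qed

lemma recf_mod2 [rec_intros]: "recf f \<Longrightarrow> recf (\<lambda>x. f x mod 2)"
  unfolding half_parity_rec by (intro rec_intros)

lemma recf_div2 [rec_intros]: "recf f \<Longrightarrow> recf (\<lambda>x. f x div 2)"
  unfolding half_parity_rec(2) by (intro rec_intros)

lemma dec_mem_set_decode [rec_intros]:
  assumes "recf f" "recf g"
  shows "dec (\<lambda>x. f x \<in> set_decode (g x))"
proof -
  have "rec_nat m (\<lambda>_ r. r div 2) n = m div 2 ^ n" for m n :: nat
    by (induction n) (auto simp: div_mult2_eq[symmetric] mult.commute)
  then have "f x \<in> set_decode (g x) \<longleftrightarrow> rec_nat (g x) (\<lambda>_ r. r div 2) (f x) mod 2 = 1" for x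
    by (simp add: set_decode_def odd_iff_mod_2_eq_one)
  then show ?thesis using assms by (simp, intro rec_intros)
qed

text \<open>A nonempty list is coded as \<open>Suc\<close> of the pair of its head and the code of
  its tail. For the empty list, \<open>0 - 1 = 0\<close> decodes to a pair of zeros, and the second
  zero is again the empty list.\<close>

lemma tl_list_decode: "tl (list_decode n) = list_decode (rgt (n - 1))"
  by (cases n) (auto simp: case_prod_beta prod_decode_def prod_decode_aux.simps)

lemma nth_default_hd: "nth_default 0 xs n = nth_default 0 (drop n xs) 0"
  by (simp add: nth_default_def)

lemma nth_default_0_list_decode: "nth_default 0 (list_decode n) 0 = lft (n - 1)"
  by (cases n) (auto simp: case_prod_beta prod_decode_def prod_decode_aux.simps)

lemma drop_list_decode: "drop k (list_decode n) = list_decode (rec_nat n (\<lambda>_ r. rgt (r - 1)) k)"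
proof (induction k)
  case (Suc k)
  have "drop (Suc k) (list_decode n) = tl (drop k (list_decode n))"
    by (simp only: drop_Suc tl_drop)
  also have "\<dots> = list_decode (rgt (rec_nat n (\<lambda>_ r. rgt (r - 1)) k - 1))"
    by (simp only: Suc.IH tl_list_decode)
  finally show ?case by simp
qed simp

text \<open>Access with default 0 is total. The same default later stands for a missing edge and,
  being the code of \<open>[]\<close>, for the empty representative word.\<close>

lemma recf_lookup [rec_intros]:
  assumes "recf f" "recf g"
  shows "recf (\<lambda>x. nth_default 0 (list_decode (f x)) (g x))"
  unfolding nth_default_hd[of _ "g _"] drop_list_decode nth_default_0_list_decode
  by (intro rec_intros assms)

lemma recl_decode [rec_intros]: "recf f \<Longrightarrow> recl (\<lambda>x. list_decode (f x))"
  by (simp add: recl_def)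

lemma recf_encode [rec_intros]: "recl f \<Longrightarrow> recf (\<lambda>x. list_encode (f x))"
  by (simp add: recl_def)

lemma recf_nth_default [rec_intros]:
  "recl f \<Longrightarrow> recf g \<Longrightarrow> recf (\<lambda>x. nth_default 0 (f x) (g x))"
  unfolding recl_def by (drule (1) recf_lookup) simp

lemma length_le_list_encode: "length xs \<le> list_encode xs"
proof (induction xs)
  case (Cons x xs)
  then show ?case using le_prod_encode_2[of "list_encode xs" x] by simp
qed simp

text \<open>A list is no longer than its code, so the code bounds a loop that counts how often the
  iterated tail is still nonempty.\<close>

lemma recf_length [rec_intros]:
  assumes "recl f"
  shows "recf (\<lambda>x. length (f x))"
proof -
  have count: "rec_nat 0 (\<lambda>y r. r + of_bool (y < n)) m = min m n" for m n
    by (induction m) auto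
  have drop: "drop k xs = [] \<longleftrightarrow> rec_nat (list_encode xs) (\<lambda>_ r. rgt (r - 1)) k = 0" for k xs
    using drop_list_decode[of k "list_encode xs"]
    by (metis list_encode_inverse list_decode_inverse list_encode.simps(1))
  have eq: "length (f x) = rec_nat 0
      (\<lambda>y r. r + of_bool (rec_nat (list_encode (f x)) (\<lambda>_ r. rgt (r - 1)) y \<noteq> 0)) (list_encode (f x))" for x
    using count[of "length (f x)" "list_encode (f x)"] length_le_list_encode[of "f x"]
    unfolding drop[symmetric] drop_eq_Nil not_le by simp
  have "dec (\<lambda>z. rec_nat (list_encode (f (lft z))) (\<lambda>_ r. rgt (r - 1)) (lft (rgt z)) \<noteq> 0)"
    by (intro rec_intros recf_comp[OF assms[unfolded recl_def]])
  then have "recf (\<lambda>x. rec_nat 0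
      (\<lambda>y r. r + of_bool (rec_nat (list_encode (f x)) (\<lambda>_ r. rgt (r - 1)) y \<noteq> 0)) (list_encode (f x)))"
    by (intro recf_rec_nat rec_intros assms[unfolded recl_def]) (simp only: dec_def)
  then show ?thesis by (simp only: eq)
qed

text \<open>List codes grow at the head, so round \<open>i\<close> of the recursion adds entry
  \<open>b x - 1 - i\<close>. Append and reversal are then obtained by writing their results as
  tabulations.\<close>

lemma recl_tabulate [rec_intros]:
  assumes "recf (\<lambda>z. h (lft z) (rgt z))" "recf b"
  shows "recl (\<lambda>x. map (h x) [0..<b x])"
proof -
  have *: "k \<le> n \<Longrightarrow> list_encode (map f [n - k..<n])
      = rec_nat 0 (\<lambda>i r. Suc (prod_encode (f (n - 1 - i), r))) k" for f k and n :: nat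
  proof (induction k)
    case (Suc k)
    then have "[n - Suc k..<n] = (n - Suc k) # [n - k..<n]"
      by (metis Suc_diff_Suc Suc_le_lessD diff_less upt_conv_Cons zero_less_Suc order.strict_trans2 zero_less_diff less_le_trans diff_Suc_less)
    then show ?case using Suc by simp
  qed simp
  have "list_encode (map (h x) [0..<b x])
      = rec_nat 0 (\<lambda>i r. Suc (prod_encode (h x (b x - 1 - i), r))) (b x)" for x
    using *[of "b x" "b x" "h x"] by simp
  moreover have "recf (\<lambda>z. h (lft z) (b (lft z) - 1 - lft (rgt z)))"
    using recf_comp[OF assms(1), of "\<lambda>z. prod_encode (lft z, b (lft z) - 1 - lft (rgt z))"]
      recf_comp[OF assms(2) recf_lft[OF recf_id]]
    by (simp add: rec_intros)
  ultimately show ?thesis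
    unfolding recl_def using assms(2) by (simp, intro rec_intros)
qed

lemma list_eq_tabulate: "n = length xs \<Longrightarrow> (\<And>i. i < n \<Longrightarrow> xs ! i = h i) \<Longrightarrow> xs = map h [0..<n]"
  by (rule nth_equalityI) auto

lemma recl_comp: "recl f \<Longrightarrow> recf g \<Longrightarrow> recl (\<lambda>x. f (g x))"
  unfolding recl_def by (rule recf_comp)

lemma recl_append [rec_intros]:
  assumes "recl f" "recl g"
  shows "recl (\<lambda>x. f x @ g x)"
proof -
  have "f x @ g x = map (\<lambda>i. if i < length (f x) then nth_default 0 (f x) i
      else nth_default 0 (g x) (i - length (f x))) [0..<length (f x) + length (g x)]" for x
    by (rule list_eq_tabulate) (auto simp: nth_append nth_default_def)
  then show ?thesis
    by (simp only:) (intro rec_intros assms recl_comp[OF assms(1)] recl_comp[OF assms(2)])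
qed

lemma recl_rev [rec_intros]:
  assumes "recl f"
  shows "recl (\<lambda>x. rev (f x))"
proof -
  have "rev (f x) = map (\<lambda>i. nth_default 0 (f x) (length (f x) - 1 - i)) [0..<length (f x)]" for x
    by (rule list_eq_tabulate) (auto simp: rev_nth nth_default_def)
  then show ?thesis
    by (simp only:) (intro rec_intros assms recl_comp[OF assms])
qed

lemma recl_Nil [rec_intros]: "recl (\<lambda>x. [])"
  by (simp add: recl_def recf_const)

lemma recl_Cons [rec_intros]: "recf f \<Longrightarrow> recl g \<Longrightarrow> recl (\<lambda>x. f x # g x)"
  unfolding recl_def by (simp add: recf_Suc recf_pair)

lemma recl_concat_replicate [rec_intros]:
  assumes "recl f" "recf g"
  shows "recl (\<lambda>x. concat (replicate (g x) (f x)))"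
proof -
  have eq: "list_encode (concat (replicate n w))
      = rec_nat 0 (\<lambda>_ r. list_encode (w @ list_decode r)) n" for n and w :: "nat list"
    by (induction n) (simp_all, metis list_encode_inverse)
  show ?thesis
    unfolding recl_def eq by (intro recf_rec_nat recf_encode recl_append recl_decode recl_comp[OF assms(1)] rec_intros assms(2))
qed

lemma dec_list_eq [rec_intros]: "recl f \<Longrightarrow> recl g \<Longrightarrow> dec (\<lambda>x. f x = g x)"
  unfolding recl_def by (drule (1) dec_eq) (simp only: list_encode_eq)

section \<open>Semidecidable predicates\<close>

lemma semidec_dec: "dec P \<Longrightarrow> semidec P"
  unfolding semidec_def
  using dec_comp[of P, OF _ recf_lft[OF recf_id]]
  by (intro exI[of _ "\<lambda>z. P (lft z)"]) simp

lemma semidec_comp: "semidec P \<Longrightarrow> recf g \<Longrightarrow> semidec (\<lambda>x. P (g x))"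
proof -
  assume "semidec P" and g: "recf g"
  then obtain D where D: "dec D" "\<And>x. P x \<longleftrightarrow> (\<exists>n. D (prod_encode (x, n)))"
    by (auto simp: semidec_def)
  have "dec (\<lambda>z. D (prod_encode (g (lft z), rgt z)))"
    by (intro dec_comp[OF D(1)] rec_intros recf_comp[OF g])
  then show ?thesis
    unfolding semidec_def by (intro exI[of _ "\<lambda>z. D (prod_encode (g (lft z), rgt z))"]) (simp add: D(2))
qed

named_theorems semidec_intros

lemma semidec_ex [semidec_intros]:
  assumes "semidec (\<lambda>z. P (lft z) (rgt z))"
  shows "semidec (\<lambda>x. \<exists>y. P x y)"
proof -
  obtain D where D: "dec D" "\<And>x. P (lft x) (rgt x) \<longleftrightarrow> (\<exists>n. D (prod_encode (x, n)))"
    using assms by (auto simp: semidec_def)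
  let ?E = "\<lambda>z. D (prod_encode (prod_encode (lft z, lft (rgt z)), rgt (rgt z)))"
  have "dec ?E" by (intro dec_comp[OF D(1)] rec_intros)
  moreover have "(\<exists>y. P x y) \<longleftrightarrow> (\<exists>n. ?E (prod_encode (x, n)))" for x
  proof -
    have "(\<exists>y. P x y) \<longleftrightarrow> (\<exists>y n. D (prod_encode (prod_encode (x, y), n)))"
      using D(2)[of "prod_encode (x, _)"] by simp
    also have "\<dots> \<longleftrightarrow> (\<exists>n. ?E (prod_encode (x, n)))"
      by (metis prod_encode_inverse fst_conv snd_conv)
    finally show ?thesis .
  qed
  ultimately show ?thesis unfolding semidec_def by blast
qed

lemma semidec_ex_list [semidec_intros]:
  assumes "semidec (\<lambda>z. P (lft z) (list_decode (rgt z)))"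
  shows "semidec (\<lambda>x. \<exists>y. P x y)"
proof -
  have "(\<exists>y. P x y) \<longleftrightarrow> (\<exists>n. P x (list_decode n))" for x
    by (metis list_encode_inverse)
  then show ?thesis using semidec_ex[OF assms] by simp
qed

lemma semidec_conj [semidec_intros]:
  assumes "semidec P" "semidec Q"
  shows "semidec (\<lambda>x. P x \<and> Q x)"
proof -
  obtain D where D: "dec D" "\<And>x. P x \<longleftrightarrow> (\<exists>n. D (prod_encode (x, n)))"
    using assms by (auto simp: semidec_def)
  obtain E where E: "dec E" "\<And>x. Q x \<longleftrightarrow> (\<exists>n. E (prod_encode (x, n)))"
    using assms by (auto simp: semidec_def)
  have "semidec (\<lambda>x. \<exists>n m. D (prod_encode (x, n)) \<and> E (prod_encode (x, m)))"
    by (rule semidec_ex, rule semidec_ex, rule semidec_dec)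
      (intro rec_intros dec_comp[OF D(1)] dec_comp[OF E(1)])
  then show ?thesis by (simp add: D(2) E(2))
qed

lemma semidec_disj [semidec_intros]:
  assumes "semidec P" "semidec Q"
  shows "semidec (\<lambda>x. P x \<or> Q x)"
proof -
  obtain D where D: "dec D" "\<And>x. P x \<longleftrightarrow> (\<exists>n. D (prod_encode (x, n)))"
    using assms by (auto simp: semidec_def)
  obtain E where E: "dec E" "\<And>x. Q x \<longleftrightarrow> (\<exists>n. E (prod_encode (x, n)))"
    using assms by (auto simp: semidec_def)
  have "semidec (\<lambda>x. \<exists>n m. D (prod_encode (x, n)) \<or> E (prod_encode (x, m)))"
    by (rule semidec_ex, rule semidec_ex, rule semidec_dec)
      (intro rec_intros dec_comp[OF D(1)] dec_comp[OF E(1)])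
  then show ?thesis by (simp add: D(2) E(2))
qed

lemma semidec_imp [semidec_intros]: "dec P \<Longrightarrow> semidec Q \<Longrightarrow> semidec (\<lambda>x. P x \<longrightarrow> Q x)"
  unfolding imp_conv_disj by (rule semidec_disj[OF semidec_dec[OF dec_not]])

lemmas semidec_atoms [semidec_intros] =
  dec_eq[THEN semidec_dec] dec_le[THEN semidec_dec] dec_less[THEN semidec_dec]
  dec_list_eq[THEN semidec_dec] dec_mem_set_decode[THEN semidec_dec] dec_not[THEN semidec_dec]

text \<open>Finitely many witnesses have a common bound \<open>N\<close>, so one unbounded search
  for \<open>N\<close> can be placed in front of the bounded quantifiers.\<close>

lemma semidec_ball [semidec_intros]:
  assumes "recf b" "semidec (\<lambda>z. P (lft z) (rgt z))"
  shows "semidec (\<lambda>x. \<forall>y<b x. P x y)"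
proof -
  obtain D where D: "dec D" "\<And>x. P (lft x) (rgt x) \<longleftrightarrow> (\<exists>n. D (prod_encode (x, n)))"
    using assms by (auto simp: semidec_def)
  have P: "P x y \<longleftrightarrow> (\<exists>n. D (prod_encode (prod_encode (x, y), n)))" for x y
    using D(2)[of "prod_encode (x, y)"] by simp
  have "(\<forall>y<b x. P x y) \<longleftrightarrow> (\<exists>N. \<forall>y<b x. \<exists>n<N. D (prod_encode (prod_encode (x, y), n)))" for x
  proof
    assume "\<forall>y<b x. P x y"
    then obtain f where f: "\<And>y. y < b x \<Longrightarrow> D (prod_encode (prod_encode (x, y), f y))"
      unfolding P by metis
    have "f y < Suc (Max (f ` {..<b x}))" if "y < b x" for y
      using that by (auto simp: less_Suc_eq_le intro!: Max_ge)
    with f show "\<exists>N. \<forall>y<b x. \<exists>n<N. D (prod_encode (prod_encode (x, y), n))" by blast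
  qed (auto simp: P)
  moreover have "semidec (\<lambda>x. \<exists>N. \<forall>y<b x. \<exists>n<N. D (prod_encode (prod_encode (x, y), n)))"
    by (intro semidec_ex semidec_dec rec_intros dec_comp[OF D(1)] recf_comp[OF assms(1)])
  ultimately show ?thesis by simp
qed

lemma ex_list_prefix: "\<exists>n. \<forall>i<m. nth_default 0 (list_decode n) i = f i"
  by (rule exI[of _ "list_encode (map f [0..<m])"]) (simp add: nth_default_def)

text \<open>A whole chain of words is packed into one number \<open>L\<close>, which turns
  reachability into a search over numbers with a bounded check of consecutive entries.\<close>

lemma rtranclp_iff_sequence:
  "R\<^sup>*\<^sup>* (u :: nat list) v \<longleftrightarrow> (\<exists>L n. list_decode (nth_default 0 (list_decode L) 0) = u \<and>
     list_decode (nth_default 0 (list_decode L) n) = v \<and>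
     (\<forall>i<n. R (list_decode (nth_default 0 (list_decode L) i))
        (list_decode (nth_default 0 (list_decode L) (Suc i)))))"
  (is "_ \<longleftrightarrow> ?rhs")
proof
  assume "R\<^sup>*\<^sup>* u v"
  then obtain n where "(R ^^ n) u v" by (auto simp: rtranclp_power)
  then obtain f where f: "f 0 = u" "f n = v" "\<And>i. i < n \<Longrightarrow> R (f i) (f (Suc i))"
    by (auto simp: relpowp_fun_conv)
  obtain L where "\<forall>i<Suc n. nth_default 0 (list_decode L) i = list_encode (f i)"
    using ex_list_prefix[of "Suc n" "\<lambda>i. list_encode (f i)"] by blast
  then have L: "list_decode (nth_default 0 (list_decode L) i) = f i" if "i \<le> n" for i
    using that by simp
  show ?rhs
  proof (rule exI[of _ L], rule exI[of _ n], intro conjI allI impI)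
    fix i assume "i < n"
    then show "R (list_decode (nth_default 0 (list_decode L) i))
        (list_decode (nth_default 0 (list_decode L) (Suc i)))"
      using f(3)[of i] L[of i] L[of "Suc i"] by (simp only: less_imp_le Suc_leI)
  qed (simp_all only: L f(1,2) le0 order_refl)
next
  assume ?rhs
  then obtain L n where "list_decode (nth_default 0 (list_decode L) 0) = u"
     "list_decode (nth_default 0 (list_decode L) n) = v"
     "\<forall>i<n. R (list_decode (nth_default 0 (list_decode L) i))
        (list_decode (nth_default 0 (list_decode L) (Suc i)))" by blast
  then have "(R ^^ n) u v"
    unfolding relpowp_fun_conv by (intro exI[of _ "\<lambda>i. list_decode (nth_default 0 (list_decode L) i)"]) auto
  then show "R\<^sup>*\<^sup>* u v" by (rule relpowp_imp_rtranclp)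
qed

lemma semidec_rtranclp:
  assumes R: "semidec (\<lambda>z. R (lft z) (list_decode (lft (rgt z))) (list_decode (rgt (rgt z))))"
    and "recf c" "recl f" "recl g"
  shows "semidec (\<lambda>x. (R (c x))\<^sup>*\<^sup>* (f x) (g x))"
proof -
  have *: "semidec (\<lambda>z. R (c1 z) (list_decode (u z)) (list_decode (v z)))"
    if "recf c1" "recf u" "recf v" for c1 u v
    using semidec_comp[OF R, of "\<lambda>z. prod_encode (c1 z, prod_encode (u z, v z))"] that
    by (simp add: rec_intros)
  show ?thesis
    unfolding rtranclp_iff_sequence
    by (intro semidec_intros * rec_intros recf_comp[OF assms(2)]
        recl_comp[OF assms(3)] recl_comp[OF assms(4)])
qed

text \<open>The search runs over pairs of an output and a witness, with a total test, and then
  projects to the output. \<open>R\<close> has to be the graph of \<open>F\<close> on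
  \<open>P\<close> only: elsewhere the search may run forever or find a wrong value.\<close>

lemma computable_on_semidec:
  assumes "semidec R" and R: "\<And>x y. x \<in> P \<Longrightarrow> R (prod_encode (enc x, y)) \<longleftrightarrow> y = out (F x)"
  shows "computable_on P enc out F"
proof -
  obtain D where D: "dec D" "\<And>x. R x \<longleftrightarrow> (\<exists>n. D (prod_encode (x, n)))"
    using assms by (auto simp: semidec_def)
  let ?t = "\<lambda>a n. D (prod_encode (prod_encode (a, lft n), rgt n))"
  have "recf (\<lambda>z. of_bool (\<not> ?t (lft z) (rgt z)))"
    by (intro dec_not[unfolded dec_def] dec_comp[OF D(1), unfolded dec_def] rec_intros)
  from partial_recursive.comp[OF partial_recursive.left
      partial_recursive.mu[OF this[unfolded recf_def]]]
  have f: "partial_recursive (\<lambda>a. Option.bind (minimize (\<lambda>n. Some (of_bool (\<not> ?t a n)))) (\<lambda>n. Some (lft n)))"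
    (is "partial_recursive ?f")
    by simp
  have "?f (enc x) = Some (out (F x))" if "x \<in> P" for x
  proof -
    have "R (prod_encode (enc x, out (F x)))" using R[OF that] by simp
    then obtain m where "D (prod_encode (prod_encode (enc x, out (F x)), m))" by (auto simp: D(2))
    then have "?t (enc x) (prod_encode (out (F x), m))" by simp
    then have ex: "\<exists>n. ?t (enc x) n" by blast
    from LeastI_ex[OF this] have "R (prod_encode (enc x, lft (LEAST n. ?t (enc x) n)))"
      by (auto simp: D(2))
    with ex show ?thesis using R[OF that] by (simp add: minimize_def)
  qed
  then show ?thesis
    unfolding computable_on_def by (intro exI[of _ ?f] conjI ballI f)
qed

text \<open>Post's theorem under a promise: \<open>A\<close> and \<open>B\<close> are complementary
  on codes of elements of \<open>P\<close> and may be unrelated elsewhere.\<close>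

lemma computable_on_bool:
  assumes "semidec A" "semidec B"
    and "\<And>x. x \<in> P \<Longrightarrow> A (enc x) \<longleftrightarrow> F x" "\<And>x. x \<in> P \<Longrightarrow> B (enc x) \<longleftrightarrow> \<not> F x"
  shows "computable_on P enc of_bool F"
proof (rule computable_on_semidec)
  show "semidec (\<lambda>z. (rgt z = 1 \<and> A (lft z)) \<or> (rgt z = 0 \<and> B (lft z)))"
    by (intro semidec_disj semidec_conj semidec_atoms(1) recf_rgt recf_id recf_const recf_lft semidec_comp[OF assms(1)] semidec_comp[OF assms(2)])
next
  fix x y assume "x \<in> P"
  then show "(rgt (prod_encode (enc x, y)) = 1 \<and> A (lft (prod_encode (enc x, y)))) \<or>
      (rgt (prod_encode (enc x, y)) = 0 \<and> B (lft (prod_encode (enc x, y)))) \<longleftrightarrow> y = of_bool (F x)"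
    by (cases "F x") (simp_all add: assms(3,4))
qed

section \<open>Words up to commutation\<close>

locale commutation =
  fixes adj :: "'v \<Rightarrow> 'v \<Rightarrow> bool"
  assumes adj_sym: "adj s t \<Longrightarrow> adj t s" and adj_irrefl [simp]: "\<not> adj s s"
begin

text \<open>Words are equal up to swaps of commuting letters iff their projections to all pairs of
  non-commuting letters agree. Taking \<open>s = t\<close> counts the occurrences of \<open>s\<close>.\<close>

definition trace_eq :: "'v list \<Rightarrow> 'v list \<Rightarrow> bool" where
  "trace_eq u v \<longleftrightarrow>
     (\<forall>s t. \<not> adj s t \<longrightarrow> filter (\<lambda>x. x = s \<or> x = t) u = filter (\<lambda>x. x = s \<or> x = t) v)"

text \<open>The letters that can be swapped to the first place. As \<open>adj\<close> is
  irreflexive, only the first occurrence of \<open>s\<close> counts.\<close>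

fun front :: "'v \<Rightarrow> 'v list \<Rightarrow> bool" where
  "front s [] \<longleftrightarrow> False"
| "front s (t # w) \<longleftrightarrow> s = t \<or> adj s t \<and> front s w"

text \<open>No letter can be swapped next to a later copy of itself. By
  \<open>reduced_iff_len\<close> these are the shortest words for their group elements.\<close>

fun reduced :: "'v list \<Rightarrow> bool" where
  "reduced [] \<longleftrightarrow> True"
| "reduced (s # w) \<longleftrightarrow> reduced w \<and> \<not> front s w"

text \<open>Left multiplication by \<open>s\<close> on reduced words. Following van der Waerden,
  letters are shown to act, up to swaps, by involutions that commute where required; this replaces a
  confluence argument.\<close>

definition ins :: "'v \<Rightarrow> 'v list \<Rightarrow> 'v list" where
  "ins s w = (if front s w then remove1 s w else s # w)"

definition nf :: "'v list \<Rightarrow> 'v list" where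
  "nf w = foldr ins w []"

definition eqv :: "'v list \<Rightarrow> 'v list \<Rightarrow> bool" where
  "eqv u v \<longleftrightarrow> trace_eq (nf u) (nf v)"

definition len :: "'v list \<Rightarrow> nat" where
  "len w = length (nf w)"

definition descent :: "'v \<Rightarrow> 'v list \<Rightarrow> bool" where
  "descent s w \<longleftrightarrow> front s (nf w)"

section \<open>Commutation classes\<close>

lemma trace_eq_refl [simp]: "trace_eq u u"
  by (simp add: trace_eq_def)

lemma trace_eq_sym: "trace_eq u v \<Longrightarrow> trace_eq v u"
  by (simp add: trace_eq_def)

lemma trace_eq_trans [trans]: "trace_eq u v \<Longrightarrow> trace_eq v w \<Longrightarrow> trace_eq u w"
  by (simp add: trace_eq_def)

lemma trace_eq_append: "trace_eq u u' \<Longrightarrow> trace_eq v v' \<Longrightarrow> trace_eq (u @ v) (u' @ v')"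
  by (simp add: trace_eq_def)

lemma trace_eq_Cons [simp]: "trace_eq (s # u) (s # v) \<longleftrightarrow> trace_eq u v"
  unfolding trace_eq_def by (intro all_cong1 imp_cong HOL.refl) simp

lemma trace_eq_rev: "trace_eq u v \<Longrightarrow> trace_eq (rev u) (rev v)"
  by (simp add: trace_eq_def rev_filter[symmetric])

lemma trace_eq_mset: "trace_eq u v \<Longrightarrow> mset u = mset v"
proof (rule multiset_eqI)
  fix s assume "trace_eq u v"
  then have "filter (\<lambda>x. x = s) u = filter (\<lambda>x. x = s) v"
    unfolding trace_eq_def by (metis (mono_tags, lifting) adj_irrefl filter_cong)
  then have "mset (filter (\<lambda>x. x = s) u) = mset (filter (\<lambda>x. x = s) v)" by simp
  then have "count (filter_mset (\<lambda>x. x = s) (mset u)) s = count (filter_mset (\<lambda>x. x = s) (mset v)) s"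
    by simp
  then show "count (mset u) s = count (mset v) s" by simp
qed

lemma trace_eq_set: "trace_eq u v \<Longrightarrow> set u = set v"
  by (metis trace_eq_mset set_mset_mset)

lemma trace_eq_length: "trace_eq u v \<Longrightarrow> length u = length v"
  by (metis trace_eq_mset size_mset)

lemma trace_eq_Nil [simp]: "trace_eq [] v \<longleftrightarrow> v = []" "trace_eq v [] \<longleftrightarrow> v = []"
  using trace_eq_length by fastforce+

lemma trace_eq_move:
  assumes "\<forall>t\<in>set p. adj s t"
  shows "trace_eq (p @ s # q) (s # p @ q)"
  unfolding trace_eq_def
proof (intro allI impI)
  fix a b assume ab: "\<not> adj a b"
  show "filter (\<lambda>x. x = a \<or> x = b) (p @ s # q) = filter (\<lambda>x. x = a \<or> x = b) (s # p @ q)"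
  proof (cases "s = a \<or> s = b")
    case True
    then have "filter (\<lambda>x. x = a \<or> x = b) p = []"
      using assms ab adj_sym by (auto simp: filter_empty_conv)
    then show ?thesis by simp
  qed simp
qed

lemma front_iff: "front s w \<longleftrightarrow> (\<exists>p q. w = p @ s # q \<and> (\<forall>t\<in>set p. adj s t))"
proof (induction w)
  case (Cons a w)
  show ?case
  proof
    assume "front s (a # w)"
    then consider "s = a" | "adj s a" "front s w" by auto
    then show "\<exists>p q. a # w = p @ s # q \<and> (\<forall>t\<in>set p. adj s t)"
    proof cases
      case 1
      then show ?thesis by (intro exI[of _ "[]"] exI[of _ w]) simp
    next
      case 2
      then obtain p q where "w = p @ s # q" "\<forall>t\<in>set p. adj s t" using Cons by blast
      then show ?thesis using 2 by (intro exI[of _ "a # p"] exI[of _ q]) simp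
    qed
  next
    assume "\<exists>p q. a # w = p @ s # q \<and> (\<forall>t\<in>set p. adj s t)"
    then obtain p q where *: "a # w = p @ s # q" "\<forall>t\<in>set p. adj s t" by blast
    then show "front s (a # w)"
      using Cons by (cases p) auto
  qed
qed simp

lemma front_append: "front s (u @ v) \<longleftrightarrow> front s u \<or> (\<forall>t\<in>set u. adj s t) \<and> front s v"
  by (induction u) auto

lemma front_in_set: "front s w \<Longrightarrow> s \<in> set w"
  by (auto simp: front_iff)

lemma remove1_front:
  assumes "front s w"
  shows "trace_eq w (s # remove1 s w)"
proof -
  obtain p q where w: "w = p @ s # q" "\<forall>t\<in>set p. adj s t"
    using assms by (auto simp: front_iff)
  then have "s \<notin> set p" by auto
  then have "remove1 s w = p @ q" using w by (simp add: remove1_append)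
  then show ?thesis using trace_eq_move w by simp
qed

text \<open>Take the first \<open>s\<close> in \<open>v\<close>. If a letter \<open>t\<close> before
  it did not commute with \<open>s\<close>, the projections to \<open>s\<close> and \<open>t\<close>
  would begin with \<open>s\<close> for one word and with \<open>t\<close> for the other.\<close>

lemma trace_eq_ConsD:
  assumes "trace_eq (s # u) v"
  shows "\<exists>p q. v = p @ s # q \<and> (\<forall>t\<in>set p. adj s t) \<and> trace_eq u (p @ q)"
proof -
  have "s \<in> set v" using trace_eq_set[OF assms] by auto
  then obtain p q where v: "v = p @ s # q" "s \<notin> set p" by (metis split_list_first)
  have adj: "\<forall>t\<in>set p. adj s t"
  proof (rule ballI, rule ccontr)
    fix t assume "t \<in> set p" "\<not> adj s t"
    then have "filter (\<lambda>x. x = s \<or> x = t) (s # u) = filter (\<lambda>x. x = s \<or> x = t) (p @ s # q)"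
      using assms unfolding trace_eq_def v by blast
    then have "s = hd (filter (\<lambda>x. x = s \<or> x = t) p @ s # filter (\<lambda>x. x = s \<or> x = t) q)"
      by (metis (mono_tags, lifting) filter.simps(2) filter_append list.sel(1))
    moreover have "filter (\<lambda>x. x = s \<or> x = t) p \<noteq> []"
      using \<open>t \<in> set p\<close> by (auto simp: filter_empty_conv)
    ultimately have "s \<in> set (filter (\<lambda>x. x = s \<or> x = t) p)"
      by (metis hd_append2 list.set_sel(1))
    then show False using v by simp
  qed
  then have "trace_eq (s # u) (s # p @ q)"
    using assms trace_eq_move v trace_eq_trans by blast
  then show ?thesis using v adj by auto
qed

lemma front_iff_trace_eq: "front s w \<longleftrightarrow> (\<exists>u. trace_eq w (s # u))"
proof
  assume "\<exists>u. trace_eq w (s # u)"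
  then show "front s w" using trace_eq_ConsD trace_eq_sym by (metis front_iff)
qed (use remove1_front in blast)

lemma front_trace_eq: "trace_eq u v \<Longrightarrow> front s u \<longleftrightarrow> front s v"
  unfolding front_iff_trace_eq using trace_eq_trans trace_eq_sym by metis

lemma trace_eq_fold:
  assumes f: "\<And>s t q. adj s t \<Longrightarrow> f t (f s q) = f s (f t q)"
    and "trace_eq u v"
  shows "fold f u q = fold f v q"
  using assms(2)
proof (induction u arbitrary: v q)
  case (Cons s u)
  then obtain a b where v: "v = a @ s # b" "\<forall>t\<in>set a. adj s t" "trace_eq u (a @ b)"
    using trace_eq_ConsD by blast
  have "\<forall>t\<in>set a. adj s t \<Longrightarrow> fold f a (f s q) = f s (fold f a q)" for q
    by (induction a arbitrary: q) (auto simp: f[of s])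
  then show ?case using Cons.IH[OF v(3)] v by simp
qed simp

lemma reduced_move:
  assumes "\<forall>t\<in>set p. adj s t"
  shows "reduced (p @ s # q) \<longleftrightarrow> reduced (s # p @ q)"
  using assms
proof (induction p)
  case (Cons x p)
  then have "reduced ((x # p) @ s # q) \<longleftrightarrow> reduced (s # p @ q) \<and> \<not> front x (s # p @ q)"
    using front_trace_eq[OF trace_eq_move[of p s q]] by simp
  also have "\<dots> \<longleftrightarrow> reduced (s # x # p @ q)"
    using Cons.prems adj_sym by auto
  finally show ?case by simp
qed simp

lemma reduced_trace_eq: "trace_eq u v \<Longrightarrow> reduced u \<longleftrightarrow> reduced v"
proof (induction u arbitrary: v)
  case (Cons s u)
  then obtain p q where v: "v = p @ s # q" "\<forall>t\<in>set p. adj s t" "trace_eq u (p @ q)"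
    using trace_eq_ConsD by blast
  then have "reduced v \<longleftrightarrow> reduced (s # p @ q)" using reduced_move by simp
  then show ?case using Cons.IH[OF v(3)] front_trace_eq[OF v(3)] by simp
qed simp

section \<open>Left multiplication on reduced words\<close>

lemma ins_trace_eq:
  assumes "trace_eq u v"
  shows "trace_eq (ins s u) (ins s v)"
proof (cases "front s u")
  case True
  then have "front s v" using assms front_trace_eq by blast
  then have "trace_eq (s # remove1 s u) (s # remove1 s v)"
    using remove1_front[OF True] remove1_front[of s v] assms trace_eq_trans trace_eq_sym by meson
  then show ?thesis using True \<open>front s v\<close> by (simp add: ins_def)
next
  case False
  then show ?thesis using assms front_trace_eq[OF assms] by (simp add: ins_def)
qed

lemma ins_cancel: "trace_eq w (s # u) \<Longrightarrow> trace_eq (ins s w) u"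
  using ins_trace_eq[of w "s # u" s] by (simp add: ins_def)

lemma ins_Cons: "\<not> front s w \<Longrightarrow> ins s w = s # w"
  by (simp add: ins_def)

lemma reduced_ins: "reduced w \<Longrightarrow> reduced (ins s w)"
  unfolding ins_def using reduced_trace_eq[OF remove1_front] by auto

text \<open>In a reduced word, deleting a front \<open>s\<close> leaves no further \<open>s\<close>
  that can come to the front. In general two deletions may follow each other: from
  \<open>[s, s]\<close> the two steps lead to \<open>[]\<close>.\<close>

lemma ins_ins:
  assumes "reduced w"
  shows "trace_eq (ins s (ins s w)) w"
proof (cases "front s w")
  case True
  then have w: "trace_eq w (s # remove1 s w)" by (rule remove1_front)
  then have "\<not> front s (remove1 s w)" using assms reduced_trace_eq by force
  then show ?thesis using True w by (simp add: ins_def trace_eq_sym)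
next
  case False
  then show ?thesis by (simp add: ins_def)
qed

lemma trace_eq_swap: "adj s t \<Longrightarrow> trace_eq (s # t # w) (t # s # w)"
  using trace_eq_move[of "[s]" t w] adj_sym by simp

lemma ins_commute:
  assumes "adj s t"
  shows "trace_eq (ins s (ins t w)) (ins t (ins s w))"
proof -
  have [simp]: "s \<noteq> t" "t \<noteq> s" "adj t s" using assms adj_sym by auto
  \<comment> \<open>The mixed case, in which exactly one of the two letters cancels; stated for
    arbitrary letters, it serves both orders.\<close>
  have one: "trace_eq (ins s (ins t w)) (ins t (ins s w))"
    if "front s w" "\<not> front t w" "adj s t" "s \<noteq> t" for s t
  proof -
    define w1 where "w1 = remove1 s w"
    have w: "trace_eq w (s # w1)" using remove1_front that w1_def by simp
    then have "\<not> front t w1" using that front_trace_eq[OF w] adj_sym by auto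
    moreover have "trace_eq (ins t w) (s # t # w1)"
      using that w trace_eq_swap[of s t w1] trace_eq_trans trace_eq_sym
      by (metis ins_Cons trace_eq_Cons)
    ultimately show ?thesis
      using ins_cancel ins_cancel[OF w] ins_trace_eq[OF ins_cancel[OF w], of t]
      by (metis ins_Cons trace_eq_sym trace_eq_trans)
  qed
  consider "front s w" "front t w" | "front s w" "\<not> front t w" | "\<not> front s w" "front t w"
    | "\<not> front s w" "\<not> front t w" by blast
  then show ?thesis
  proof cases
    case 1
    define w1 where "w1 = remove1 s w"
    define w2 where "w2 = remove1 t w1"
    have w: "trace_eq w (s # w1)" using remove1_front 1 w1_def by simp
    then have "front t (s # w1)" using 1 front_trace_eq by blast
    then have w1: "trace_eq w1 (t # w2)" using remove1_front w2_def by simp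
    then have w': "trace_eq w (t # s # w2)"
      using w trace_eq_swap[OF assms] trace_eq_trans trace_eq_Cons by meson
    have "trace_eq (ins t (ins s w)) w2"
      using ins_cancel[OF w] w1 ins_cancel trace_eq_trans by blast
    moreover have "trace_eq (ins s (ins t w)) w2"
      using ins_cancel[OF w'] ins_cancel by blast
    ultimately show ?thesis using trace_eq_trans trace_eq_sym by blast
  next
    case 2
    then show ?thesis using one[of s t] assms by simp
  next
    case 3
    then show ?thesis using one[of t s] by (simp add: trace_eq_sym)
  next
    case 4
    then show ?thesis using trace_eq_swap[OF assms] by (simp add: ins_def)
  qed
qed

lemma foldr_ins_trace_eq: "trace_eq x y \<Longrightarrow> trace_eq (foldr ins w x) (foldr ins w y)"
  by (induction w) (auto intro: ins_trace_eq)

lemma reduced_foldr_ins: "reduced x \<Longrightarrow> reduced (foldr ins w x)"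
  by (induction w) (auto intro: reduced_ins)

lemma foldr_ins_move:
  "\<forall>t\<in>set p. adj s t \<Longrightarrow> trace_eq (foldr ins p (ins s x)) (ins s (foldr ins p x))"
proof (induction p)
  case (Cons a p)
  then have "trace_eq (ins a (foldr ins p (ins s x))) (ins a (ins s (foldr ins p x)))"
    by (intro ins_trace_eq) auto
  also have "trace_eq \<dots> (ins s (ins a (foldr ins p x)))"
    using Cons.prems by (intro ins_commute) (auto intro: adj_sym)
  finally show ?case by simp
qed simp

lemma trace_eq_foldr_ins: "trace_eq u v \<Longrightarrow> trace_eq (foldr ins u x) (foldr ins v x)"
proof (induction u arbitrary: v)
  case (Cons s u)
  then obtain p q where v: "v = p @ s # q" "\<forall>t\<in>set p. adj s t" "trace_eq u (p @ q)"
    using trace_eq_ConsD by blast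
  have "trace_eq (foldr ins (s # u) x) (ins s (foldr ins (p @ q) x))"
    using Cons.IH[OF v(3)] ins_trace_eq by simp
  also have "trace_eq \<dots> (foldr ins v x)"
    using foldr_ins_move[OF v(2)] trace_eq_sym by (simp add: v(1))
  finally show ?case .
qed simp

lemma reduced_nf: "reduced (nf w)"
  by (simp add: nf_def reduced_foldr_ins)

lemma nf_Cons: "nf (s # w) = ins s (nf w)"
  by (simp add: nf_def)

lemma nf_Nil [simp]: "nf [] = []"
  by (simp add: nf_def)

lemma nf_reduced: "reduced w \<Longrightarrow> nf w = w"
  by (induction w) (auto simp: nf_Cons ins_def)

lemma nf_nf [simp]: "nf (nf w) = nf w"
  using nf_reduced reduced_nf by blast

lemma nf_append: "nf (u @ v) = foldr ins u (nf v)"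
  by (simp add: nf_def)

text \<open>If \<open>s\<close> cancels, then \<open>nf w\<close> is \<open>s\<close> followed by
  \<open>nf (s # w)\<close> up to swaps, and two insertions of \<open>s\<close> undo each other on a
  reduced word. This makes \<open>eqv\<close> compatible with concatenation.\<close>

lemma foldr_ins_nf:
  assumes "reduced x"
  shows "trace_eq (foldr ins (nf w) x) (foldr ins w x)"
proof (induction w)
  case (Cons s w)
  show ?case
  proof (cases "front s (nf w)")
    case True
    then have "trace_eq (nf w) (s # nf (s # w))"
      using remove1_front by (simp add: nf_Cons ins_def)
    then have "trace_eq (ins s (ins s (foldr ins (nf (s # w)) x))) (ins s (foldr ins (nf w) x))"
      using trace_eq_foldr_ins[of "nf w" "s # nf (s # w)" x] ins_trace_eq trace_eq_sym by simp
    then have "trace_eq (foldr ins (nf (s # w)) x) (ins s (foldr ins (nf w) x))"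
      using ins_ins[OF reduced_foldr_ins[OF assms]] trace_eq_sym trace_eq_trans by blast
    then show ?thesis using ins_trace_eq[OF Cons.IH, of s] trace_eq_trans by simp
  next
    case False
    then show ?thesis using Cons ins_trace_eq by (simp add: nf_Cons ins_def)
  qed
qed simp

section \<open>Equality of group elements\<close>

lemma eqv_refl [simp]: "eqv u u"
  by (simp add: eqv_def)

lemma eqv_sym: "eqv u v \<Longrightarrow> eqv v u"
  by (simp add: eqv_def trace_eq_sym)

lemma eqv_trans [trans]: "eqv u v \<Longrightarrow> eqv v w \<Longrightarrow> eqv u w"
  unfolding eqv_def by (rule trace_eq_trans)

lemma eqv_nf [simp]: "eqv (nf w) w" "eqv w (nf w)"
  by (simp_all add: eqv_def)

lemma trace_eq_imp_eqv: "trace_eq u v \<Longrightarrow> eqv u v"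
  unfolding eqv_def nf_def by (rule trace_eq_foldr_ins)

lemma eqv_reduced: "reduced u \<Longrightarrow> reduced v \<Longrightarrow> eqv u v \<longleftrightarrow> trace_eq u v"
  by (simp add: eqv_def nf_reduced)

lemma eqv_append:
  assumes "eqv u u'" "eqv v v'"
  shows "eqv (u @ v) (u' @ v')"
proof -
  have "trace_eq (foldr ins u (nf v)) (foldr ins (nf u) (nf v))"
    by (rule trace_eq_sym[OF foldr_ins_nf[OF reduced_nf]])
  also have "trace_eq \<dots> (foldr ins (nf u') (nf v))"
    using assms(1) unfolding eqv_def by (rule trace_eq_foldr_ins)
  also have "trace_eq \<dots> (foldr ins u' (nf v))"
    by (rule foldr_ins_nf[OF reduced_nf])
  also have "trace_eq \<dots> (foldr ins u' (nf v'))"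
    using assms(2) unfolding eqv_def by (rule foldr_ins_trace_eq)
  finally show ?thesis by (simp add: eqv_def nf_append)
qed

lemma eqv_square: "eqv [s, s] []"
  by (simp add: eqv_def nf_Cons ins_def)

lemma eqv_cancel_square: "eqv (u @ s # s # v) (u @ v)"
  using eqv_append[OF eqv_append[OF eqv_refl[of u] eqv_square[of s]] eqv_refl[of v]] by simp

lemma eqv_commute: "adj s t \<Longrightarrow> eqv [s, t] [t, s]"
  by (rule trace_eq_imp_eqv[OF trace_eq_swap])

lemma eqv_rev_append: "eqv (rev w @ w) []"
proof (induction w)
  case (Cons s w)
  have "eqv (rev w @ s # s # w) (rev w @ w)" by (rule eqv_cancel_square)
  then show ?case using Cons eqv_trans by simp
qed simp

lemma eqv_append_rev: "eqv (w @ rev w) []"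
  using eqv_rev_append[of "rev w"] by simp

lemma eqv_cancel_left: "eqv (u @ v) (u @ w) \<longleftrightarrow> eqv v w"
proof
  assume "eqv (u @ v) (u @ w)"
  then have "eqv (rev u @ u @ v) (rev u @ u @ w)" by (rule eqv_append[OF eqv_refl])
  moreover have "eqv (rev u @ u @ x) x" for x
    using eqv_append[OF eqv_rev_append eqv_refl[of x]] by simp
  ultimately show "eqv v w" by (meson eqv_sym eqv_trans)
qed (rule eqv_append[OF eqv_refl])

lemma eqv_cancel_right: "eqv (v @ u) (w @ u) \<longleftrightarrow> eqv v w"
proof
  assume "eqv (v @ u) (w @ u)"
  then have "eqv (v @ u @ rev u) (w @ u @ rev u)" using eqv_append[OF _ eqv_refl] by fastforce
  moreover have "eqv (x @ u @ rev u) x" for x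
    using eqv_append[OF eqv_refl[of x] eqv_append_rev[of u]] by simp
  ultimately show "eqv v w" by (meson eqv_sym eqv_trans)
qed (rule eqv_append[OF _ eqv_refl])

lemma eqv_Cons: "eqv (s # u) (s # v) \<longleftrightarrow> eqv u v"
  using eqv_cancel_left[of "[s]"] by simp

lemma eqv_move_left: "eqv u (v @ w) \<longleftrightarrow> eqv (rev v @ u) w"
proof -
  have "eqv (rev v @ v @ w) w" using eqv_append[OF eqv_rev_append eqv_refl[of w]] by simp
  then show ?thesis
    using eqv_cancel_left[of "rev v" u "v @ w"] by (meson eqv_sym eqv_trans)
qed

lemma eqv_rev: "eqv u v \<Longrightarrow> eqv (rev u) (rev v)"
proof -
  assume "eqv u v"
  then have "eqv (rev v @ u) []"
    using eqv_move_left[of u v "[]"] by simp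
  then have "eqv (rev v @ u @ rev u) (rev u)"
    using eqv_append[OF _ eqv_refl[of "rev u"]] by fastforce
  moreover have "eqv (rev v @ u @ rev u) (rev v)"
    using eqv_append[OF eqv_refl[of "rev v"] eqv_append_rev[of u]] by simp
  ultimately show ?thesis by (meson eqv_sym eqv_trans)
qed

section \<open>Length and descents\<close>

lemma length_ins: "length (ins s w) = (if front s w then length w - 1 else Suc (length w))"
  by (simp add: ins_def length_remove1 front_in_set)

lemma len_Cons: "len (s # w) = (if descent s w then len w - 1 else Suc (len w))"
  by (simp add: len_def nf_Cons length_ins descent_def)

lemma descent_len_pos: "descent s w \<Longrightarrow> len w > 0"
  by (cases "nf w") (auto simp: descent_def len_def)

lemma descent_iff_len: "descent s w \<longleftrightarrow> len (s # w) < len w"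
  using descent_len_pos[of s w] by (auto simp: len_Cons)

lemma len_le_length: "len w \<le> length w"
  by (induction w) (auto simp: len_Cons len_def[of "[]"])

lemma eqv_len: "eqv u v \<Longrightarrow> len u = len v"
  by (simp add: eqv_def len_def trace_eq_length)

lemma eqv_descent: "eqv u v \<Longrightarrow> descent s u \<longleftrightarrow> descent s v"
  by (simp add: eqv_def descent_def front_trace_eq)

lemma descent_Cons: "descent s (s # w) \<longleftrightarrow> \<not> descent s w"
proof -
  have "len (s # s # w) = len w" using eqv_len[OF eqv_cancel_square[of "[]"]] by simp
  then show ?thesis unfolding descent_iff_len using len_Cons[of s w] descent_len_pos[of s w]
    by (auto split: if_splits)
qed

lemma descent_reduced: "reduced w \<Longrightarrow> descent s w \<longleftrightarrow> front s w"
  by (simp add: descent_def nf_reduced)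

lemma len_rev: "len (rev w) = len w"
proof -
  have "len (rev w) \<le> len w" for w
    using eqv_len[OF eqv_rev[OF eqv_nf(1)[of w]]] len_le_length[of "rev (nf w)"] by (simp add: len_def)
  from this[of w] this[of "rev w"] show ?thesis by simp
qed

lemma reduced_iff_len: "reduced w \<longleftrightarrow> len w = length w"
proof
  show "len w = length w \<Longrightarrow> reduced w"
  proof (induction w)
    case (Cons s w)
    then have "\<not> descent s w" "len w = length w"
      using len_le_length[of w] by (auto simp: len_Cons split: if_splits)
    then show ?case using Cons.IH by (simp add: descent_reduced)
  qed simp
qed (simp add: len_def nf_reduced)

lemma reduced_rev [simp]: "reduced (rev w) \<longleftrightarrow> reduced w"
  by (simp add: reduced_iff_len len_rev)

lemma reduced_Cons_front: "trace_eq w (s # u) \<Longrightarrow> reduced w \<Longrightarrow> reduced u \<and> \<not> front s u"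
  using reduced_trace_eq by fastforce

lemma reduced_append_iff:
  "reduced (a @ b) \<longleftrightarrow> reduced a \<and> reduced b \<and> \<not> (\<exists>s. front s (rev a) \<and> front s b)"
proof (induction a)
  case (Cons x a)
  have "front x (a @ b) \<longleftrightarrow> front x a \<or> (\<forall>t\<in>set a. adj x t) \<and> front x b"
    by (rule front_append)
  moreover have "front s (rev (x # a)) \<longleftrightarrow> front s (rev a) \<or> s = x \<and> (\<forall>t\<in>set a. adj x t)" for s
    by (auto simp: front_append)
  ultimately show ?case using Cons.IH by auto
qed simp

text \<open>Besides cancellation within neighbouring blocks, only a letter commuting with the whole
  of \<open>b\<close> can cancel across it.\<close>

lemma reduced_append3:
  "reduced (a @ b @ c) \<longleftrightarrow> reduced (a @ b) \<and> reduced (b @ c) \<and>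
     \<not> (\<exists>s. front s (rev a) \<and> (\<forall>t\<in>set b. adj s t) \<and> front s c)"
  unfolding reduced_append_iff[of a] reduced_append_iff[of b] front_append by blast

text \<open>Only positions below the length are quantified over, which makes reducedness decidable
  on coded words.\<close>

lemma reduced_iff_no_cancel:
  "reduced w \<longleftrightarrow> (\<forall>j<length w. \<forall>i<j. w ! i = w ! j \<longrightarrow> (\<exists>k<j. i < k \<and> \<not> adj (w ! i) (w ! k)))"
proof (induction w)
  case (Cons s w)
  have "front s w \<longleftrightarrow> (\<exists>j<length w. s = w ! j \<and> (\<forall>k<j. adj s (w ! k)))"
  proof
    assume "front s w"
    then obtain p q where "w = p @ s # q" "\<forall>t\<in>set p. adj s t" by (auto simp: front_iff)
    then show "\<exists>j<length w. s = w ! j \<and> (\<forall>k<j. adj s (w ! k))"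
      by (intro exI[of _ "length p"]) (auto simp: nth_append)
  next
    assume "\<exists>j<length w. s = w ! j \<and> (\<forall>k<j. adj s (w ! k))"
    then obtain j where j: "j < length w" "s = w ! j" "\<forall>k<j. adj s (w ! k)" by blast
    then show "front s w"
      unfolding front_iff by (intro exI[of _ "take j w"] exI[of _ "drop (Suc j) w"])
        (auto simp: id_take_nth_drop[symmetric] in_set_conv_nth)
  qed
  moreover have "(\<forall>j<length (s # w). \<forall>i<j. (s # w) ! i = (s # w) ! j \<longrightarrow>
        (\<exists>k<j. i < k \<and> \<not> adj ((s # w) ! i) ((s # w) ! k))) \<longleftrightarrow>
      (\<forall>j<length w. (s = w ! j \<longrightarrow> (\<exists>k<j. \<not> adj s (w ! k))) \<and>
        (\<forall>i<j. w ! i = w ! j \<longrightarrow> (\<exists>k<j. i < k \<and> \<not> adj (w ! i) (w ! k))))"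
    by (simp add: All_less_Suc2 Ex_less_Suc2)
  ultimately show ?case using Cons.IH by (simp only: reduced.simps) blast
qed simp

lemma nf_set: "set (nf w) \<subseteq> set w"
proof (induction w)
  case (Cons s w)
  then show ?case using set_remove1_subset[of s "nf w"] by (auto simp: nf_Cons ins_def)
qed simp

text \<open>The number of copies of \<open>s\<close> modulo 2 is a homomorphism to the group of
  order two: prepending a letter and deleting it change the parity in the same way.\<close>

lemma nf_parity: "even (count (mset (nf w)) s) \<longleftrightarrow> even (count (mset w) s)"
proof (induction w)
  case (Cons t w)
  have "even (count (mset (ins t u)) s) \<longleftrightarrow> even (count (mset (t # u)) s)" for u
  proof (cases "front t u")
    case True
    define r where "r = remove1 t u"
    have "mset u = mset (t # r)"
      using trace_eq_mset[OF remove1_front[OF True]] r_def by simp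
    moreover have "ins t u = r" using True by (simp add: ins_def r_def)
    ultimately show ?thesis by simp
  qed (simp add: ins_def)
  then show ?case using Cons by (simp add: nf_Cons)
qed simp

end

section \<open>Half-spaces, powers and convex hulls\<close>

context commutation
begin

text \<open>Right multiplication by \<open>c\<close> crosses the wall of \<open>s\<close>. If
  \<open>y @ [c]\<close> is reduced, the new front letter \<open>s\<close> must be \<open>c\<close>
  itself and commute with all of \<open>y\<close>. Otherwise \<open>y\<close> ends in
  \<open>c\<close> up to swaps, and a front \<open>s\<close> of the shortened word would already be
  one of \<open>y\<close>.\<close>

lemma exchange:
  assumes "\<not> descent s z" "descent s (z @ [c])"
  shows "eqv (s # z) (z @ [c])"
proof -
  define y where "y = nf z"
  have y: "reduced y" "eqv y z" by (simp_all add: y_def reduced_nf)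
  have yc: "eqv (y @ [c]) (z @ [c])" using y eqv_append by simp
  have ny: "\<not> front s y" using assms(1) by (simp add: y_def descent_def)
  have dy: "descent s (y @ [c])" using assms(2) eqv_descent[OF yc] by simp
  have "eqv (s # y) (y @ [c])"
  proof (cases "reduced (y @ [c])")
    case True
    then have "front s (y @ [c])" using dy descent_reduced by blast
    then have "s = c" "\<forall>t\<in>set y. adj s t" using ny by (auto simp: front_append)
    then show ?thesis
      using trace_eq_move[of y s "[]"] by (simp add: trace_eq_imp_eqv eqv_sym)
  next
    case False
    have "front c (rev y)"
    proof (rule ccontr)
      assume "\<not> front c (rev y)"
      then have "reduced (rev (y @ [c]))" using y by simp
      then show False using False by (simp only: reduced_rev)
    qed
    then obtain r where r: "trace_eq (rev y) (c # r)" by (auto simp: front_iff_trace_eq)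
    then have red: "reduced (rev r)" using reduced_Cons_front y by auto
    have yr: "trace_eq y (rev r @ [c])" using trace_eq_rev[OF r] by simp
    then have "eqv (y @ [c]) (rev r @ [c] @ [c])"
      using eqv_append[OF trace_eq_imp_eqv eqv_refl] by fastforce
    then have "eqv (y @ [c]) (rev r)"
      using eqv_cancel_square[of "rev r" c "[]"] eqv_trans by simp
    then have "front s (rev r)" using dy eqv_descent descent_reduced[OF red] by blast
    then have "front s (rev r @ [c])" by (simp add: front_append)
    then show ?thesis using ny front_trace_eq[OF yr] by simp
  qed
  moreover have "eqv (s # y) (s # z)" using y(2) by (simp add: eqv_Cons)
  ultimately show ?thesis using yc by (meson eqv_sym eqv_trans)
qed

text \<open>The words without descent \<open>s\<close> form a half-space of the Cayley graph; its translates and their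
  complements are all the half-spaces.\<close>

lemma descent_square:
  assumes "adj t u" "\<not> descent s z" "\<not> descent s (z @ [t])" "\<not> descent s (z @ [u])"
  shows "\<not> descent s (z @ [t, u])"
proof
  assume "descent s (z @ [t, u])"
  then have "eqv (s # z @ [t]) (z @ [t, u])" using exchange[of s "z @ [t]" u] assms by simp
  also have "eqv (z @ [t, u]) (z @ [u, t])" using eqv_commute[OF assms(1)] by (simp add: eqv_cancel_left)
  \<comment> \<open>Opposite edges of a square cross the same wall, so \<open>z @ [u]\<close> would
    lie beyond it as well.\<close>
  finally have "eqv (s # z) (z @ [u])" using eqv_cancel_right[of "s # z" "[t]" "z @ [u]"] by simp
  then show False using eqv_descent[of "s # z" "z @ [u]" s] assms descent_Cons by blast
qed

text \<open>Follow \<open>p\<close> up to the first edge that crosses the wall; by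
  \<open>exchange\<close>, left multiplication by \<open>s\<close> moves one end of this edge to the
  other.\<close>

lemma crossing:
  assumes "\<not> descent s a" "descent s (a @ p)"
  shows "\<exists>p1 c m. p = p1 @ c # m \<and> eqv (s # a @ p1) (a @ p1 @ [c])"
  using assms
proof (induction p arbitrary: a)
  case (Cons c p)
  show ?case
  proof (cases "descent s (a @ [c])")
    case True
    then show ?thesis
      using exchange Cons.prems by (intro exI[of _ "[]"] exI[of _ c] exI[of _ p]) simp
  next
    case False
    then obtain p1 d m where "p = p1 @ d # m" "eqv (s # (a @ [c]) @ p1) ((a @ [c]) @ p1 @ [d])"
      using Cons.IH[of "a @ [c]"] Cons.prems by auto
    then show ?thesis by (intro exI[of _ "c # p1"] exI[of _ d] exI[of _ m]) simp
  qed
qed simp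

text \<open>A path that crosses the wall and returns can be shortened by reflecting the part in
  between: the crossing letters \<open>c\<close> and \<open>d\<close> disappear, and
  \<open>p1 @ m @ v1\<close> replaces the reduced word \<open>u @ v1 @ [d]\<close>, which is two
  letters longer.\<close>

lemma descent_convex:
  assumes "\<not> descent s a" "\<not> descent s (a @ u @ v)" "reduced (u @ v)"
  shows "\<not> descent s (a @ u)"
proof
  assume d: "descent s (a @ u)"
  then obtain p1 c m where u: "u = p1 @ c # m" "eqv (s # a @ p1) (a @ p1 @ [c])"
    using crossing assms(1) by blast
  have "eqv (s # a @ u) (a @ p1 @ c # c # m)"
    using eqv_append[OF u(2) eqv_refl[of "c # m"]] by (simp add: u(1))
  also have "eqv \<dots> (a @ p1 @ m)"
    using eqv_cancel_square[of "a @ p1"] by simp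
  finally have su: "eqv (s # a @ u) (a @ p1 @ m)" .
  have "\<not> descent s (s # a @ u)" "descent s ((s # a @ u) @ v)"
    using d assms by (simp_all add: descent_Cons)
  then obtain v1 d m' where v: "v = v1 @ d # m'"
    "eqv (s # (s # a @ u) @ v1) ((s # a @ u) @ v1 @ [d])"
    using crossing by blast
  have "eqv (a @ u @ v1) (s # (s # a @ u) @ v1)"
    using eqv_cancel_square[of "[]" s] eqv_sym by simp
  also note v(2)
  also have "eqv ((s # a @ u) @ v1 @ [d]) ((a @ p1 @ m) @ v1 @ [d])"
    by (rule eqv_append[OF su eqv_refl])
  finally have "eqv (u @ v1) (p1 @ m @ v1 @ [d])" by (simp add: eqv_cancel_left)
  then have "eqv ((u @ v1) @ [d]) ((p1 @ m @ v1 @ [d]) @ [d])" by (rule eqv_append[OF _ eqv_refl])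
  also have "eqv \<dots> (p1 @ m @ v1)" using eqv_cancel_square[of "p1 @ m @ v1" d "[]"] by simp
  finally have "len (u @ v1 @ [d]) \<le> length (p1 @ m @ v1)"
    using eqv_len len_le_length[of "p1 @ m @ v1"] by fastforce
  moreover have "reduced (u @ v1 @ [d])"
    using assms(3) reduced_append_iff[of "u @ v1 @ [d]" m'] v(1) by simp
  ultimately show False using u(1) by (simp add: reduced_iff_len)
qed

section \<open>Cyclic reduction and powers\<close>

lemma cyclic_reduction:
  "\<exists>x u. trace_eq w (x @ u @ rev x) \<and> \<not> (\<exists>s y. trace_eq u (s # y @ [s]))"
proof (induction "length w" arbitrary: w rule: less_induct)
  case less
  show ?case
  proof (cases "\<exists>s y. trace_eq w (s # y @ [s])")
    case True
    then obtain s y where w: "trace_eq w (s # y @ [s])" by blast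
    then have "length y < length w" using trace_eq_length by fastforce
    then obtain x u where xu: "trace_eq y (x @ u @ rev x)" "\<not> (\<exists>s y. trace_eq u (s # y @ [s]))"
      using less by blast
    have "trace_eq ([s] @ y @ [s]) ([s] @ (x @ u @ rev x) @ [s])"
      by (intro trace_eq_append xu) simp_all
    then have "trace_eq w ((s # x) @ u @ rev (s # x))" using w trace_eq_trans by simp
    then show ?thesis using xu by blast
  next
    case False
    then show ?thesis by (intro exI[of _ "[]"] exI[of _ w]) simp
  qed
qed

text \<open>If \<open>s\<close> can come first and can come last, but not as two separate copies,
  then a single copy does both, so it commutes with all other letters.\<close>

lemma front_both:
  assumes "front s u" "front s (rev u)" "\<not> (\<exists>y. trace_eq u (s # y @ [s]))"
  shows "\<exists>y. trace_eq u (s # y) \<and> s \<notin> set y \<and> (\<forall>t\<in>set y. adj s t)"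
proof -
  obtain y where y: "trace_eq u (s # y)" using assms by (auto simp: front_iff_trace_eq)
  have "front s (rev y @ [s])"
    using assms(2) front_trace_eq[OF trace_eq_rev[OF y]] by simp
  moreover have "\<not> front s (rev y)"
  proof
    assume "front s (rev y)"
    then obtain z where "trace_eq (rev y) (s # z)" by (auto simp: front_iff_trace_eq)
    then have "trace_eq y (rev z @ [s])" using trace_eq_rev by fastforce
    then have "trace_eq u (s # rev z @ [s])" using y trace_eq_trans trace_eq_Cons by blast
    then show False using assms by blast
  qed
  ultimately have "\<forall>t\<in>set y. adj s t" by (auto simp: front_append)
  then show ?thesis using y by (auto intro!: exI[of _ y])
qed

abbreviation wpow :: "'v list \<Rightarrow> nat \<Rightarrow> 'v list" where
  "wpow v n \<equiv> concat (replicate n v)"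

lemma wpow_Suc_right: "wpow v (Suc n) = wpow v n @ v"
  by (induction n) auto

lemma wpow_add: "wpow v (m + n) = wpow v m @ wpow v n"
  by (simp add: replicate_add)

lemma wpow_mult: "wpow v (m * n) = wpow (wpow v m) n"
  by (induction n) (simp_all add: wpow_add)

lemma rev_wpow: "rev (wpow v n) = wpow (rev v) n"
  by (simp add: rev_concat)

lemma set_wpow: "set (wpow v n) \<subseteq> set v"
  by auto

lemma eqv_wpow: "eqv u v \<Longrightarrow> eqv (wpow u n) (wpow v n)"
  by (induction n) (auto intro: eqv_append)

lemma eqv_conj_power: "eqv (wpow (x @ v @ rev x) n) (x @ wpow v n @ rev x)"
proof (induction n)
  case 0
  then show ?case using eqv_append_rev eqv_sym by simp
next
  case (Suc n)
  have "eqv (wpow (x @ v @ rev x) (Suc n)) ((x @ v @ rev x) @ x @ wpow v n @ rev x)"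
    using eqv_append[OF eqv_refl[of "x @ v @ rev x"] Suc] by simp
  also have "eqv \<dots> (x @ wpow v (Suc n) @ rev x)"
    using eqv_append[OF eqv_rev_append eqv_refl[of "wpow v n @ rev x"], of x]
    by (simp add: eqv_cancel_left)
  finally show ?case .
qed

text \<open>A cancellation across a junction needs a letter \<open>s\<close> that can end
  \<open>u\<close> and can begin the following power. As \<open>s\<close> does not commute with
  itself, it cannot pass the first copy of \<open>u\<close>, hence it can begin that copy.\<close>

lemma reduced_power:
  assumes "reduced u" "\<not> (\<exists>s. front s u \<and> front s (rev u))"
  shows "reduced (wpow u n)"
proof (induction n)
  case (Suc n)
  have "\<not> (\<exists>s. front s (rev u) \<and> front s (wpow u n))"
  proof
    assume "\<exists>s. front s (rev u) \<and> front s (wpow u n)"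
    then obtain s where s: "front s (rev u)" "front s (wpow u n)" by blast
    then have "s \<in> set u" using front_in_set by fastforce
    then have "\<not> (\<forall>t\<in>set u. adj s t)" by (metis adj_irrefl)
    then have "front s u" using s(2) by (cases n) (auto simp: front_append)
    then show False using s assms by blast
  qed
  then show ?case using assms(1) Suc by (simp add: reduced_append_iff)
qed simp

lemma reduced_append_power:
  assumes "reduced (x @ u)" "\<not> (\<exists>s. front s u \<and> front s (rev u))"
  shows "reduced (x @ wpow u (Suc n))"
proof -
  have u: "reduced u" using assms(1) by (simp add: reduced_append_iff)
  have "\<not> (\<exists>s. front s (rev x) \<and> (\<forall>t\<in>set u. adj s t) \<and> front s (wpow u n))"
  proof clarify
    fix s assume "\<forall>t\<in>set u. adj s t" "front s (wpow u n)"
    then show False using front_in_set set_wpow by (metis adj_irrefl subsetD)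
  qed
  then show ?thesis
    using reduced_append3[of x u "wpow u n"] reduced_power[OF u assms(2), of "Suc n"] assms(1)
    by simp
qed

lemma reduced_conj_power:
  assumes "reduced (x @ u @ rev x)" "\<not> (\<exists>s. front s u \<and> front s (rev u))"
  shows "reduced (x @ wpow u (Suc n) @ rev x)"
proof -
  have *: "reduced (x @ u)" "reduced (u @ rev x)"
    "\<not> (\<exists>s. front s (rev x) \<and> (\<forall>t\<in>set u. adj s t) \<and> front s (rev x))"
    using assms(1) reduced_append3[of x u "rev x"] by auto
  \<comment> \<open>The right-hand conjugator is treated by reversing the word, which turns
    \<open>u\<close> into \<open>rev u\<close>.\<close>
  have "reduced (x @ rev u)" using *(2) reduced_rev[of "u @ rev x"] by simp
  then have "reduced (x @ wpow (rev u) (Suc n))"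
    using assms(2) by (intro reduced_append_power) auto
  then have "reduced (rev (x @ wpow (rev u) (Suc n)))" by (simp only: reduced_rev)
  then have "reduced (wpow u (Suc n) @ rev x)" by (simp only: rev_append rev_wpow rev_rev_ident)
  moreover have "\<not> (\<exists>s. front s (rev x) \<and> (\<forall>t\<in>set (wpow u (Suc n)). adj s t) \<and> front s (rev x))"
    using *(3) by auto
  ultimately show ?thesis
    using reduced_append_power[OF *(1) assms(2)] by (simp only: reduced_append3) blast
qed

text \<open>Every letter occurs an even number of times in a square, so no letter of the cyclically reduced
  part commutes with all of it, which is the only obstruction to its powers being reduced.\<close>

lemma square_conj_power:
  "\<exists>x v. eqv (g @ g) (x @ v @ rev x) \<and> (\<forall>n. reduced (x @ wpow v (Suc n) @ rev x))"
proof -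
  obtain x u where xu: "trace_eq (nf (g @ g)) (x @ u @ rev x)"
    and cyc: "\<not> (\<exists>s y. trace_eq u (s # y @ [s]))"
    using cyclic_reduction by blast
  have "\<not> (\<exists>s. front s u \<and> front s (rev u))"
  proof
    assume "\<exists>s. front s u \<and> front s (rev u)"
    then obtain s y where y: "trace_eq u (s # y)" "s \<notin> set y" using front_both cyc by blast
    have "count (mset u) s = 1" using trace_eq_mset[OF y(1)] y(2) by (simp add: count_mset_0_iff)
    moreover have "even (count (mset (x @ u @ rev x)) s)"
      using nf_parity[of "g @ g" s] trace_eq_mset[OF xu] by simp
    ultimately show False by simp
  qed
  moreover have "reduced (x @ u @ rev x)" using reduced_nf reduced_trace_eq[OF xu] by blast
  moreover have "eqv (g @ g) (x @ u @ rev x)"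
    using trace_eq_imp_eqv[OF xu] eqv_nf(2) eqv_trans by blast
  ultimately show ?thesis using reduced_conj_power by blast
qed

text \<open>The reduced form of every positive power of \<open>g @ g\<close> contains
  \<open>x\<close> and \<open>v\<close>; if one of them is empty, then so are \<open>x\<close> and
  \<open>v\<close>.\<close>

lemma torsion_square:
  assumes "eqv (wpow g (Suc n)) []"
  shows "eqv (g @ g) []"
proof -
  obtain x v where xv: "eqv (g @ g) (x @ v @ rev x)" "\<And>n. reduced (x @ wpow v (Suc n) @ rev x)"
    using square_conj_power by blast
  have "eqv (x @ wpow v (Suc n) @ rev x) (wpow (x @ v @ rev x) (Suc n))"
    by (rule eqv_sym[OF eqv_conj_power])
  also have "eqv \<dots> (wpow (g @ g) (Suc n))" by (rule eqv_wpow[OF eqv_sym[OF xv(1)]])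
  also have "wpow (g @ g) (Suc n) = wpow (wpow g (Suc n)) 2"
    using wpow_mult[of 2 "Suc n" g] wpow_mult[of "Suc n" 2 g]
    by (simp add: mult.commute numeral_2_eq_2)
  also have "eqv \<dots> (wpow [] 2)" using assms by (rule eqv_wpow)
  finally have "eqv (x @ wpow v (Suc n) @ rev x) []" by (simp add: numeral_2_eq_2)
  then have "x @ wpow v (Suc n) @ rev x = []"
    using xv(2)[of n] eqv_reduced[OF xv(2), of "[]" n] by simp
  then have "x @ v @ rev x = []" by simp
  then show ?thesis using xv(1) by simp
qed

section \<open>Cliques and involutions\<close>

definition clique :: "'v list \<Rightarrow> bool" where
  "clique k \<longleftrightarrow> distinct k \<and> (\<forall>s\<in>set k. \<forall>t\<in>set k. s \<noteq> t \<longrightarrow> adj s t)"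

text \<open>The first letter of \<open>k\<close> is also a possible last one, and by cyclic
  reducedness both are the same copy. It therefore commutes with the rest, which inherits all three
  hypotheses.\<close>

lemma clique_if_involution:
  assumes "reduced k" "trace_eq k (rev k)" "\<not> (\<exists>s y. trace_eq k (s # y @ [s]))"
  shows "clique k"
  using assms
proof (induction k)
  case Nil
  then show ?case by (simp add: clique_def)
next
  case (Cons s k)
  have "front s (rev (s # k))" using front_trace_eq[OF Cons.prems(2), of s] by simp
  moreover have "\<not> (\<exists>y. trace_eq (s # k) (s # y @ [s]))" using Cons.prems(3) by blast
  ultimately obtain y where y: "trace_eq (s # k) (s # y)" "s \<notin> set y" "\<forall>t\<in>set y. adj s t"
    using front_both[of s "s # k"] by (metis front.simps(2))
  then have k: "s \<notin> set k" "\<forall>t\<in>set k. adj s t" using trace_eq_set[of k y] by auto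
  have "trace_eq (rev k @ [s]) (s # rev k)"
    using trace_eq_move[of "rev k" s "[]"] k by simp
  then have "trace_eq (s # k) (s # rev k)"
    using Cons.prems(2) trace_eq_trans[of "s # k" "rev k @ [s]" "s # rev k"] by simp
  moreover have "\<not> (\<exists>t y. trace_eq k (t # y @ [t]))"
  proof
    assume "\<exists>t y. trace_eq k (t # y @ [t])"
    then obtain t y where ty: "trace_eq k (t # y @ [t])" by blast
    then have "adj s t" using trace_eq_set[OF ty] k by auto
    then have "trace_eq (s # k) (t # (s # y) @ [t])"
      using ty trace_eq_swap[of s t "y @ [t]"] trace_eq_trans[of "s # k" "s # t # y @ [t]"] by simp
    then show False using Cons.prems(3) by blast
  qed
  ultimately have "clique k" using Cons by simp
  then show ?case using k adj_sym by (auto simp: clique_def)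
qed

text \<open>The conjugate is kept reduced as a whole, so that an automaton can read it:
  \<open>x\<close> leads to a state at which \<open>k\<close> is a loop.\<close>

lemma involution_conj_clique:
  assumes "eqv (g @ g) []"
  shows "\<exists>x k. eqv g (x @ k @ rev x) \<and> reduced (x @ k @ rev x) \<and> clique k"
proof -
  obtain x k where xk: "trace_eq (nf g) (x @ k @ rev x)" and cyc: "\<not> (\<exists>s y. trace_eq k (s # y @ [s]))"
    using cyclic_reduction by blast
  have red: "reduced (x @ k @ rev x)" using reduced_nf reduced_trace_eq[OF xk] by blast
  then have "reduced k" by (simp add: reduced_append_iff)
  have g: "eqv g (x @ k @ rev x)" using trace_eq_imp_eqv[OF xk] eqv_nf(2) eqv_trans by blast
  have "eqv (wpow g 2) (x @ wpow k 2 @ rev x)"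
    using eqv_wpow[OF g] eqv_conj_power eqv_trans by blast
  then have "eqv (x @ (k @ k) @ rev x) []"
    using assms by (simp add: numeral_2_eq_2) (meson eqv_sym eqv_trans)
  then have "eqv (x @ (k @ k) @ rev x) (x @ [] @ rev x)"
    using eqv_append_rev[of x] by simp (meson eqv_sym eqv_trans)
  then have "eqv (k @ k) []" by (simp only: eqv_cancel_left eqv_cancel_right)
  then have "eqv k (rev k)" using eqv_move_left[of k "rev k" "[]"] by simp
  then have "clique k"
    using clique_if_involution \<open>reduced k\<close> cyc by (simp add: eqv_reduced)
  then show ?thesis using g red by blast
qed

lemma clique_reduced:
  assumes "clique k"
  shows "reduced k"
proof -
  have "distinct k \<Longrightarrow> reduced k" by (induction k) (auto dest: front_in_set)
  then show ?thesis using assms by (simp add: clique_def)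
qed

text \<open>Lets the search for cliques run over sets of letters, with one arbitrary ordering of
  each.\<close>

lemma clique_trace_eq:
  assumes "clique k" "distinct l" "set l = set k"
  shows "trace_eq k l"
  using assms
proof (induction k arbitrary: l)
  case (Cons s k)
  then obtain p q where l: "l = p @ s # q" by (metis list.set_intros(1) split_list)
  then have "set (p @ q) = set k" "distinct (p @ q)" using Cons.prems by (auto simp: clique_def)
  moreover have "clique k" using Cons.prems by (auto simp: clique_def)
  ultimately have "trace_eq (s # k) (s # p @ q)" using Cons.IH by simp
  moreover have "\<forall>t\<in>set p. adj s t"
    using Cons.prems l unfolding clique_def by (metis UnCI append.assoc distinct_append
        list.set_intros(1) not_distinct_conv_prefix set_append)
  ultimately show ?case using trace_eq_move[of p s q] l trace_eq_sym trace_eq_trans by metis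
qed simp

lemma clique_square:
  assumes "clique k"
  shows "eqv (k @ k) []"
proof -
  have "eqv k (rev k)" using assms by (intro trace_eq_imp_eqv clique_trace_eq) (auto simp: clique_def)
  then have "eqv (k @ k) (rev k @ k)" by (rule eqv_append[OF _ eqv_refl])
  then show ?thesis using eqv_rev_append eqv_trans by blast
qed

end

text \<open>A subgroup is represented by all words over \<open>V\<close> for its elements, so that
  walls and hulls can be treated without passing to classes.\<close>

locale word_group = commutation adj for adj :: "'v \<Rightarrow> 'v \<Rightarrow> bool" +
  fixes V :: "'v set" and G :: "'v list \<Rightarrow> bool"
  assumes finite_V: "finite V"
    and G_lists: "G w \<Longrightarrow> w \<in> lists V"
    and G_Nil: "G []"
    and G_append: "G u \<Longrightarrow> G v \<Longrightarrow> G (u @ v)"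
    and G_rev: "G u \<Longrightarrow> G (rev u)"
    and G_eqv: "G u \<Longrightarrow> eqv u v \<Longrightarrow> v \<in> lists V \<Longrightarrow> G v"
begin

text \<open>The intersection of all half-spaces containing the subgroup; the complement of a half-space is
  obtained by replacing \<open>y\<close> by \<open>y @ [s]\<close>.\<close>

definition in_hull :: "'v list \<Rightarrow> bool" where
  "in_hull x \<longleftrightarrow> x \<in> lists V \<and> (\<forall>y s. descent s (rev y @ x) \<longrightarrow> (\<exists>g. G g \<and> descent s (rev y @ g)))"

lemma nf_lists: "w \<in> lists V \<Longrightarrow> nf w \<in> lists V"
  using nf_set by fastforce

lemma hull_G: "G g \<Longrightarrow> in_hull g"
  using G_lists by (auto simp: in_hull_def)

lemma hull_eqv:
  assumes "in_hull x" "eqv x y" "y \<in> lists V"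
  shows "in_hull y"
proof -
  have "descent s (rev z @ y) \<longleftrightarrow> descent s (rev z @ x)" for s z
    by (rule eqv_descent) (simp add: eqv_cancel_left eqv_sym assms(2))
  then show ?thesis using assms unfolding in_hull_def by blast
qed

lemma hull_translate:
  assumes "G g" "in_hull x"
  shows "in_hull (g @ x)"
  unfolding in_hull_def
proof (intro conjI allI impI)
  show "g @ x \<in> lists V" using assms G_lists unfolding in_hull_def by auto
  fix y s assume "descent s (rev y @ g @ x)"
  then have "descent s (rev (rev g @ y) @ x)" by simp
  then obtain h where h: "G h" "descent s (rev (rev g @ y) @ h)"
    using assms(2) unfolding in_hull_def by blast
  then show "\<exists>h. G h \<and> descent s (rev y @ h)"
    using G_append[OF assms(1)] by (intro exI[of _ "g @ h"]) simp
qed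

text \<open>No wall separates the fourth corner of a square from the other three.\<close>

lemma hull_square:
  assumes "adj t u" "in_hull x" "in_hull (x @ [t])" "in_hull (x @ [u])"
  shows "in_hull (x @ [t, u])"
  unfolding in_hull_def
proof (intro conjI allI impI)
  show "x @ [t, u] \<in> lists V" using assms unfolding in_hull_def by auto
  fix y s assume "descent s (rev y @ x @ [t, u])"
  then have "descent s (rev y @ x) \<or> descent s (rev y @ x @ [t]) \<or> descent s (rev y @ x @ [u])"
    using descent_square[OF assms(1), of s "rev y @ x"] by auto
  then show "\<exists>g. G g \<and> descent s (rev y @ g)" using assms unfolding in_hull_def by blast
qed

text \<open>\<open>u\<close> lies on a geodesic from the identity, a point of the subgroup, to a
  hull point, and half-spaces are convex. Thus a run along a reduced representative will never leave
  the automaton.\<close>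

lemma hull_prefix:
  assumes "in_hull (u @ v)" "reduced (u @ v)"
  shows "in_hull u"
  unfolding in_hull_def
proof (intro conjI allI impI)
  show "u \<in> lists V" using assms unfolding in_hull_def by auto
  fix y s assume "descent s (rev y @ u)"
  then have "descent s (rev y @ []) \<or> descent s (rev y @ u @ v)"
    using descent_convex[of s "rev y" u v] assms(2) by auto
  then show "\<exists>g. G g \<and> descent s (rev y @ g)" using assms(1) G_Nil unfolding in_hull_def by blast
qed

text \<open>Let \<open>g\<close> be a point of the subgroup nearest to \<open>x\<close>, and cut a geodesic from \<open>g\<close> to \<open>x\<close> right after
  its last letter \<open>r\<close>, with the part \<open>p\<close> before it as short as possible. As the wall crossed by this
  letter does not separate \<open>x\<close> from the subgroup, \<open>p\<close> followed by \<open>r\<close> starts a geodesic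
  ending in the subgroup; it stays close to the subgroup, so it is short by the choice of \<open>g\<close>.\<close>

lemma hull_bounded:
  assumes qc: "\<And>p q. G (p @ q) \<Longrightarrow> reduced (p @ q) \<Longrightarrow>
      \<exists>m\<in>lists V. length m \<le> M \<and> G (p @ m)"
    and x: "in_hull x"
  shows "\<exists>g. G g \<and> len (rev g @ x) \<le> card V * M"
proof -
  obtain g where g: "G g" and min: "\<And>h. G h \<Longrightarrow> len (rev g @ x) \<le> len (rev h @ x)"
    using exists_least_iff[of "\<lambda>n. \<exists>g. G g \<and> n = len (rev g @ x)"] G_Nil by (metis not_less)
  define w where "w = nf (rev g @ x)"
  have xl: "x \<in> lists V" using x by (simp add: in_hull_def)
  have w: "reduced w" "eqv (rev g @ x) w" "len (rev g @ x) = length w"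
    by (simp_all add: w_def reduced_nf len_def)
  have wV: "set w \<subseteq> V"
    using nf_set[of "rev g @ x"] G_lists[OF g] xl by (auto simp: w_def)
  \<comment> \<open>Each letter is bounded separately, which is the origin of the factor
    \<open>card V\<close>: every copy of \<open>r\<close> but the last lies in \<open>p\<close>, so
    \<open>Suc (length p) \<le> M\<close> is enough.\<close>
  have count: "count (mset w) r \<le> M" if r: "r \<in> set w" for r
  proof -
    let ?P = "\<lambda>p. \<exists>q. trace_eq w (p @ r # q) \<and> r \<notin> set q"
    have "\<exists>p. ?P p" using split_list_last[OF r] by (metis trace_eq_refl)
    then obtain p where p: "?P p" and pmin: "\<And>p'. ?P p' \<Longrightarrow> length p \<le> length p'"
      using exists_least_iff[of "\<lambda>n. \<exists>p. ?P p \<and> n = length p"] by (metis not_less)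
    then obtain q where q: "trace_eq w (p @ r # q)" "r \<notin> set q" by blast
    have red: "reduced (p @ r # q)" using w(1) reduced_trace_eq[OF q(1)] by simp
    then have redr: "reduced (r # q)" "reduced (p @ [r])"
      using reduced_append_iff[of p "r # q"] reduced_append_iff[of "p @ [r]" q] by auto
    \<comment> \<open>A possible last letter of \<open>p\<close> that commutes with \<open>r\<close>
      could be moved behind \<open>r\<close>, against the choice of \<open>p\<close>. Hence nothing
      cancels between \<open>p\<close> and \<open>r # z\<close> below.\<close>
    have last: "\<not> adj s r" if s: "front s (rev p)" for s
    proof
      assume sr: "adj s r"
      obtain z where "trace_eq (rev p) (s # z)" using s by (auto simp: front_iff_trace_eq)
      then have pz: "trace_eq p (rev z @ [s])" using trace_eq_rev by fastforce
      have "trace_eq (p @ r # q) ((rev z @ [s]) @ r # q)" by (rule trace_eq_append[OF pz]) simp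
      also have "(rev z @ [s]) @ r # q = rev z @ s # r # q" by simp
      also have "trace_eq \<dots> (rev z @ r # s # q)"
        by (rule trace_eq_append[OF _ trace_eq_swap[OF sr]]) simp
      finally have "trace_eq w (rev z @ r # s # q)" using q trace_eq_trans by blast
      moreover have "r \<notin> set (s # q)" using q sr by auto
      ultimately have "length p \<le> length (rev z)" using pmin by blast
      then show False using trace_eq_length[OF pz] by simp
    qed
    have "eqv (rev p @ rev g @ x) (r # q)"
      using eqv_trans[OF w(2) trace_eq_imp_eqv[OF q(1)]] by (simp add: eqv_move_left)
    then have "descent r (rev (g @ p) @ x)"
      using eqv_descent redr(1) descent_reduced by fastforce
    then obtain h where h: "G h" "descent r (rev (g @ p) @ h)"
      using x unfolding in_hull_def by blast
    have hl: "set h \<subseteq> V" "set g \<subseteq> V" using G_lists h(1) g by auto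
    have pV: "set p \<subseteq> V" "r \<in> V" "set q \<subseteq> V" using trace_eq_set[OF q(1)] wV by auto
    define z where "z = remove1 r (nf (rev p @ rev g @ h))"
    have z: "trace_eq (nf (rev p @ rev g @ h)) (r # z)"
      using h(2) remove1_front by (simp add: descent_def z_def)
    then have redz: "reduced (r # z)" using reduced_nf reduced_trace_eq by blast
    have zV: "set z \<subseteq> V"
      using trace_eq_set[OF z] nf_set[of "rev p @ rev g @ h"] hl pV by auto
    have "reduced (p @ r # z)"
    proof -
      have "\<not> (front s (rev p) \<and> front s (r # z))" for s
        using last[of s] redr(2) by (auto simp: reduced_append_iff)
      then show ?thesis using redz redr(2) by (auto simp: reduced_append_iff)
    qed
    moreover have "G (p @ r # z)"
    proof (rule G_eqv)
      show "G (rev g @ h)" using g h G_rev G_append by blast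
      have "eqv (rev p @ rev g @ h) (r # z)"
        using trace_eq_imp_eqv[OF z] eqv_nf(2) eqv_trans by blast
      then show "eqv (rev g @ h) (p @ r # z)" by (simp add: eqv_move_left)
      show "p @ r # z \<in> lists V" using pV zV by auto
    qed
    ultimately obtain m where m: "m \<in> lists V" "length m \<le> M" "G (p @ [r] @ m)"
      using qc[of "p @ [r]" z] by auto
    have "G (g @ p @ [r] @ m)" using g m(3) G_append by blast
    \<comment> \<open>The point \<open>g @ p @ [r] @ m\<close> of the subgroup is at distance at
      most \<open>length m + length q\<close> from \<open>x\<close>, while \<open>w\<close> has
      length \<open>length p + 1 + length q\<close>.\<close>
    then have "length w \<le> len (rev (g @ p @ [r] @ m) @ x)" using min w(3) by metis
    also have "\<dots> = len (rev m @ q)"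
    proof (rule eqv_len)
      have "eqv (rev (p @ [r]) @ rev g @ x) q"
        using eqv_trans[OF w(2) trace_eq_imp_eqv[OF q(1)]] eqv_move_left[of "rev g @ x" "p @ [r]" q]
        by simp
      then have "eqv (rev m @ rev (p @ [r]) @ rev g @ x) (rev m @ q)" by (simp only: eqv_cancel_left)
      then show "eqv (rev (g @ p @ [r] @ m) @ x) (rev m @ q)" by simp
    qed
    also have "\<dots> \<le> length m + length q" using len_le_length[of "rev m @ q"] by simp
    finally have "Suc (length p) \<le> M" using trace_eq_length[OF q(1)] m(2) by simp
    moreover have "count (mset w) r \<le> Suc (length p)"
      using trace_eq_mset[OF q(1)] q(2) count_le_length[of p r]
      by (simp add: count_mset_0_iff count_mset)
    ultimately show ?thesis by simp
  qed
  have "length w = (\<Sum>r\<in>set w. count (mset w) r)"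
    using size_multiset_overloaded_eq[of "mset w"] by simp
  also have "\<dots> \<le> card (set w) * M" using sum_bounded_above[of "set w" "count (mset w)" M] count by simp
  also have "\<dots> \<le> card V * M" using wV finite_V by (simp add: card_mono)
  finally show ?thesis using g w(3) by auto
qed

end

section \<open>Automata for subgroups\<close>

definition run :: "(nat \<Rightarrow> 'v \<Rightarrow> nat) \<Rightarrow> nat \<Rightarrow> 'v list \<Rightarrow> nat" where
  "run \<delta> q w = fold (\<lambda>s q. \<delta> q s) w q"

text \<open>The states are \<open>{1..N}\<close> with base \<open>1\<close>, while \<open>0\<close> stands for a missing edge. The word \<open>r q\<close> represents
  the coset of \<open>q\<close>. The relation \<open>E\<close> is equality in the group; generators need not be reduced, hence only
  some word equal to each of them has to be a loop.\<close>

definition certificate ::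
  "'v set \<Rightarrow> ('v \<Rightarrow> 'v \<Rightarrow> bool) \<Rightarrow> 'v list set \<Rightarrow> ('v list \<Rightarrow> 'v list \<Rightarrow> bool) \<Rightarrow> ('v list \<Rightarrow> bool)
    \<Rightarrow> (nat \<Rightarrow> 'v \<Rightarrow> nat) \<Rightarrow> nat \<Rightarrow> (nat \<Rightarrow> 'v list) \<Rightarrow> bool" where
  "certificate V adj S E G \<delta> N r \<longleftrightarrow>
     0 < N \<and> r 1 = [] \<and>
     (\<forall>q\<in>{1..N}. run \<delta> 1 (r q) = q \<and> r q \<in> lists V) \<and>
     (\<forall>q\<in>{1..N}. \<forall>s\<in>V. \<delta> q s \<le> N \<and>
        (\<delta> q s \<noteq> 0 \<longrightarrow> \<delta> (\<delta> q s) s = q \<and> G (r q @ s # rev (r (\<delta> q s))))) \<and>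
     (\<forall>q\<in>{1..N}. \<forall>s\<in>V. \<forall>t\<in>V. adj s t \<longrightarrow> \<delta> q s \<noteq> 0 \<longrightarrow> \<delta> q t \<noteq> 0 \<longrightarrow>
        \<delta> (\<delta> q s) t = \<delta> (\<delta> q t) s \<and> \<delta> (\<delta> q s) t \<noteq> 0) \<and>
     (\<forall>w\<in>S. \<exists>u. E w u \<and> run \<delta> 1 u = 1)"

lemma run_Nil [simp]: "run \<delta> q [] = q"
  by (simp add: run_def)

lemma run_Cons [simp]: "run \<delta> q (s # w) = run \<delta> (\<delta> q s) w"
  by (simp add: run_def)

lemma run_append [simp]: "run \<delta> q (u @ v) = run \<delta> (run \<delta> q u) v"
  by (simp add: run_def)

locale racg_subgroup = pair_graph \<Gamma> for \<Gamma> :: "'v pair_pre_digraph" +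
  fixes S :: "'v list set"
  assumes finite_S: "finite S" and S_lists: "S \<subseteq> lists (pverts \<Gamma>)"
begin

abbreviation V :: "'v set" where "V \<equiv> pverts \<Gamma>"
abbreviation adj :: "'v \<Rightarrow> 'v \<Rightarrow> bool" where "adj s t \<equiv> (s, t) \<in> parcs \<Gamma>"
abbreviation W :: "'v list set monoid" where "W \<equiv> racg \<Gamma>"
abbreviation cls :: "'v list \<Rightarrow> 'v list set" where "cls \<equiv> racg_word \<Gamma>"
abbreviation H :: "'v list set set" where "H \<equiv> word_subgroup \<Gamma> S"
abbreviation G :: "'v list \<Rightarrow> bool" where "G w \<equiv> cls w \<in> H"

sublocale commutation adj
proof
  show "adj s t \<Longrightarrow> adj t s" for s t
    using pair_sym_arcs by (simp add: arcs_symmetric symmetric_def sym_def)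
  show "\<not> adj s s" for s using no_loops' by blast
qed

sublocale W: group W by (rule group_racg)

lemma adj_in_V: "adj s t \<Longrightarrow> s \<in> V \<and> t \<in> V"
  using wellformed' by blast

section \<open>The word problem\<close>

lemma racg_eq_move:
  assumes "\<forall>t\<in>set p. adj s t" "p @ s # q \<in> lists V"
  shows "racg_eq \<Gamma> (p @ s # q) (s # p @ q)"
  using assms
proof (induction p)
  case (Cons x p)
  then have "racg_eq \<Gamma> ([x] @ (p @ s # q)) ([x] @ (s # p @ q))"
    by (intro racg_eq.append racg_eq.refl) auto
  moreover have "racg_eq \<Gamma> ([x, s] @ (p @ q)) ([s, x] @ (p @ q))"
    using Cons.prems by (intro racg_eq.append racg_eq.commute racg_eq.refl) (auto intro: adj_sym)
  ultimately show ?case by (auto intro: racg_eq.trans)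
qed (simp add: racg_eq.refl)

lemma trace_eq_imp_racg_eq: "trace_eq u v \<Longrightarrow> u \<in> lists V \<Longrightarrow> racg_eq \<Gamma> u v"
proof (induction u arbitrary: v)
  case (Cons s u)
  then obtain p q where v: "v = p @ s # q" "\<forall>t\<in>set p. adj s t" "trace_eq u (p @ q)"
    using trace_eq_ConsD by blast
  have "v \<in> lists V" using trace_eq_set[OF Cons.prems(1)] Cons.prems(2) by auto
  then have "racg_eq \<Gamma> v (s # p @ q)" using racg_eq_move v by blast
  moreover have "racg_eq \<Gamma> ([s] @ u) ([s] @ (p @ q))"
    using Cons v by (intro racg_eq.append racg_eq.refl) auto
  ultimately show ?case by (auto intro: racg_eq.trans racg_eq.sym)
qed (auto intro: racg_eq.refl)

lemma racg_eq_nf: "w \<in> lists V \<Longrightarrow> racg_eq \<Gamma> w (nf w)"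
proof (induction w)
  case (Cons s w)
  then have "racg_eq \<Gamma> w (nf w)" "s \<in> V" by auto
  then have IH: "racg_eq \<Gamma> ([s] @ w) ([s] @ nf w)" "nf w \<in> lists V" "s \<in> V"
    using racg_eq_lists[of w "nf w"] racg_eq.append[OF racg_eq.refl[of "[s]"]] by auto
  show ?case
  proof (cases "front s (nf w)")
    case True
    define y where "y = nf (s # w)"
    have y: "trace_eq (nf w) (s # y)"
      using remove1_front[OF True] True by (simp add: y_def nf_Cons ins_def)
    then have "racg_eq \<Gamma> ([s] @ nf w) ([s] @ (s # y))"
      using IH by (intro racg_eq.append racg_eq.refl trace_eq_imp_racg_eq) auto
    moreover have "y \<in> lists V" using trace_eq_set[OF y] IH by auto
    then have "racg_eq \<Gamma> ([s, s] @ y) ([] @ y)"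
      using IH by (intro racg_eq.append racg_eq.square racg_eq.refl)
    ultimately show ?thesis using IH(1) unfolding y_def
      by (auto intro: racg_eq.trans)
  next
    case False
    then show ?thesis using IH by (simp add: nf_Cons ins_def)
  qed
qed (auto intro: racg_eq.refl)

text \<open>The defining relations hold for \<open>eqv\<close>. Conversely, the relations connect
  every word with its normal form, and also words that differ by swaps.\<close>

lemma racg_eq_iff: "racg_eq \<Gamma> u v \<longleftrightarrow> u \<in> lists V \<and> v \<in> lists V \<and> eqv u v"
proof
  assume uv: "racg_eq \<Gamma> u v"
  then have "eqv u v"
    by (induction rule: racg_eq.induct)
      (auto intro: eqv_square eqv_commute eqv_sym eqv_append elim: eqv_trans)
  then show "u \<in> lists V \<and> v \<in> lists V \<and> eqv u v" using racg_eq_lists uv by blast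
next
  assume uv: "u \<in> lists V \<and> v \<in> lists V \<and> eqv u v"
  then have "racg_eq \<Gamma> (nf u) (nf v)"
    unfolding eqv_def using trace_eq_imp_racg_eq racg_eq_nf racg_eq_lists by blast
  then show "racg_eq \<Gamma> u v"
    using racg_eq.trans[OF racg_eq.trans[OF racg_eq_nf] racg_eq.sym[OF racg_eq_nf]] uv by blast
qed

lemma cls_eq_iff: "u \<in> lists V \<Longrightarrow> v \<in> lists V \<Longrightarrow> cls u = cls v \<longleftrightarrow> eqv u v"
  using racg_word_eq_iff racg_eq_iff by blast

lemma cls_in_carrier: "w \<in> lists V \<Longrightarrow> cls w \<in> carrier W"
  by (auto simp: carrier_racg)

lemma rev_lists: "rev w \<in> lists V \<longleftrightarrow> w \<in> lists V"
  by (simp add: in_lists_conv_set)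

lemma inv_cls: "w \<in> lists V \<Longrightarrow> inv\<^bsub>W\<^esub> cls w = cls (rev w)"
proof -
  assume w: "w \<in> lists V"
  then have "cls (rev w) \<otimes>\<^bsub>W\<^esub> cls w = \<one>\<^bsub>W\<^esub>"
    using racg_word_eqI[OF racg_eq_rev[OF w]] w by (subst mult_racg) (auto simp: one_racg)
  then show ?thesis using w by (intro W.inv_equality) (auto intro: cls_in_carrier)
qed

lemma cls_pow: "w \<in> lists V \<Longrightarrow> cls w [^]\<^bsub>W\<^esub> (n::nat) = cls (wpow w n)"
proof (induction n)
  case (Suc n)
  then have "wpow w n \<in> lists V" by (auto simp: in_lists_conv_set)
  with Suc show ?case by (simp add: mult_racg wpow_Suc_right del: replicate_Suc)
qed (simp add: one_racg)

lemma subgroup_H: "subgroup H W"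
  unfolding word_subgroup_def
  using S_lists by (intro W.generate_is_subgroup) (auto intro: cls_in_carrier)

text \<open>The class of a sequence with a letter outside \<open>V\<close> is empty, hence not an
  element of the group.\<close>

lemma G_in_lists: "G w \<Longrightarrow> w \<in> lists V"
proof -
  assume "G w"
  then have "cls w \<in> carrier W" using subgroup.subset[OF subgroup_H] by blast
  then obtain u where u: "u \<in> lists V" "cls w = cls u" by (auto simp: carrier_racg)
  then have "u \<in> cls w" by (simp add: racg_word_def racg_rel_def racg_eq.refl)
  then show ?thesis using racg_eq_lists by (auto simp: racg_word_def racg_rel_def)
qed

sublocale word_group adj V G
proof
  show "finite V" by (rule pair_finite_verts)
  show "G w \<Longrightarrow> w \<in> lists V" for w by (rule G_in_lists)
  show "G []" using subgroup.one_closed[OF subgroup_H] by (simp add: one_racg)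
  show "G (u @ v)" if "G u" "G v" for u v
    using subgroup.m_closed[OF subgroup_H that] G_in_lists that by (simp add: mult_racg)
  show "G (rev u)" if "G u" for u
    using subgroup.m_inv_closed[OF subgroup_H that] G_in_lists that by (simp add: inv_cls)
  show "G v" if "G u" "eqv u v" "v \<in> lists V" for u v
    using that cls_eq_iff G_in_lists by metis
qed

lemma G_gen: "w \<in> S \<Longrightarrow> G w"
  unfolding word_subgroup_def by (intro generate.incl) simp

text \<open>Induction over \<open>generate\<close> only sees classes, so a property of words that
  depends on the spelling is obtained for one representative \<open>u\<close>.\<close>

lemma G_induct:
  assumes "G w" "P []" "\<And>w. w \<in> S \<Longrightarrow> P w" "\<And>w. w \<in> S \<Longrightarrow> P (rev w)"
    "\<And>u v. G u \<Longrightarrow> G v \<Longrightarrow> P u \<Longrightarrow> P v \<Longrightarrow> P (u @ v)"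
  shows "\<exists>u. eqv w u \<and> G u \<and> P u"
proof -
  have "\<exists>u. x = cls u \<and> G u \<and> P u" if "x \<in> H" for x
    using that unfolding word_subgroup_def
  proof (induction rule: generate.induct)
    case one
    then show ?case using assms(2) G_Nil by (auto simp: one_racg word_subgroup_def)
  next
    case (incl h)
    then show ?case using assms(3) G_gen unfolding word_subgroup_def by auto
  next
    case (inv h)
    then obtain w where w: "w \<in> S" "h = cls w" by auto
    then have "inv\<^bsub>W\<^esub> h = cls (rev w)" using S_lists inv_cls by blast
    then show ?case
      using assms(4)[OF w(1)] G_rev[OF G_gen[OF w(1)], unfolded word_subgroup_def] by blast
  next
    case (eng h1 h2)
    then obtain u v where uv: "h1 = cls u" "G u" "P u" "h2 = cls v" "G v" "P v"
      unfolding word_subgroup_def by blast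
    then have "h1 \<otimes>\<^bsub>W\<^esub> h2 = cls (u @ v)" using G_in_lists mult_racg by simp
    then show ?case using uv assms(5) G_append unfolding word_subgroup_def by blast
  qed
  then obtain u where "cls w = cls u" "G u" "P u" using assms(1) by blast
  then show ?thesis using cls_eq_iff G_in_lists assms(1) by metis
qed

subsection \<open>Quasiconvexity in terms of words\<close>

abbreviation C where "C \<equiv> cayley_graph W (racg_gens \<Gamma>)"

lemma arc_iff:
  assumes "u \<in> lists V"
  shows "(cls u, y) \<in> parcs C \<longleftrightarrow> (\<exists>s\<in>V. y = cls (u @ [s]))"
proof -
  have "inv\<^bsub>W\<^esub> cls [s] = cls [s]" "cls u \<otimes>\<^bsub>W\<^esub> cls [s] = cls (u @ [s])" if "s \<in> V" for s
    using inv_cls[of "[s]"] that assms by (simp_all add: mult_racg)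
  then show ?thesis
    using assms cls_in_carrier by (auto simp: cayley_graph_def racg_gens_def)
qed

lemma awalk_iff:
  "pre_digraph.awalk (with_proj C) x p y \<longleftrightarrow> x \<in> carrier W \<and> set p \<subseteq> parcs C \<and> pcas x p y"
  by (simp add: pre_digraph.awalk_def cas_with_proj_eq) (simp add: cayley_graph_def)

fun walk :: "'v list \<Rightarrow> 'v list \<Rightarrow> ('v list set \<times> 'v list set) list" where
  "walk a [] = []"
| "walk a (s # w) = (cls a, cls (a @ [s])) # walk (a @ [s]) w"

lemma awalk_walk:
  assumes "a \<in> lists V" "w \<in> lists V"
  shows "pre_digraph.awalk (with_proj C) (cls a) (walk a w) (cls (a @ w))"
proof -
  have "set (walk a w) \<subseteq> parcs C \<and> pcas (cls a) (walk a w) (cls (a @ w))"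
    using assms
  proof (induction w arbitrary: a)
    case (Cons s w)
    then have "s \<in> V" "a @ [s] \<in> lists V" "w \<in> lists V" by auto
    then show ?case using Cons.IH[of "a @ [s]"] Cons.prems arc_iff[of a] by auto
  qed simp
  then show ?thesis using assms by (simp add: awalk_iff cls_in_carrier)
qed

lemma length_walk [simp]: "length (walk a w) = length w"
  by (induction w arbitrary: a) auto

lemma walk_verts: "cls (a @ p) \<in> set (pawalk_verts (cls a) (walk a (p @ q)))"
proof (induction p arbitrary: a)
  case Nil
  then show ?case by (cases q) auto
next
  case (Cons s p)
  then show ?case using Cons[of "a @ [s]"] by simp
qed

lemma awalkD:
  assumes "pre_digraph.awalk (with_proj C) (cls a) p y" "a \<in> lists V"
  shows "\<exists>w\<in>lists V. length w = length p \<and> y = cls (a @ w)"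
  using assms
proof (induction p arbitrary: a)
  case Nil
  then show ?case by (auto simp: awalk_iff)
next
  case (Cons e p)
  then have e: "(cls a, snd e) \<in> parcs C" "set p \<subseteq> parcs C" "pcas (snd e) p y"
    by (cases e; auto simp: awalk_iff)+
  then obtain s where s: "s \<in> V" "snd e = cls (a @ [s])" using arc_iff Cons.prems(2) by blast
  then have "a @ [s] \<in> lists V" using Cons.prems(2) by simp
  then obtain w where "w \<in> lists V" "length w = length p" "y = cls ((a @ [s]) @ w)"
    using Cons.IH[of "a @ [s]"] e s cls_in_carrier by (auto simp: awalk_iff)
  then show ?case using s by (intro bexI[of _ "s # w"]) auto
qed

lemma graph_distD:
  assumes "graph_dist C (cls a) (cls b) \<le> enat M" "a \<in> lists V" "b \<in> lists V"
  shows "\<exists>w\<in>lists V. length w \<le> M \<and> eqv (a @ w) b"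
proof -
  have "\<exists>p. pre_digraph.awalk (with_proj C) (cls a) p (cls b) \<and> enat (length p) \<le> enat M"
  proof (rule ccontr)
    assume "\<not> ?thesis"
    then have "enat (Suc M) \<le> graph_dist C (cls a) (cls b)"
      unfolding graph_dist_def by (intro INF_greatest) (auto simp: not_le)
    then have "enat (Suc M) \<le> enat M" using assms(1) by (rule order_trans)
    then show False by simp
  qed
  then obtain p where p: "pre_digraph.awalk (with_proj C) (cls a) p (cls b)" "length p \<le> M" by auto
  obtain w where w: "w \<in> lists V" "length w = length p" "cls b = cls (a @ w)"
    using awalkD[OF p(1) assms(2)] by blast
  moreover have "eqv b (a @ w)" using w cls_eq_iff[of b "a @ w"] assms by simp
  ultimately show ?thesis using p(2) eqv_sym by metis
qed

lemma geodesic_walk: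
  assumes "w \<in> lists V" "reduced w"
  shows "geodesic C (cls []) (walk [] w) (cls w)"
proof -
  have walk: "pre_digraph.awalk (with_proj C) (cls []) (walk [] w) (cls w)"
    using awalk_walk[of "[]" w] assms by simp
  have "length w \<le> length p" if p: "pre_digraph.awalk (with_proj C) (cls []) p (cls w)" for p
  proof -
    obtain v where v: "v \<in> lists V" "length v = length p" "cls w = cls v"
      using awalkD[OF p] by auto
    then have "eqv w v" using cls_eq_iff assms(1) by blast
    then show ?thesis using eqv_len len_le_length[of v] assms(2) v(2) by (simp add: reduced_iff_len)
  qed
  then have "enat (length (walk [] w)) = graph_dist C (cls []) (cls w)"
    unfolding graph_dist_def using walk by (intro antisym INF_greatest INF_lower2[of "walk [] w"]) auto
  then show ?thesis using walk by (simp add: geodesic_def)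
qed

text \<open>Reduced words label geodesics from the identity, so \<open>p\<close> leads to a vertex
  of a geodesic between two elements of the subgroup, and \<open>m\<close> labels a short path
  back.\<close>

lemma quasiconvex_words:
  assumes "quasiconvex W (racg_gens \<Gamma>) H"
  shows "\<exists>M. \<forall>p q. G (p @ q) \<longrightarrow> reduced (p @ q) \<longrightarrow> (\<exists>m\<in>lists V. length m \<le> M \<and> G (p @ m))"
proof -
  obtain M where M: "\<And>u v p x. u \<in> H \<Longrightarrow> v \<in> H \<Longrightarrow> geodesic C u p v \<Longrightarrow>
      x \<in> set (pawalk_verts u p) \<Longrightarrow> \<exists>h\<in>H. graph_dist C x h \<le> enat M"
    using assms unfolding quasiconvex_def by blast
  have "\<exists>m\<in>lists V. length m \<le> M \<and> G (p @ m)" if pq: "G (p @ q)" "reduced (p @ q)" for p q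
  proof -
    have l: "p @ q \<in> lists V" using G_in_lists pq(1) by blast
    have "cls p \<in> set (pawalk_verts (cls []) (walk [] (p @ q)))" using walk_verts[of "[]" p q] by simp
    then obtain h where h: "h \<in> H" "graph_dist C (cls p) h \<le> enat M"
      using M[OF G_Nil pq(1) geodesic_walk[OF l pq(2)]] by blast
    then obtain b where b: "b \<in> lists V" "h = cls b"
      using subgroup.subset[OF subgroup_H] by (auto simp: carrier_racg)
    then obtain m where "m \<in> lists V" "length m \<le> M" "eqv (p @ m) b"
      using graph_distD[of p b M] h l by auto
    then show ?thesis using G_eqv[of b "p @ m"] h b l eqv_sym by auto
  qed
  then show ?thesis by blast
qed

subsection \<open>Cosets\<close>

abbreviation coset :: "'v list \<Rightarrow> 'v list set set" where "coset w \<equiv> H #>\<^bsub>W\<^esub> cls w"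

lemma coset_eq_iff:
  assumes "u \<in> lists V" "v \<in> lists V"
  shows "coset u = coset v \<longleftrightarrow> G (u @ rev v)"
proof -
  have "coset u = coset v \<longleftrightarrow> cls u \<otimes>\<^bsub>W\<^esub> inv\<^bsub>W\<^esub> cls v \<in> H"
  proof
    assume "coset u = coset v"
    then have "cls u \<in> coset v"
      using W.rcos_self[OF _ subgroup_H] assms cls_in_carrier by metis
    then show "cls u \<otimes>\<^bsub>W\<^esub> inv\<^bsub>W\<^esub> cls v \<in> H"
      using subgroup.rcos_module_imp[OF subgroup_H W.is_group] assms cls_in_carrier by blast
  next
    assume "cls u \<otimes>\<^bsub>W\<^esub> inv\<^bsub>W\<^esub> cls v \<in> H"
    then have "cls u \<in> coset v"
      using subgroup.rcos_module_rev[OF subgroup_H W.is_group] assms cls_in_carrier by blast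
    then show "coset u = coset v"
      using W.repr_independence[OF _ _ subgroup_H] assms cls_in_carrier by metis
  qed
  also have "cls u \<otimes>\<^bsub>W\<^esub> inv\<^bsub>W\<^esub> cls v = cls (u @ rev v)"
    using assms by (simp add: mult_racg inv_cls rev_lists)
  finally show ?thesis .
qed

lemma rcosets_eq: "rcosets\<^bsub>W\<^esub> H = coset ` lists V"
  by (auto simp: RCOSETS_def carrier_racg)

lemma coset_append:
  assumes "coset u = coset v" "u \<in> lists V" "v \<in> lists V" "w \<in> lists V"
  shows "coset (u @ w) = coset (v @ w)"
proof -
  have "eqv (u @ rev v) ((u @ w) @ rev (v @ w))"
    using eqv_append[OF eqv_refl[of u] eqv_append[OF eqv_append_rev[of w] eqv_refl[of "rev v"]]]
    by (simp add: eqv_sym)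
  moreover have "(u @ w) @ rev (v @ w) \<in> lists V" using assms by auto
  ultimately show ?thesis
    using assms coset_eq_iff G_eqv[of "u @ rev v" "(u @ w) @ rev (v @ w)"] by auto
qed

lemma coset_eqv:
  assumes "eqv u v" "u \<in> lists V" "v \<in> lists V"
  shows "coset u = coset v"
  using assms cls_eq_iff by metis

lemma torsion_free_iff:
  "torsion_free (W\<lparr>carrier := H\<rparr>) \<longleftrightarrow> (\<forall>w. G w \<longrightarrow> eqv (w @ w) [] \<longrightarrow> eqv w [])"
proof -
  have eq1: "cls w = \<one>\<^bsub>W\<^esub> \<longleftrightarrow> eqv w []" if "w \<in> lists V" for w
    using that cls_eq_iff[of w "[]"] by (simp add: one_racg)
  have "torsion_free (W\<lparr>carrier := H\<rparr>) \<longleftrightarrow>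
      (\<forall>x\<in>H. x \<noteq> \<one>\<^bsub>W\<^esub> \<longrightarrow> (\<forall>n::nat. n > 0 \<longrightarrow> x [^]\<^bsub>W\<^esub> n \<noteq> \<one>\<^bsub>W\<^esub>))"
    by (simp add: torsion_free_def W.nat_pow_consistent[symmetric])
  also have "\<dots> \<longleftrightarrow> (\<forall>w. G w \<longrightarrow> cls w \<noteq> \<one>\<^bsub>W\<^esub> \<longrightarrow> (\<forall>n::nat. n > 0 \<longrightarrow> cls w [^]\<^bsub>W\<^esub> n \<noteq> \<one>\<^bsub>W\<^esub>))"
  proof -
    have "(\<forall>x\<in>H. Q x) \<longleftrightarrow> (\<forall>w. G w \<longrightarrow> Q (cls w))" for Q
      using subgroup.subset[OF subgroup_H] unfolding carrier_racg by blast
    then show ?thesis .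
  qed
  also have "\<dots> \<longleftrightarrow> (\<forall>w. G w \<longrightarrow> \<not> eqv w [] \<longrightarrow> (\<forall>n. n > 0 \<longrightarrow> \<not> eqv (wpow w n) []))"
  proof -
    have "wpow w n \<in> lists V" if "G w" for w n
      using G_in_lists[OF that] by (auto simp: in_lists_conv_set)
    then have "cls w [^]\<^bsub>W\<^esub> n = \<one>\<^bsub>W\<^esub> \<longleftrightarrow> eqv (wpow w n) []" if "G w" for w and n :: nat
      using that G_in_lists by (simp only: cls_pow eq1)
    moreover have "cls w = \<one>\<^bsub>W\<^esub> \<longleftrightarrow> eqv w []" if "G w" for w
      using that G_in_lists eq1 by blast
    ultimately show ?thesis by auto
  qed
  also have "\<dots> \<longleftrightarrow> (\<forall>w. G w \<longrightarrow> eqv (w @ w) [] \<longrightarrow> eqv w [])"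
  proof
    assume *: "\<forall>w. G w \<longrightarrow> \<not> eqv w [] \<longrightarrow> (\<forall>n. n > 0 \<longrightarrow> \<not> eqv (wpow w n) [])"
    show "\<forall>w. G w \<longrightarrow> eqv (w @ w) [] \<longrightarrow> eqv w []"
    proof (intro allI impI, rule ccontr)
      fix w assume "G w" "eqv (w @ w) []" "\<not> eqv w []"
      then show False using *[rule_format, of w 2] by (simp add: numeral_2_eq_2)
    qed
  next
    assume "\<forall>w. G w \<longrightarrow> eqv (w @ w) [] \<longrightarrow> eqv w []"
    then show "\<forall>w. G w \<longrightarrow> \<not> eqv w [] \<longrightarrow> (\<forall>n. n > 0 \<longrightarrow> \<not> eqv (wpow w n) [])"
      using torsion_square by (metis gr0_implies_Suc)
  qed
  finally show ?thesis .
qed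

text \<open>Conjugation by \<open>s\<close> respects products up to an inserted \<open>s s\<close>,
  so generators of \<open>G\<close> suffice. Letters are involutions, so conjugation by letters in
  turn yields conjugation by every element. The resulting condition is finite.\<close>

lemma normal_iff: "H \<lhd> W \<longleftrightarrow> (\<forall>s\<in>V. \<forall>h\<in>S. G (s # h @ [s]))"
proof
  assume "H \<lhd> W"
  show "\<forall>s\<in>V. \<forall>h\<in>S. G (s # h @ [s])"
  proof (intro ballI)
    fix s h assume sh: "s \<in> V" "h \<in> S"
    then have "cls [s] \<otimes>\<^bsub>W\<^esub> cls h \<otimes>\<^bsub>W\<^esub> inv\<^bsub>W\<^esub> cls [s] \<in> H"
      using \<open>H \<lhd> W\<close> G_gen cls_in_carrier by (auto simp: W.normal_inv_iff)
    moreover have "h \<in> lists V" using sh S_lists by blast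
    ultimately show "G (s # h @ [s])" using sh by (simp add: inv_cls mult_racg)
  qed
next
  assume *: "\<forall>s\<in>V. \<forall>h\<in>S. G (s # h @ [s])"
  have one: "G (s # w @ [s])" if "s \<in> V" "G w" for s w
  proof -
    have "\<exists>u. eqv w u \<and> G u \<and> G (s # u @ [s])"
    proof (rule G_induct[OF that(2)])
      show "G (s # [] @ [s])"
        using G_eqv[OF G_Nil eqv_sym[OF eqv_square]] that(1) by simp
      show "G (s # rev h @ [s])" if "h \<in> S" for h
        using * G_rev[of "s # h @ [s]"] that \<open>s \<in> V\<close> by auto
      show "G (s # (u @ v) @ [s])" if "G u" "G v" "G (s # u @ [s])" "G (s # v @ [s])" for u v
      proof (rule G_eqv)
        show "G ((s # u @ [s]) @ (s # v @ [s]))" using that by (intro G_append)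
        show "eqv ((s # u @ [s]) @ (s # v @ [s])) (s # (u @ v) @ [s])"
          using eqv_cancel_square[of "s # u" s "v @ [s]"] by simp
        show "s # (u @ v) @ [s] \<in> lists V" using that G_in_lists by fastforce
      qed
    qed (use * that in auto)
    then obtain u where u: "eqv w u" "G (s # u @ [s])" by blast
    show ?thesis
    proof (rule G_eqv[OF u(2)])
      have "eqv (s # u) (s # w)" using u(1) by (simp add: eqv_Cons eqv_sym)
      from eqv_append[OF this eqv_refl[of "[s]"]] show "eqv (s # u @ [s]) (s # w @ [s])" by simp
      show "s # w @ [s] \<in> lists V" using that G_in_lists by simp
    qed
  qed
  have "G (x @ w @ rev x)" if "x \<in> lists V" "G w" for x w
    using that(1)
  proof (induction x)
    case (Cons s x)
    then show ?case using one[of s "x @ w @ rev x"] by simp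
  qed (use that in simp)
  moreover have "cls x \<otimes>\<^bsub>W\<^esub> cls w \<otimes>\<^bsub>W\<^esub> inv\<^bsub>W\<^esub> cls x = cls (x @ w @ rev x)"
    if "x \<in> lists V" "w \<in> lists V" for x w
    using that by (simp add: mult_racg inv_cls rev_lists)
  ultimately have conj: "cls x \<otimes>\<^bsub>W\<^esub> cls w \<otimes>\<^bsub>W\<^esub> inv\<^bsub>W\<^esub> cls x \<in> H"
    if "x \<in> lists V" "G w" for x w
    using that G_in_lists by simp
  have "x \<otimes>\<^bsub>W\<^esub> h \<otimes>\<^bsub>W\<^esub> inv\<^bsub>W\<^esub> x \<in> H" if xh: "x \<in> carrier W" "h \<in> H" for x h
  proof -
    obtain u w where "u \<in> lists V" "x = cls u" "h = cls w"
      using xh subgroup.subset[OF subgroup_H] unfolding carrier_racg by blast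
    then show ?thesis using conj[of u w] xh by simp
  qed
  then show "H \<lhd> W" using subgroup_H by (auto simp: W.normal_inv_iff)
qed

end

text \<open>The consequences below hold for any certificate that a search may produce. By
  \<open>dead\<close> the value 0 is absorbing, so a run ends in 0 as soon as an edge is
  missing.\<close>

locale racg_certificate = racg_subgroup \<Gamma> S for \<Gamma> :: "'v pair_pre_digraph" and S +
  fixes \<delta> :: "nat \<Rightarrow> 'v \<Rightarrow> nat" and N :: nat and r :: "nat \<Rightarrow> 'v list"
  assumes dead: "\<And>q s. q \<notin> {1..N} \<or> s \<notin> V \<Longrightarrow> \<delta> q s = 0"
    and cert: "certificate V adj S (racg_eq \<Gamma>) G \<delta> N r"
begin

abbreviation Q :: "nat set" where "Q \<equiv> {1..N}"

lemma base_in_Q: "1 \<in> Q"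
  using cert by (simp add: certificate_def)

lemma r_base: "r (Suc 0) = []"
  using cert by (simp add: certificate_def)

lemma run_r: "q \<in> Q \<Longrightarrow> run \<delta> 1 (r q) = q"
  using cert by (simp add: certificate_def)

lemma r_lists: "q \<in> Q \<Longrightarrow> r q \<in> lists V"
  using cert unfolding certificate_def by blast

lemma \<delta>_in_Q: "q \<in> Q \<Longrightarrow> s \<in> V \<Longrightarrow> \<delta> q s \<noteq> 0 \<Longrightarrow> \<delta> q s \<in> Q"
  using cert by (simp add: certificate_def)

lemma \<delta>_inverse: "q \<in> Q \<Longrightarrow> s \<in> V \<Longrightarrow> \<delta> q s \<noteq> 0 \<Longrightarrow> \<delta> (\<delta> q s) s = q"
  using cert by (simp add: certificate_def)

lemma \<delta>_G: "q \<in> Q \<Longrightarrow> s \<in> V \<Longrightarrow> \<delta> q s \<noteq> 0 \<Longrightarrow> G (r q @ s # rev (r (\<delta> q s)))"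
  using cert by (simp add: certificate_def)

lemma \<delta>_square:
  assumes "q \<in> Q" "adj s t" "\<delta> q s \<noteq> 0" "\<delta> q t \<noteq> 0"
  shows "\<delta> (\<delta> q s) t = \<delta> (\<delta> q t) s" "\<delta> (\<delta> q s) t \<noteq> 0"
  using cert assms adj_in_V[OF assms(2)] unfolding certificate_def by blast+

lemma generator_loop: "w \<in> S \<Longrightarrow> \<exists>u\<in>lists V. eqv w u \<and> run \<delta> 1 u = 1"
  using cert unfolding certificate_def racg_eq_iff by blast

lemma \<delta>_dead [simp]: "\<delta> 0 s = 0"
  by (simp add: dead)

lemma run_dead [simp]: "run \<delta> 0 w = 0"
  by (induction w) auto

lemma run_in_Q: "q \<in> Q \<Longrightarrow> w \<in> lists V \<Longrightarrow> run \<delta> q w \<noteq> 0 \<Longrightarrow> run \<delta> q w \<in> Q"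
proof (induction w arbitrary: q)
  case (Cons s w)
  then have "\<delta> q s \<noteq> 0" by (metis run_Cons run_dead)
  then have "\<delta> q s \<in> Q" using Cons.prems \<delta>_in_Q by simp
  then show ?case using Cons by simp
qed simp

text \<open>The closing of squares covers the case of two edges. If \<open>s\<close> has an edge at
  \<open>q\<close> and \<open>t\<close> has none, then reading \<open>s\<close> and \<open>t\<close>
  must fail too: otherwise the square at the state in between would provide an edge \<open>t\<close>
  at \<open>q\<close>.\<close>

lemma \<delta>_commute:
  assumes "adj s t"
  shows "\<delta> (\<delta> q s) t = \<delta> (\<delta> q t) s"
proof (cases "q \<in> Q")
  case False
  then show ?thesis by (simp add: dead)
next
  case q: True
  have *: "\<delta> (\<delta> q s) t = 0" if st: "adj s t" "\<delta> q t = 0" "\<delta> q s \<noteq> 0" for s t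
  proof (rule ccontr)
    assume n: "\<delta> (\<delta> q s) t \<noteq> 0"
    have s: "s \<in> V" using st adj_in_V by blast
    have p: "\<delta> q s \<in> Q" "\<delta> (\<delta> q s) s = q" using \<delta>_in_Q \<delta>_inverse q s st by blast+
    then show False using \<delta>_square(2)[OF p(1) st(1) _ n] q st by simp
  qed
  consider "\<delta> q s = 0" "\<delta> q t = 0" | "\<delta> q s \<noteq> 0" "\<delta> q t = 0" | "\<delta> q s = 0" "\<delta> q t \<noteq> 0"
    | "\<delta> q s \<noteq> 0" "\<delta> q t \<noteq> 0" by blast
  then show ?thesis
    using *[of s t] *[of t s] assms adj_sym[OF assms] \<delta>_square(1)[OF q assms] by cases simp_all
qed

lemma run_trace_eq: "trace_eq u v \<Longrightarrow> run \<delta> q u = run \<delta> q v"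
  unfolding run_def by (rule trace_eq_fold) (erule \<delta>_commute)

lemma run_rev:
  assumes "q \<in> Q" "w \<in> lists V" "run \<delta> q w \<noteq> 0"
  shows "run \<delta> (run \<delta> q w) (rev w) = q"
  using assms
proof (induction w arbitrary: q)
  case (Cons s w)
  then have "\<delta> q s \<noteq> 0" by (metis run_Cons run_dead)
  then have "\<delta> q s \<in> Q" "\<delta> (\<delta> q s) s = q" using Cons.prems \<delta>_in_Q \<delta>_inverse by simp_all
  then show ?case using Cons by simp
qed simp

text \<open>Reading \<open>s\<close> twice along an edge leads back, so cancellation keeps a run
  alive. The converse fails, since a detour may leave the automaton; this singles out reduced words
  as the ones to read.\<close>

lemma run_nf:
  assumes "q \<in> Q" "w \<in> lists V" "run \<delta> q w \<noteq> 0"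
  shows "run \<delta> q (nf w) = run \<delta> q w"
  using assms
proof (induction w arbitrary: q)
  case (Cons s w)
  then have "\<delta> q s \<noteq> 0" by (metis run_Cons run_dead)
  then have p: "\<delta> q s \<in> Q" "\<delta> (\<delta> q s) s = q" using Cons.prems \<delta>_in_Q \<delta>_inverse by simp_all
  then have IH: "run \<delta> q (s # nf w) = run \<delta> q (s # w)" using Cons by simp
  show ?case
  proof (cases "front s (nf w)")
    case True
    then have "trace_eq (nf w) (s # nf (s # w))"
      using remove1_front[OF True] by (simp add: nf_Cons ins_def)
    then have "run \<delta> q (s # nf w) = run \<delta> q (s # s # nf (s # w))"
      using run_trace_eq by simp
    then show ?thesis using IH p(2) by simp
  next
    case False
    then show ?thesis using IH by (simp add: nf_Cons ins_def)
  qed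
qed simp

lemma run_eqv:
  assumes "q \<in> Q" "w \<in> lists V" "run \<delta> q w \<noteq> 0" "eqv w u" "reduced u"
  shows "run \<delta> q u = run \<delta> q w"
proof -
  have "trace_eq (nf w) u" using assms(4,5) by (simp add: eqv_def nf_reduced)
  then show ?thesis using run_trace_eq run_nf assms by metis
qed

lemma run_G:
  assumes "q \<in> Q" "w \<in> lists V" "run \<delta> q w \<noteq> 0"
  shows "G (r q @ w @ rev (r (run \<delta> q w)))"
  using assms
proof (induction w arbitrary: q)
  case Nil
  then show ?case using G_eqv[OF G_Nil eqv_sym[OF eqv_append_rev]] r_lists[of q]
    by (simp add: rev_lists)
next
  case (Cons s w)
  define p where "p = \<delta> q s"
  have "p \<noteq> 0" using Cons.prems p_def by (metis run_Cons run_dead)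
  then have p: "p \<in> Q" "G (r q @ s # rev (r p))"
    using Cons.prems \<delta>_in_Q \<delta>_G by (simp_all add: p_def)
  let ?x = "r (run \<delta> p w)"
  have "G (r p @ w @ rev ?x)" using Cons p p_def by simp
  then have G: "G ((r q @ s # rev (r p)) @ (r p @ w @ rev ?x))" using p G_append by blast
  have eq: "eqv ((r q @ s # rev (r p)) @ (r p @ w @ rev ?x)) (r q @ (s # w) @ rev ?x)"
    using eqv_append[OF eqv_refl[of "r q @ [s]"]
        eqv_append[OF eqv_rev_append[of "r p"] eqv_refl[of "w @ rev ?x"]]] by simp
  have "r q @ (s # w) @ rev ?x \<in> lists V"
    using Cons.prems G_in_lists[OF G] by simp
  then have "G (r q @ (s # w) @ rev ?x)" using G_eqv[OF G eq] by blast
  then show ?case by (simp add: p_def)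
qed

text \<open>Loops compose and can be reversed, so the loops of the generators give one for each
  element of the subgroup, possibly a non-reduced one.\<close>

lemma G_run:
  assumes "G w"
  shows "\<exists>u\<in>lists V. eqv w u \<and> run \<delta> 1 u = 1"
proof -
  let ?P = "\<lambda>w. \<exists>u\<in>lists V. eqv w u \<and> run \<delta> 1 u = 1"
  have "\<exists>u. eqv w u \<and> G u \<and> ?P u"
  proof (rule G_induct[OF assms])
    show "?P []" by (intro bexI[of _ "[]"]) auto
    show "?P (rev w)" if w: "w \<in> S" for w
    proof -
      obtain u where u: "u \<in> lists V" "eqv w u" "run \<delta> 1 u = 1" using generator_loop[OF w] by blast
      then have "run \<delta> 1 (rev u) = 1" using run_rev[OF base_in_Q u(1)] by simp
      then show ?thesis using u eqv_rev by (intro bexI[of _ "rev u"]) (auto simp: rev_lists)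
    qed
    show "?P (u @ v)" if uv: "?P u" "?P v" for u v
    proof -
      obtain u' v' where "u' \<in> lists V" "eqv u u'" "run \<delta> 1 u' = 1"
        "v' \<in> lists V" "eqv v v'" "run \<delta> 1 v' = 1" using uv by blast
      then show ?thesis using eqv_append by (intro bexI[of _ "u' @ v'"]) auto
    qed
  qed (rule generator_loop)
  then show ?thesis using eqv_trans by blast
qed

text \<open>A base loop \<open>w\<close> for the element becomes a path from \<open>p\<close> to
  \<open>q\<close> by reading \<open>rev (r p)\<close> before it and \<open>r q\<close> after it.
  This path is alive and represents the same element as \<open>u\<close>, so the reduced word
  \<open>u\<close> ends in the same state.\<close>

lemma reduced_G_iff_run:
  assumes "reduced u" "u \<in> lists V" "p \<in> Q" "q \<in> Q"
  shows "G (r p @ u @ rev (r q)) \<longleftrightarrow> run \<delta> p u = q"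
proof
  assume "G (r p @ u @ rev (r q))"
  then obtain w where w: "w \<in> lists V" "eqv (r p @ u @ rev (r q)) w" "run \<delta> 1 w = 1"
    using G_run by blast
  let ?x = "rev (r p) @ w @ r q"
  have "run \<delta> p (rev (r p)) = 1"
    using run_rev[OF base_in_Q r_lists[OF assms(3)]] run_r[OF assms(3)] assms(3) by simp
  then have run: "run \<delta> p ?x = q" using w(3) run_r[OF assms(4)] by simp
  have "eqv (u @ rev (r q)) (rev (r p) @ w)"
    using eqv_sym[OF w(2)] eqv_sym unfolding eqv_move_left[of w "r p" "u @ rev (r q)"] by blast
  then have "eqv ((u @ rev (r q)) @ r q) ((rev (r p) @ w) @ r q)" by (rule eqv_append[OF _ eqv_refl])
  moreover have "eqv ((u @ rev (r q)) @ r q) u"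
    using eqv_append[OF eqv_refl[of u] eqv_rev_append[of "r q"]] by simp
  ultimately have "eqv ((rev (r p) @ w) @ r q) u" using eqv_sym eqv_trans by blast
  then have "eqv ?x u" by simp
  moreover have "?x \<in> lists V" using w r_lists assms by (auto simp: rev_lists)
  ultimately show "run \<delta> p u = q" using run_eqv[OF assms(3), of ?x u] run assms by simp
next
  assume "run \<delta> p u = q"
  then show "G (r p @ u @ rev (r q))" using run_G[OF assms(3,2)] assms(4) by auto
qed

lemma reduced_G_iff_loop: "reduced u \<Longrightarrow> u \<in> lists V \<Longrightarrow> G u \<longleftrightarrow> run \<delta> 1 u = 1"
  using reduced_G_iff_run[OF _ _ base_in_Q base_in_Q, of u] by (simp add: r_base)

lemma G_iff_loop:
  assumes "w \<in> lists V" "eqv w u" "reduced u" "u \<in> lists V"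
  shows "G w \<longleftrightarrow> run \<delta> 1 u = 1"
  using reduced_G_iff_loop[of u] G_eqv[of w u] G_eqv[of u w] eqv_sym assms by blast

lemma torsion_iff_clique_loop:
  "(\<exists>w. G w \<and> eqv (w @ w) [] \<and> \<not> eqv w []) \<longleftrightarrow>
     (\<exists>q\<in>Q. \<exists>k. clique k \<and> k \<noteq> [] \<and> set k \<subseteq> V \<and> run \<delta> q k = q)"
proof
  assume "\<exists>w. G w \<and> eqv (w @ w) [] \<and> \<not> eqv w []"
  then obtain w where w: "G w" "eqv (w @ w) []" "\<not> eqv w []" by blast
  obtain x k where xk: "eqv w (x @ k @ rev x)" "reduced (x @ k @ rev x)" "clique k"
    using involution_conj_clique[OF w(2)] by blast
  have "trace_eq (nf w) (x @ k @ rev x)" using xk(1,2) by (simp add: eqv_def nf_reduced)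
  then have V: "set (x @ k @ rev x) \<subseteq> V"
    using trace_eq_set nf_set[of w] G_in_lists[OF w(1)] by fastforce
  then have xl: "x @ k @ rev x \<in> lists V" by (auto simp: in_lists_conv_set)
  then have "G (x @ k @ rev x)" using G_eqv[OF w(1) xk(1)] by blast
  then have run: "run \<delta> 1 (x @ k @ rev x) = 1" using reduced_G_iff_loop[OF xk(2) xl] by blast
  define q where "q = run \<delta> 1 x"
  define p where "p = run \<delta> q k"
  have pq: "run \<delta> p (rev x) = 1" "p \<noteq> 0" "q \<noteq> 0"
    using run by (auto simp: p_def q_def intro!: gr0I)
  then have Q: "q \<in> Q" "p \<in> Q"
    using run_in_Q[OF base_in_Q, of x] run_in_Q[of q k] V by (auto simp: q_def p_def)
  \<comment> \<open>Live runs are reversible: \<open>rev x\<close> leads from \<open>p\<close> to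
    the base, so \<open>x\<close> leads from the base to \<open>p\<close>, while it also leads to
    \<open>q\<close>.\<close>
  have "run \<delta> (run \<delta> p (rev x)) (rev (rev x)) = p"
    by (rule run_rev[OF Q(2)]) (use V pq in auto)
  then have "p = q" using pq by (simp add: q_def)
  moreover have "k \<noteq> []" using w(3) xk(1) eqv_append_rev[of x] eqv_trans by auto
  ultimately show "\<exists>q\<in>Q. \<exists>k. clique k \<and> k \<noteq> [] \<and> set k \<subseteq> V \<and> run \<delta> q k = q"
    using Q xk(3) V by (auto simp: p_def)
next
  assume "\<exists>q\<in>Q. \<exists>k. clique k \<and> k \<noteq> [] \<and> set k \<subseteq> V \<and> run \<delta> q k = q"
  then obtain q k where qk: "q \<in> Q" "clique k" "k \<noteq> []" "set k \<subseteq> V" "run \<delta> q k = q" by blast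
  let ?w = "r q @ k @ rev (r q)"
  have "G ?w" using run_G[OF qk(1), of k] qk by auto
  moreover have "eqv (?w @ ?w) []"
  proof -
    have "eqv (wpow ?w 2) (r q @ wpow k 2 @ rev (r q))" by (rule eqv_conj_power)
    also have "eqv \<dots> (r q @ [] @ rev (r q))"
      using eqv_append[OF clique_square[OF qk(2)] eqv_refl[of "rev (r q)"]]
      by (simp add: numeral_2_eq_2 eqv_cancel_left)
    also have "eqv \<dots> []" using eqv_append_rev by simp
    finally show ?thesis by (simp add: numeral_2_eq_2)
  qed
  moreover have "\<not> eqv ?w []"
  proof
    assume "eqv ?w []"
    then have "eqv ?w (r q @ [] @ rev (r q))"
      using eqv_append_rev[of "r q"] eqv_sym eqv_trans by (metis append_Nil)
    then have "eqv k []" by (simp only: eqv_cancel_left eqv_cancel_right)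
    then have "trace_eq k []" using eqv_reduced[OF clique_reduced[OF qk(2)]] by simp
    then show False using qk(3) by simp
  qed
  ultimately show "\<exists>w. G w \<and> eqv (w @ w) [] \<and> \<not> eqv w []" by blast
qed

text \<open>Without missing edges the automaton is the Schreier graph: every word can be read, and
  the state it reaches names its coset. Distinct states are distinct cosets because the empty word
  does not connect them.\<close>

lemma index_total:
  assumes total: "\<And>q s. q \<in> Q \<Longrightarrow> s \<in> V \<Longrightarrow> \<delta> q s \<noteq> 0"
  shows "subgroup_index W H = enat N"
proof -
  have "inj_on (\<lambda>q. coset (r q)) Q"
  proof (rule inj_onI)
    fix p q assume pq: "p \<in> Q" "q \<in> Q" "coset (r p) = coset (r q)"
    then have "G (r p @ [] @ rev (r q))" using coset_eq_iff r_lists by simp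
    then show "p = q" using reduced_G_iff_run[of "[]" p q] pq by simp
  qed
  moreover have "rcosets\<^bsub>W\<^esub> H = (\<lambda>q. coset (r q)) ` Q"
  proof
    show "rcosets\<^bsub>W\<^esub> H \<subseteq> (\<lambda>q. coset (r q)) ` Q"
      unfolding rcosets_eq
    proof (rule image_subsetI)
      fix w assume w: "w \<in> lists V"
      have nz: "run \<delta> q w \<noteq> 0" if "q \<in> Q" for q
        using w that
      proof (induction w arbitrary: q)
        case (Cons s w)
        then show ?case using total[of q s] \<delta>_in_Q[of q s] by simp
      qed simp
      then have "run \<delta> 1 w \<in> Q" using run_in_Q[OF base_in_Q w] base_in_Q by blast
      moreover have "G (w @ rev (r (run \<delta> 1 w)))"
        using run_G[OF base_in_Q w nz[OF base_in_Q]] by (simp add: r_base)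
      then have "coset w = coset (r (run \<delta> 1 w))"
        using coset_eq_iff w r_lists calculation by blast
      ultimately show "coset w \<in> (\<lambda>q. coset (r q)) ` Q" by blast
    qed
    show "(\<lambda>q. coset (r q)) ` Q \<subseteq> rcosets\<^bsub>W\<^esub> H"
      unfolding rcosets_eq using r_lists by blast
  qed
  ultimately show ?thesis by (simp add: subgroup_index_def card_image)
qed

text \<open>Once the automaton is left through \<open>s\<close>, it cannot be re-entered along powers of \<open>st\<close>.\<close>

lemma index_infinite:
  assumes "q \<in> Q" "s \<in> V" "t \<in> V" "s \<noteq> t" "\<not> adj s t" "\<delta> q s = 0"
  shows "infinite (rcosets\<^bsub>W\<^esub> H)"
proof -
  let ?f = "\<lambda>n. r q @ wpow [s, t] n"
  have lists: "wpow [s, t] n \<in> lists V" for n using assms(2,3) by (auto simp: in_lists_conv_set)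
  have "\<not> (\<exists>x. front x [s, t] \<and> front x (rev [s, t]))"
    using assms(4,5) adj_sym by auto
  moreover have "reduced [s, t]" using assms(4,5) by simp
  ultimately have red: "reduced (wpow [s, t] n)" for n using reduced_power by blast
  have neq: "coset (?f (Suc j + m)) \<noteq> coset (?f m)" for j m
  proof
    assume "coset (?f (Suc j + m)) = coset (?f m)"
    then have "G (?f (Suc j + m) @ rev (?f m))"
      using coset_eq_iff lists r_lists[OF assms(1)] by (simp del: replicate_Suc add_Suc)
    moreover have "eqv (?f (Suc j + m) @ rev (?f m)) (r q @ wpow [s, t] (Suc j) @ rev (r q))"
      using eqv_append[OF eqv_refl[of "r q @ wpow [s, t] (Suc j)"]
          eqv_append[OF eqv_append_rev[of "wpow [s, t] m"] eqv_refl[of "rev (r q)"]]]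
      unfolding wpow_add by (simp del: replicate_Suc)
    moreover have "r q @ wpow [s, t] (Suc j) @ rev (r q) \<in> lists V"
      using lists[of "Suc j"] r_lists[OF assms(1)] by (simp add: rev_lists del: replicate_Suc)
    ultimately have "run \<delta> q (wpow [s, t] (Suc j)) = q"
      using reduced_G_iff_run[OF red lists assms(1,1)] G_eqv by blast
    then show False using assms(1,6) by simp
  qed
  have "inj (\<lambda>n. coset (?f n))"
  proof (rule linorder_injI)
    fix m n :: nat assume "m < n"
    then obtain j where "n = Suc j + m" using less_imp_Suc_add by (metis add.commute add_Suc)
    then show "coset (?f m) \<noteq> coset (?f n)" using neq[of j m] by metis
  qed
  then have "infinite (range (\<lambda>n. coset (?f n)))" by (rule range_inj_infinite)
  moreover have "range (\<lambda>n. coset (?f n)) \<subseteq> rcosets\<^bsub>W\<^esub> H"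
    unfolding rcosets_eq
    by (rule image_subsetI, rule imageI) (use lists r_lists[OF assms(1)] in simp)
  ultimately show ?thesis using finite_subset by blast
qed

text \<open>If every missing letter is central, then each coset is reached by a path in the automaton
  followed by a product of central letters.\<close>

lemma index_finite:
  assumes central: "\<And>q s t. q \<in> Q \<Longrightarrow> s \<in> V \<Longrightarrow> \<delta> q s = 0 \<Longrightarrow> t \<in> V \<Longrightarrow> t \<noteq> s \<Longrightarrow> adj s t"
  shows "finite (rcosets\<^bsub>W\<^esub> H)"
proof -
  define Z where "Z = {s \<in> V. \<forall>t\<in>V. t \<noteq> s \<longrightarrow> adj s t}"
  have Z: "Z \<subseteq> V" "finite Z" using finite_V by (auto simp: Z_def)
  have ex: "\<exists>q\<in>Q. \<exists>z\<in>lists Z. coset w = coset (r q @ z)" if "w \<in> lists V" for w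
    using that
  proof (induction w rule: rev_induct)
    case Nil
    then show ?case using base_in_Q r_base by (intro bexI[of _ 1] bexI[of _ "[]"]) auto
  next
    case (snoc s w)
    then have "w \<in> lists V" by simp
    then obtain q z where qz: "q \<in> Q" "z \<in> lists Z" "coset w = coset (r q @ z)"
      using snoc.IH by blast
    have zV: "z \<in> lists V" "r q @ z \<in> lists V" using qz Z r_lists by auto
    have *: "coset (w @ [s]) = coset (r q @ z @ [s])"
      using coset_append[OF qz(3), of "[s]"] snoc.prems zV by simp
    show ?case
    proof (cases "s \<in> Z")
      case True
      then show ?thesis using * qz by (intro bexI[of _ q] bexI[of _ "z @ [s]"]) auto
    next
      case False
      have s: "s \<in> V" using snoc.prems by simp
      \<comment> \<open>A non-central letter has an edge at \<open>q\<close> and commutes with the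
        central letters in \<open>z\<close>, so it can be moved past \<open>z\<close> and be read by
        the automaton.\<close>
      then have nz: "\<delta> q s \<noteq> 0" using False central[OF qz(1)] by (auto simp: Z_def)
      have "\<forall>t\<in>set z. adj s t"
      proof
        fix t assume "t \<in> set z"
        then have "t \<in> Z" using qz by auto
        moreover have "t \<noteq> s" using \<open>t \<in> Z\<close> False by blast
        ultimately have "adj t s" using s by (simp add: Z_def)
        then show "adj s t" by (rule adj_sym)
      qed
      then have "eqv (r q @ z @ [s]) (r q @ [s] @ z)"
        using trace_eq_imp_eqv[OF trace_eq_move[of z s "[]"]] by (simp add: eqv_cancel_left)
      then have "coset (r q @ z @ [s]) = coset (r q @ [s] @ z)"
        using zV s r_lists[OF qz(1)] by (intro coset_eqv) auto
      moreover have "coset (r q @ [s]) = coset (r (\<delta> q s))"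
        using \<delta>_G[OF qz(1) s nz] s r_lists[OF qz(1)] r_lists[OF \<delta>_in_Q[OF qz(1) s nz]]
        by (subst coset_eq_iff) auto
      then have "coset ((r q @ [s]) @ z) = coset (r (\<delta> q s) @ z)"
        using s r_lists[OF qz(1)] r_lists[OF \<delta>_in_Q[OF qz(1) s nz]] zV by (intro coset_append) auto
      ultimately show ?thesis
        using * \<delta>_in_Q[OF qz(1) s nz] qz(2) by (intro bexI[of _ "\<delta> q s"] bexI[of _ z]) auto
    qed
  qed
  \<comment> \<open>Central letters commute with each other, so a reduced word over \<open>Z\<close>
    repeats no letter and there are finitely many of them.\<close>
  define D where "D = {z. set z \<subseteq> Z \<and> length z \<le> card Z}"
  have D: "finite D" unfolding D_def using Z(2) by (rule finite_lists_length_le)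
  have nfD: "nf z \<in> D" if "z \<in> lists Z" for z
  proof -
    have "set (nf z) \<subseteq> Z" using nf_set[of z] that by auto
    moreover have "distinct y" if "reduced y" "set y \<subseteq> Z" for y
      using that
    proof (induction y)
      case (Cons s y)
      have "front s u" if "s \<in> set u" "set u \<subseteq> Z" for u
        using that
      proof (induction u)
        case (Cons t u)
        then show ?case using Cons.prems Z_def \<open>set (s # y) \<subseteq> Z\<close> by auto
      qed simp
      then show ?case using Cons by auto
    qed simp
    ultimately have "distinct (nf z)" "set (nf z) \<subseteq> Z" using reduced_nf by blast+
    then show ?thesis using Z(2) by (simp add: D_def) (metis card_mono distinct_card)
  qed
  have "rcosets\<^bsub>W\<^esub> H \<subseteq> (\<lambda>(q, z). coset (r q @ z)) ` (Q \<times> D)"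
    unfolding rcosets_eq
  proof (rule image_subsetI)
    fix w assume "w \<in> lists V"
    then obtain q z where qz: "q \<in> Q" "z \<in> lists Z" "coset w = coset (r q @ z)" using ex by blast
    then have "z \<in> lists V" using Z(1) by auto
    then have "coset w = coset (r q @ nf z)"
      using r_lists[OF qz(1)] nf_lists[of z]
      by (subst qz(3), intro coset_eqv) (simp_all add: eqv_cancel_left)
    moreover have "(q, nf z) \<in> Q \<times> D" using qz(1) nfD[OF qz(2)] by blast
    ultimately show "coset w \<in> (\<lambda>(q, z). coset (r q @ z)) ` (Q \<times> D)"
      by (intro image_eqI[of _ _ "(q, nf z)"]) simp_all
  qed
  then show ?thesis using D by (meson finite_SigmaI finite_atLeastAtMost finite_imageI finite_subset)
qed

text \<open>Among the \<open>N + 1\<close> states reached by the powers 0 to \<open>N\<close> two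
  coincide. Live runs are reversible, so the common last part of the two powers can be
  removed.\<close>

lemma run_wpow_period:
  assumes "q \<in> Q" "v \<in> lists V" "run \<delta> q (wpow v (Suc n)) = q"
  shows "\<exists>j\<in>Q. run \<delta> q (wpow v j) = q"
proof -
  have vl: "wpow v i \<in> lists V" for i using assms(2) by (auto simp: in_lists_conv_set)
  have run: "run \<delta> q (wpow v i) \<in> Q" for i
  proof (rule run_in_Q[OF assms(1) vl])
    \<comment> \<open>Each power of \<open>v\<close> is a prefix of a power that returns to
      \<open>q\<close>, so its run cannot die.\<close>
    have "run \<delta> q (wpow v (Suc n * i)) = q"
      by (induction i) (use assms(3) in \<open>simp_all only: wpow_mult concat.simps replicate.simps run_append run_Nil\<close>)
    moreover have "wpow v (Suc n * i) = wpow v i @ wpow v (n * i)" by (simp add: wpow_add)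
    ultimately have "run \<delta> (run \<delta> q (wpow v i)) (wpow v (n * i)) = q" by simp
    then show "run \<delta> q (wpow v i) \<noteq> 0" using assms(1) by (intro notI) simp
  qed
  have "\<not> inj_on (\<lambda>i. run \<delta> q (wpow v i)) {0..N}"
  proof
    assume "inj_on (\<lambda>i. run \<delta> q (wpow v i)) {0..N}"
    then have "card {0..N} \<le> card Q" using run by (intro card_inj_on_le) auto
    then show False by simp
  qed
  then obtain i k where ik: "i < k" "k \<le> N" "run \<delta> q (wpow v i) = run \<delta> q (wpow v k)"
    unfolding inj_on_def by (metis atLeastAtMost_iff linorder_neqE_nat)
  define p where "p = run \<delta> q (wpow v (k - i))"
  have "wpow v k = wpow v (k - i) @ wpow v i" using ik(1) wpow_add[of "k - i" i v] by simp
  then have "run \<delta> p (wpow v i) = run \<delta> q (wpow v i)" using ik(3) by (simp add: p_def)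
  moreover have "p \<in> Q" using run by (simp add: p_def)
  ultimately have "p = q"
    using run_rev[OF _ vl, of p i] run_rev[OF assms(1) vl, of i] run[of i] by simp
  then show ?thesis using ik by (intro bexI[of _ "k - i"]) (auto simp: p_def)
qed

text \<open>For reduced conjugates \<open>x @ wpow v i @ rev x\<close>, membership is a statement
  about runs. Such a form is available for even powers of \<open>w\<close>, hence the factor
  2.\<close>

lemma power_bounded:
  assumes "w \<in> lists V" "G (wpow w (Suc n))"
  shows "\<exists>j\<in>Q. G (wpow w (2 * j))"
proof -
  obtain x v where xv: "eqv (w @ w) (x @ v @ rev x)" "\<And>n. reduced (x @ wpow v (Suc n) @ rev x)"
    using square_conj_power by blast
  have red: "reduced (x @ v @ rev x)" using xv(2)[of 0] by simp
  then have "trace_eq (nf (w @ w)) (x @ v @ rev x)" using xv(1) by (simp add: eqv_def nf_reduced)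
  then have V: "set (x @ v @ rev x) \<subseteq> V"
    using trace_eq_set nf_set[of "w @ w"] assms(1) by fastforce
  have wl: "wpow w i \<in> lists V" for i using assms(1) by (auto simp: in_lists_conv_set)
  have xl: "x @ wpow v i @ rev x \<in> lists V" for i using V by (auto simp: in_lists_conv_set)
  have eq: "eqv (wpow w (2 * i)) (x @ wpow v i @ rev x)" for i
  proof -
    have "wpow w (2 * i) = wpow (w @ w) i" using wpow_mult[of 2 i w] by (simp add: numeral_2_eq_2)
    then show ?thesis using eqv_wpow[OF xv(1)] eqv_conj_power eqv_trans by metis
  qed
  have "wpow w (2 * Suc n) = wpow w (Suc n) @ wpow w (Suc n)"
    by (simp only: wpow_add[symmetric] mult_2)
  then have "G (wpow w (2 * Suc n))" using G_append[OF assms(2,2)] by simp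
  then have "G (x @ wpow v (Suc n) @ rev x)" using G_eqv eq xl by blast
  then have run: "run \<delta> 1 (x @ wpow v (Suc n) @ rev x) = 1"
    using reduced_G_iff_loop xv(2) xl by blast
  define q where "q = run \<delta> 1 x"
  define p where "p = run \<delta> q (wpow v (Suc n))"
  have pq: "run \<delta> p (rev x) = 1" using run by (simp add: p_def q_def del: replicate_Suc)
  then have "p \<noteq> 0" by (intro notI) simp
  then have "q \<noteq> 0" by (intro notI) (simp add: p_def del: replicate_Suc)
  have vl: "wpow v i \<in> lists V" "x \<in> lists V" "v \<in> lists V" for i
    using V by (auto simp: in_lists_conv_set)
  have Q: "q \<in> Q" using run_in_Q[OF base_in_Q vl(2)] \<open>q \<noteq> 0\<close> by (simp add: q_def)
  then have "p \<in> Q" using run_in_Q[OF Q vl(1)] \<open>p \<noteq> 0\<close> unfolding p_def by blast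
  then have "run \<delta> (run \<delta> p (rev x)) (rev (rev x)) = p"
    by (rule run_rev) (use vl(2) pq in \<open>auto simp: rev_lists\<close>)
  then have "p = q" using pq by (simp add: q_def)
  then obtain j where j: "j \<in> Q" "run \<delta> q (wpow v j) = q"
    using run_wpow_period[OF Q vl(3)] unfolding p_def by blast
  have "run \<delta> q (rev x) = 1" using pq \<open>p = q\<close> by simp
  then have "run \<delta> 1 (x @ wpow v j @ rev x) = 1"
    using j(2) q_def[symmetric] by simp
  then have "G (x @ wpow v j @ rev x)"
    using run_G[OF base_in_Q xl[of j]] by (simp add: r_base)
  then have "G (wpow w (2 * j))" using G_eqv eqv_sym[OF eq] wl by blast
  then show ?thesis using j(1) by blast
qed

end

context racg_subgroup
begin

text \<open>The states of the automaton are the cosets contained in \<open>U\<close>.\<close>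

lemma certificate_exists:
  fixes U :: "'v list \<Rightarrow> bool"
  assumes U_lists: "\<And>x. U x \<Longrightarrow> x \<in> lists V"
    and U_G: "\<And>g. G g \<Longrightarrow> U g"
    and U_eqv: "\<And>x y. U x \<Longrightarrow> eqv x y \<Longrightarrow> y \<in> lists V \<Longrightarrow> U y"
    and U_translate: "\<And>g x. G g \<Longrightarrow> U x \<Longrightarrow> U (g @ x)"
    and U_square: "\<And>x s t. adj s t \<Longrightarrow> U x \<Longrightarrow> U (x @ [s]) \<Longrightarrow> U (x @ [t]) \<Longrightarrow> U (x @ [s, t])"
    and U_prefix: "\<And>u v. U (u @ v) \<Longrightarrow> reduced (u @ v) \<Longrightarrow> U u"
    and finite_U: "finite (coset ` {x. U x})"
  shows "\<exists>\<delta> N r. racg_certificate \<Gamma> S \<delta> N r \<and> (\<forall>q. q \<notin> {1..N} \<longrightarrow> r q = []) \<and>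
    (\<forall>q\<in>{1..N}. \<forall>s\<in>V. U (r q @ [s]) \<longrightarrow> \<delta> q s \<noteq> 0)"
proof -
  let ?C = "coset ` {x. U x}"
  define N where "N = Suc (card (?C - {coset []}))"
  have "finite (?C - {coset []})" using finite_U by simp
  then obtain f where f: "bij_betw f {0..<card (?C - {coset []})} (?C - {coset []})"
    using ex_bij_betw_nat_finite by blast
  \<comment> \<open>The base state must be 1; the other cosets are numbered from 2 on, hence the
    shift by 2.\<close>
  define e where "e i = (if i = Suc 0 then coset [] else f (i - 2))" for i
  have base: "coset [] \<in> ?C" using U_G[OF G_Nil] by blast
  have e1: "e (Suc 0) = coset []" by (simp add: e_def)
  have e: "bij_betw e {1..N} ?C"
  proof -
    have "bij_betw (\<lambda>i. i - 2) {2..N} {0..<card (?C - {coset []})}"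
      by (rule bij_betw_byWitness[of _ "\<lambda>i. i + 2"]) (auto simp: N_def)
    from bij_betw_trans[OF this f] have "bij_betw e {2..N} (?C - {coset []})"
      by (rule bij_betw_cong[THEN iffD1, rotated]) (auto simp: e_def)
    moreover have "bij_betw e {1} {coset []}" by (simp add: bij_betw_def e_def)
    ultimately have "bij_betw e ({1} \<union> {2..N}) ({coset []} \<union> (?C - {coset []}))"
      by (intro bij_betw_combine) auto
    moreover have "{1} \<union> {2..N} = {1..N}" by (auto simp: N_def)
    moreover have "{coset []} \<union> (?C - {coset []}) = ?C" using base by blast
    ultimately show ?thesis by simp
  qed
  define idx where "idx = the_inv_into {1..N} e"
  have idx_e: "idx (e q) = q" if "q \<in> {1..N}" for q
    using e that unfolding idx_def by (intro the_inv_into_f_f) (auto simp: bij_betw_def)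
  have e_idx: "e (idx (coset x)) = coset x" "idx (coset x) \<in> {1..N}" if "U x" for x
  proof -
    have "coset x \<in> e ` {1..N}" using e that by (auto simp: bij_betw_def)
    then obtain q where "q \<in> {1..N}" "coset x = e q" by blast
    then show "e (idx (coset x)) = coset x" "idx (coset x) \<in> {1..N}"
      using idx_e[of q] by simp_all
  qed
  have "\<exists>x. U x \<and> reduced x \<and> coset x = e q" if q: "q \<in> {1..N}" for q
  proof -
    obtain x where x: "U x" "e q = coset x" using e q unfolding bij_betw_def by blast
    have "nf x \<in> lists V" using nf_lists U_lists x(1) by blast
    then have "U (nf x)" "coset (nf x) = coset x"
      using U_eqv[OF x(1) eqv_nf(2)] coset_eqv[OF eqv_nf(1)] U_lists[OF x(1)] by blast+
    then show ?thesis using x(2) reduced_nf by metis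
  qed
  then obtain r0 where r0: "\<And>q. q \<in> {1..N} \<Longrightarrow> U (r0 q) \<and> reduced (r0 q) \<and> coset (r0 q) = e q"
    by metis
  \<comment> \<open>A certificate demands \<open>r 1 = []\<close>. The other representatives are
    reduced, so that their prefixes lie in \<open>U\<close> and their runs pass through states
    only.\<close>
  define r where "r q = (if q = Suc 0 \<or> q \<notin> {1..N} then [] else r0 q)" for q
  have r: "U (r q)" "reduced (r q)" "coset (r q) = e q" if "q \<in> {1..N}" for q
    using r0[OF that] that U_G[OF G_Nil] e1 by (auto simp: r_def)
  define \<delta> where
    "\<delta> q s = (if q \<in> {1..N} \<and> U (r q @ [s]) then idx (coset (r q @ [s])) else 0)" for q s
  \<comment> \<open>\<open>U\<close> is a union of cosets, so existence and target of an edge do not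
    depend on the representative \<open>r q\<close>.\<close>
  have U_coset: "U y" if "coset x = coset y" "U x" "y \<in> lists V" for x y
  proof -
    have "G (y @ rev x)" using coset_eq_iff[of y x] that U_lists by simp
    then have "U ((y @ rev x) @ x)" using U_translate that(2) by blast
    moreover have "eqv ((y @ rev x) @ x) y"
      using eqv_append[OF eqv_refl[of y] eqv_rev_append[of x]] by simp
    ultimately show ?thesis using U_eqv that(3) by blast
  qed
  have \<delta>: "\<delta> q s = idx (coset (x @ [s]))" "coset (r q @ [s]) = coset (x @ [s])"
    if "q \<in> {1..N}" "coset x = e q" "U x" "U (x @ [s])" for q s x
  proof -
    have "x @ [s] \<in> lists V" "r q \<in> lists V"
      using U_lists that(4) r(1)[OF that(1)] by blast+
    then have l: "x \<in> lists V" "[s] \<in> lists V" "r q \<in> lists V" by simp_all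
    have "coset (x @ [s]) = coset (r q @ [s])"
      using coset_append[of x "r q" "[s]"] l r(3) that by simp
    moreover have "r q @ [s] \<in> lists V" using l by simp
    ultimately have "U (r q @ [s])" using U_coset that(4) by blast
    then show "\<delta> q s = idx (coset (x @ [s]))" "coset (r q @ [s]) = coset (x @ [s])"
      using that(1) \<open>coset (x @ [s]) = coset (r q @ [s])\<close> by (simp_all add: \<delta>_def)
  qed
  have run: "run \<delta> 1 x = idx (coset x)" if "U x" "reduced x" for x
    using that
  proof (induction x rule: rev_induct)
    case Nil
    then show ?case using idx_e[of 1] e1 by (simp add: N_def)
  next
    case (snoc s x)
    then have "U x" "reduced x" using U_prefix reduced_append_iff by blast+
    then show ?case using snoc \<delta>(1)[of "idx (coset x)" x s] e_idx by simp
  qed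
  have idx_pos: "idx (coset x) \<noteq> 0" if "U x" for x
    using e_idx(2)[OF that] by auto
  have \<delta>_nz: "\<delta> q s \<noteq> 0 \<longleftrightarrow> U (r q @ [s])" if "q \<in> {1..N}" for q s
    using that idx_pos by (simp add: \<delta>_def)
  have \<delta>_step: "\<delta> q s \<in> {1..N}" "e (\<delta> q s) = coset (r q @ [s])" if "q \<in> {1..N}" "U (r q @ [s])" for q s
    using that e_idx by (auto simp: \<delta>_def)
  have "certificate V adj S (racg_eq \<Gamma>) G \<delta> N r"
    unfolding certificate_def
  proof (intro conjI ballI impI allI)
    show "0 < N" "r 1 = []" by (simp_all add: N_def r_def)
  next
    fix q assume q: "q \<in> {1..N}"
    show "run \<delta> 1 (r q) = q" using run[OF r(1,2)[OF q]] r(3)[OF q] idx_e[OF q] by simp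
    show "r q \<in> lists V" using U_lists[OF r(1)[OF q]] .
    fix s assume s: "s \<in> V"
    have rl: "r q \<in> lists V" using U_lists[OF r(1)[OF q]] .
    show "\<delta> q s \<le> N" using \<delta>_step(1)[OF q] by (cases "U (r q @ [s])") (auto simp: \<delta>_def)
    {
      assume "\<delta> q s \<noteq> 0"
      then have Us: "U (r q @ [s])" using \<delta>_nz[OF q] by blast
      define p where "p = \<delta> q s"
      have p: "p \<in> {1..N}" "e p = coset (r q @ [s])" using \<delta>_step[OF q Us] by (simp_all add: p_def)
      have ss: "eqv (r q @ [s, s]) (r q)" using eqv_cancel_square[of "r q" s "[]"] by simp
      have l: "(r q @ [s]) @ [s] \<in> lists V" using rl s by simp
      then have "U ((r q @ [s]) @ [s])" using U_eqv[OF r(1)[OF q] eqv_sym[OF ss]] by simp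
      then have "\<delta> p s = idx (coset ((r q @ [s]) @ [s]))"
        using \<delta>(1)[OF p(1) p(2)[symmetric] Us] by blast
      also have "coset ((r q @ [s]) @ [s]) = coset (r q)"
        using coset_eqv[OF ss] l rl by simp
      finally show "\<delta> (\<delta> q s) s = q" using r(3)[OF q] idx_e[OF q] by (simp add: p_def)
      have "coset (r q @ [s]) = coset (r p)" using r(3)[OF p(1)] p(2) by simp
      then show "G (r q @ s # rev (r (\<delta> q s)))"
        using coset_eq_iff[of "r q @ [s]" "r p"] U_lists[OF r(1)[OF p(1)]] U_lists[OF Us]
        by (simp add: p_def)
    }
    fix t assume t: "t \<in> V" "adj s t" "\<delta> q s \<noteq> 0" "\<delta> q t \<noteq> 0"
    have U: "U (r q @ [s])" "U (r q @ [t])" using t \<delta>_nz[OF q] by blast+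
    have "U ((r q @ [s]) @ [t])" "U ((r q @ [t]) @ [s])"
      using U_square[of s t "r q"] U_square[of t s "r q"] U t(2) adj_sym[OF t(2)] r(1)[OF q] by simp_all
    then have *: "\<delta> (\<delta> q s) t = idx (coset ((r q @ [s]) @ [t]))"
      "\<delta> (\<delta> q t) s = idx (coset ((r q @ [t]) @ [s]))" "idx (coset ((r q @ [s]) @ [t])) \<noteq> 0"
      using \<delta>(1) \<delta>_step[OF q] U idx_pos by metis+
    have "eqv ((r q @ [s]) @ [t]) ((r q @ [t]) @ [s])"
      using eqv_commute[OF t(2)] by (simp add: eqv_cancel_left)
    then have "coset ((r q @ [s]) @ [t]) = coset ((r q @ [t]) @ [s])"
      using rl s t(1) by (intro coset_eqv) simp_all
    then show "\<delta> (\<delta> q s) t = \<delta> (\<delta> q t) s" "\<delta> (\<delta> q s) t \<noteq> 0" using * by simp_all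
  next
    fix w assume w: "w \<in> S"
    have wl: "w \<in> lists V" using w S_lists by blast
    then have nl: "nf w \<in> lists V" by (rule nf_lists)
    have G: "G (nf w)" using G_eqv[OF G_gen[OF w] eqv_nf(2) nl] .
    have "coset (nf w) = coset []" using coset_eq_iff[of "nf w" "[]"] G nl by simp
    then have "run \<delta> 1 (nf w) = 1"
      using run[OF U_G[OF G] reduced_nf] idx_e[of 1] e1 by (simp add: N_def)
    then show "\<exists>u. racg_eq \<Gamma> w u \<and> run \<delta> 1 u = 1" using racg_eq_nf[OF wl] by blast
  qed
  moreover have "\<delta> q s = 0" if "q \<notin> {1..N} \<or> s \<notin> V" for q s
  proof -
    have "\<not> (q \<in> {1..N} \<and> U (r q @ [s]))" using that U_lists[of "r q @ [s]"] by auto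
    then show ?thesis by (simp only: \<delta>_def if_False)
  qed
  ultimately have "racg_certificate \<Gamma> S \<delta> N r" by unfold_locales
  moreover have "\<forall>q. q \<notin> {1..N} \<longrightarrow> r q = []" by (simp add: r_def)
  ultimately show ?thesis using \<delta>_nz by blast
qed

text \<open>Moving a nearby point of \<open>G\<close> to the identity does not change the coset of a
  hull point, so each such coset has a representative of length at most
  \<open>card V * M\<close>.\<close>

lemma hull_certificate:
  assumes "quasiconvex W (racg_gens \<Gamma>) H"
  shows "\<exists>\<delta> N r. racg_certificate \<Gamma> S \<delta> N r \<and> (\<forall>q. q \<notin> {1..N} \<longrightarrow> r q = [])"
proof -
  obtain M where M: "\<And>p q. G (p @ q) \<Longrightarrow> reduced (p @ q) \<Longrightarrow> \<exists>m\<in>lists V. length m \<le> M \<and> G (p @ m)"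
    using quasiconvex_words[OF assms] by blast
  define F where "F = {w. set w \<subseteq> V \<and> length w \<le> card V * M}"
  have "coset x \<in> coset ` F" if x: "in_hull x" for x
  proof -
    have "\<exists>g. G g \<and> len (rev g @ x) \<le> card V * M"
      by (rule hull_bounded[OF M x]) assumption+
    then obtain g where g: "G g" "len (rev g @ x) \<le> card V * M" by blast
    have xl: "x \<in> lists V" "g \<in> lists V" using x g(1) G_in_lists by (auto simp: in_hull_def)
    define w where "w = nf (rev g @ x)"
    have wl: "w \<in> lists V" using nf_lists[of "rev g @ x"] xl by (simp add: w_def rev_lists)
    then have "w \<in> F" using g(2) by (auto simp: F_def w_def len_def)
    moreover have "eqv x (g @ w)" unfolding eqv_move_left w_def by simp
    then have "eqv (x @ rev w) ((g @ w) @ rev w)" by (rule eqv_append[OF _ eqv_refl])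
    moreover have "eqv (g @ w @ rev w) g" using eqv_append[OF eqv_refl[of g] eqv_append_rev[of w]] by simp
    ultimately have "eqv (x @ rev w) g" using eqv_trans by simp
    then have "G (x @ rev w)" using G_eqv[OF g(1) eqv_sym] xl wl by (simp add: rev_lists)
    then have "coset x = coset w" using coset_eq_iff xl wl by blast
    with \<open>w \<in> F\<close> show ?thesis by blast
  qed
  then have "coset ` {x. in_hull x} \<subseteq> coset ` F" by blast
  moreover have "finite F" unfolding F_def using finite_V by (rule finite_lists_length_le)
  ultimately have fin: "finite (coset ` {x. in_hull x})" by (meson finite_imageI finite_subset)
  have "\<exists>\<delta> N r. racg_certificate \<Gamma> S \<delta> N r \<and> (\<forall>q. q \<notin> {1..N} \<longrightarrow> r q = []) \<and>
      (\<forall>q\<in>{1..N}. \<forall>s\<in>V. in_hull (r q @ [s]) \<longrightarrow> \<delta> q s \<noteq> 0)"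
  proof (rule certificate_exists)
    show "in_hull x \<Longrightarrow> x \<in> lists V" for x by (simp add: in_hull_def)
    show "G g \<Longrightarrow> in_hull g" for g by (rule hull_G)
    show "in_hull x \<Longrightarrow> eqv x y \<Longrightarrow> y \<in> lists V \<Longrightarrow> in_hull y" for x y by (rule hull_eqv)
    show "G g \<Longrightarrow> in_hull x \<Longrightarrow> in_hull (g @ x)" for g x by (rule hull_translate)
    show "adj s t \<Longrightarrow> in_hull x \<Longrightarrow> in_hull (x @ [s]) \<Longrightarrow> in_hull (x @ [t]) \<Longrightarrow> in_hull (x @ [s, t])"
      for x s t by (rule hull_square)
    show "in_hull (u @ v) \<Longrightarrow> reduced (u @ v) \<Longrightarrow> in_hull u" for u v by (rule hull_prefix)
  qed (rule fin)
  then show ?thesis by blast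
qed

text \<open>With all words as \<open>U\<close>, every coset is a state and no edge can be missing;
  finitely many states then means finite index.\<close>

lemma total_certificate:
  assumes "finite (rcosets\<^bsub>W\<^esub> H)"
  shows "\<exists>\<delta> N r. racg_certificate \<Gamma> S \<delta> N r \<and> (\<forall>q. q \<notin> {1..N} \<longrightarrow> r q = []) \<and>
    (\<forall>q\<in>{1..N}. \<forall>s\<in>V. \<delta> q s \<noteq> 0)"
proof -
  have "\<exists>\<delta> N r. racg_certificate \<Gamma> S \<delta> N r \<and> (\<forall>q. q \<notin> {1..N} \<longrightarrow> r q = []) \<and>
      (\<forall>q\<in>{1..N}. \<forall>s\<in>V. r q @ [s] \<in> lists V \<longrightarrow> \<delta> q s \<noteq> 0)"
  proof (rule certificate_exists)
    show "finite (coset ` {x. x \<in> lists V})" using assms by (simp add: rcosets_eq)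
    show "x @ [s, t] \<in> lists V" if "x @ [s] \<in> lists V" "x @ [t] \<in> lists V" for x s t
      using that by simp
  qed (simp_all add: G_in_lists)
  then obtain \<delta> N r where *: "racg_certificate \<Gamma> S \<delta> N r" "\<forall>q. q \<notin> {1..N} \<longrightarrow> r q = []"
    "\<forall>q\<in>{1..N}. \<forall>s\<in>V. r q @ [s] \<in> lists V \<longrightarrow> \<delta> q s \<noteq> 0" by blast
  interpret racg_certificate \<Gamma> S \<delta> N r by fact
  show ?thesis using * r_lists by (metis append_in_lists_conv lists.Cons lists.Nil)
qed

end

section \<open>Enumerating certificates\<close>

lemma less_if_mem_set_decode: "n \<in> set_decode a \<Longrightarrow> n < a"
proof -
  assume "n \<in> set_decode a"
  then have "2 ^ n \<le> a" by (metis div_less even_zero not_le set_decode_def mem_Collect_eq)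
  then show ?thesis using less_exp[of n] by (metis order.strict_trans2)
qed

lemma dec_lists [rec_intros]:
  assumes "recl f" "recf a"
  shows "dec (\<lambda>x. f x \<in> lists (set_decode (a x)))"
proof -
  have "f x \<in> lists (set_decode (a x)) \<longleftrightarrow>
      (\<forall>i<length (f x). nth_default 0 (f x) i \<in> set_decode (a x))" for x
    by (simp add: in_lists_conv_set all_set_conv_all_nth nth_default_def)
  then show ?thesis
    by (simp only:) (intro rec_intros recf_comp[OF assms(2)] recl_comp[OF assms(1)] assms)
qed

lemmas semidec_lists [semidec_intros] = dec_lists[THEN semidec_dec]

lemma semidec_ball_set [semidec_intros]:
  assumes "recf a" "semidec (\<lambda>z. P (lft z) (rgt z))"
  shows "semidec (\<lambda>x. \<forall>y\<in>set_decode (a x). P x y)"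
proof -
  have "(\<forall>y\<in>set_decode (a x). P x y) \<longleftrightarrow> (\<forall>y<a x. y \<in> set_decode (a x) \<longrightarrow> P x y)" for x
    using less_if_mem_set_decode by blast
  then show ?thesis
    by (simp only:) (intro semidec_intros rec_intros assms recf_comp[OF assms(1)])
qed

lemma semidec_bex_set [semidec_intros]:
  assumes "recf a" "semidec (\<lambda>z. P (lft z) (rgt z))"
  shows "semidec (\<lambda>x. \<exists>y\<in>set_decode (a x). P x y)"
  unfolding Bex_def by (intro semidec_intros rec_intros assms recf_comp[OF assms(1)])

lemma semidec_ball_words [semidec_intros]:
  assumes "recf a" "semidec (\<lambda>z. P (lft z) (list_decode (rgt z)))"
  shows "semidec (\<lambda>x. \<forall>w\<in>list_decode ` set_decode (a x). P x w)"
  using semidec_ball_set[OF assms] by simp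

lemma semidec_bex_words [semidec_intros]:
  assumes "recf a" "semidec (\<lambda>z. P (lft z) (list_decode (rgt z)))"
  shows "semidec (\<lambda>x. \<exists>w\<in>list_decode ` set_decode (a x). P x w)"
  using semidec_bex_set[OF assms] by simp

lemma semidec_ball_interval [semidec_intros]:
  assumes "recf a" "semidec (\<lambda>z. P (lft z) (rgt z))"
  shows "semidec (\<lambda>x. \<forall>y\<in>{1..a x}. P x y)"
proof -
  have "(\<forall>y\<in>{1..a x}. P x y) \<longleftrightarrow> (\<forall>y<Suc (a x). 1 \<le> y \<longrightarrow> P x y)" for x
    by auto
  then show ?thesis
    by (simp only:) (intro semidec_intros rec_intros assms)
qed

lemma semidec_bex_interval [semidec_intros]:
  assumes "recf a" "semidec (\<lambda>z. P (lft z) (rgt z))"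
  shows "semidec (\<lambda>x. \<exists>y\<in>{1..a x}. P x y)"
proof -
  have "(\<exists>y\<in>{1..a x}. P x y) \<longleftrightarrow> (\<exists>y. 1 \<le> y \<and> y \<le> a x \<and> P x y)" for x
    by auto
  then show ?thesis
    by (simp only:) (intro semidec_intros rec_intros assms recf_comp[OF assms(1)])
qed

text \<open>Defining relations applied inside a word in both directions, so that equality in the
  group becomes reachability along a chain that can be searched for.\<close>

definition word_step :: "'v set \<Rightarrow> ('v \<Rightarrow> 'v \<Rightarrow> bool) \<Rightarrow> 'v list \<Rightarrow> 'v list \<Rightarrow> bool" where
  "word_step V adj u v \<longleftrightarrow> (\<exists>a b.
     (\<exists>s\<in>V. u = a @ s # s # b \<and> v = a @ b \<or> u = a @ b \<and> v = a @ s # s # b) \<or>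
     (\<exists>s\<in>V. \<exists>t\<in>V. adj s t \<and> u = a @ s # t # b \<and> v = a @ t # s # b))"

text \<open>Generators are attached and removed at the right end. Removal takes care of inverses:
  \<open>rev w\<close> is reached from \<open>rev w @ w\<close>, which equals the empty word in the
  group.\<close>

definition subgroup_step ::
  "'v set \<Rightarrow> ('v \<Rightarrow> 'v \<Rightarrow> bool) \<Rightarrow> 'v list set \<Rightarrow> 'v list \<Rightarrow> 'v list \<Rightarrow> bool" where
  "subgroup_step V adj S u v \<longleftrightarrow> word_step V adj u v \<or> (\<exists>w\<in>S. v = u @ w \<or> u = v @ w)"

definition no_cancel :: "(nat \<Rightarrow> nat \<Rightarrow> bool) \<Rightarrow> nat list \<Rightarrow> bool" where
  "no_cancel adj w \<longleftrightarrow> (\<forall>j<length w. \<forall>i<j. nth_default 0 w i \<noteq> nth_default 0 w j \<or>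
     (\<exists>k<j. i < k \<and> \<not> adj (nth_default 0 w i) (nth_default 0 w k)))"

section \<open>Equality and membership as reachability\<close>

context racg_subgroup
begin

lemma word_step_sym: "word_step V adj u v \<Longrightarrow> word_step V adj v u"
  unfolding word_step_def using adj_sym by blast

lemma word_step_append:
  assumes "word_step V adj u v"
  shows "word_step V adj (x @ u @ y) (x @ v @ y)"
proof -
  obtain a b where *:
    "(\<exists>s\<in>V. u = a @ s # s # b \<and> v = a @ b \<or> u = a @ b \<and> v = a @ s # s # b) \<or>
     (\<exists>s\<in>V. \<exists>t\<in>V. adj s t \<and> u = a @ s # t # b \<and> v = a @ t # s # b)"
    using assms unfolding word_step_def by blast
  then show ?thesis
    unfolding word_step_def by (intro exI[of _ "x @ a"] exI[of _ "b @ y"]) auto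
qed

lemma word_step_imp_racg_eq:
  assumes "word_step V adj u v" "u \<in> lists V"
  shows "racg_eq \<Gamma> u v"
proof -
  obtain a b where ab:
    "(\<exists>s\<in>V. u = a @ s # s # b \<and> v = a @ b \<or> u = a @ b \<and> v = a @ s # s # b) \<or>
     (\<exists>s\<in>V. \<exists>t\<in>V. adj s t \<and> u = a @ s # t # b \<and> v = a @ t # s # b)"
    using assms unfolding word_step_def by blast
  then have "v \<in> lists V" using assms(2) by auto
  moreover have "eqv u v"
    using ab eqv_cancel_square eqv_sym eqv_append[OF eqv_refl[of a] trace_eq_imp_eqv[OF trace_eq_swap]]
    by blast
  ultimately show ?thesis using assms(2) racg_eq_iff by blast
qed

lemma word_steps_append: "(word_step V adj)\<^sup>*\<^sup>* u v \<Longrightarrow> (word_step V adj)\<^sup>*\<^sup>* (x @ u @ y) (x @ v @ y)"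
proof (induction rule: rtranclp_induct)
  case (step v w)
  then show ?case using word_step_append by (meson rtranclp.rtrancl_into_rtrancl)
qed simp

lemma word_steps_iff:
  assumes "u \<in> lists V"
  shows "(word_step V adj)\<^sup>*\<^sup>* u v \<longleftrightarrow> racg_eq \<Gamma> u v"
proof
  assume "(word_step V adj)\<^sup>*\<^sup>* u v"
  then show "racg_eq \<Gamma> u v"
  proof (induction rule: rtranclp_induct)
    case base
    then show ?case using assms by (rule racg_eq.refl)
  next
    case (step v w)
    then show ?case using word_step_imp_racg_eq racg_eq_lists racg_eq.trans by blast
  qed
next
  assume "racg_eq \<Gamma> u v"
  then show "(word_step V adj)\<^sup>*\<^sup>* u v"
  proof (induction rule: racg_eq.induct)
    case (square s)
    then have "word_step V adj [s, s] []"
      unfolding word_step_def by (intro exI[of _ "[]"]) auto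
    then show ?case by blast
  next
    case (commute s t)
    then have "word_step V adj [s, t] [t, s]"
      unfolding word_step_def using adj_in_V[of s t] by (intro exI[of _ "[]"]) auto
    then show ?case by blast
  next
    case (sym u v)
    have "symp (word_step V adj)" using word_step_sym by (rule sympI)
    then have "symp (word_step V adj)\<^sup>*\<^sup>*" by (rule symp_rtranclp)
    then show ?case using sym.IH by (rule sympD)
  next
    case (append u u' v v')
    have "(word_step V adj)\<^sup>*\<^sup>* ([] @ u @ v) ([] @ u' @ v)"
      using append.IH(1) by (rule word_steps_append)
    moreover have "(word_step V adj)\<^sup>*\<^sup>* (u' @ v @ []) (u' @ v' @ [])"
      using append.IH(2) by (rule word_steps_append)
    ultimately show ?case by simp
  qed auto
qed

lemma subgroup_steps_append:
  "(subgroup_step V adj S)\<^sup>*\<^sup>* u v \<Longrightarrow> (subgroup_step V adj S)\<^sup>*\<^sup>* (x @ u) (x @ v)"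
proof (induction rule: rtranclp_induct)
  case (step v w)
  have "subgroup_step V adj S (x @ v) (x @ w)"
    using step(2) word_step_append[of v w x "[]"] unfolding subgroup_step_def by auto
  then show ?case using step.IH by (meson rtranclp.rtrancl_into_rtrancl)
qed simp

lemma subgroup_steps_iff: "(subgroup_step V adj S)\<^sup>*\<^sup>* [] w \<longleftrightarrow> G w"
proof
  assume "(subgroup_step V adj S)\<^sup>*\<^sup>* [] w"
  then show "G w"
  proof (induction rule: rtranclp_induct)
    case base
    show ?case by (rule G_Nil)
  next
    case (step u v)
    from step(2) consider "word_step V adj u v" | w where "w \<in> S" "v = u @ w" | w where "w \<in> S" "u = v @ w"
      unfolding subgroup_step_def by blast
    then show ?case
    proof cases
      case 1
      then have "racg_eq \<Gamma> u v" using word_step_imp_racg_eq step.IH G_in_lists by blast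
      then show ?thesis using step.IH racg_word_eqI by metis
    next
      case 2
      then show ?thesis using step.IH G_gen G_append by blast
    next
      case (3 w)
      then have "G ((v @ w) @ rev w)" using step.IH G_gen G_rev G_append by blast
      moreover have "eqv ((v @ w) @ rev w) v"
        using eqv_append[OF eqv_refl[of v] eqv_append_rev[of w]] by simp
      moreover have "v \<in> lists V" using G_in_lists[OF step.IH] 3 by simp
      ultimately show ?thesis using G_eqv by blast
    qed
  qed
next
  assume "G w"
  have sym: "symp (subgroup_step V adj S)\<^sup>*\<^sup>*"
    by (intro symp_rtranclp sympI) (auto simp: subgroup_step_def intro: word_step_sym)
  have "\<exists>u. eqv w u \<and> G u \<and> (subgroup_step V adj S)\<^sup>*\<^sup>* [] u"
  proof (rule G_induct[OF \<open>G w\<close>])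
    show "(subgroup_step V adj S)\<^sup>*\<^sup>* [] w" if "w \<in> S" for w
      using that by (intro r_into_rtranclp) (auto simp: subgroup_step_def)
    show "(subgroup_step V adj S)\<^sup>*\<^sup>* [] (rev w)" if "w \<in> S" for w
    proof -
      have "racg_eq \<Gamma> [] (rev w @ w)" using racg_eq_rev[of w] that S_lists racg_eq.sym by blast
      then have "(word_step V adj)\<^sup>*\<^sup>* [] (rev w @ w)" by (simp add: word_steps_iff)
      then have "(subgroup_step V adj S)\<^sup>*\<^sup>* [] (rev w @ w)"
        by (rule rtranclp_mono[THEN predicate2D, rotated]) (auto simp: subgroup_step_def)
      moreover have "subgroup_step V adj S (rev w @ w) (rev w)"
        using that by (auto simp: subgroup_step_def)
      ultimately show ?thesis by (rule rtranclp.rtrancl_into_rtrancl)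
    qed
    show "(subgroup_step V adj S)\<^sup>*\<^sup>* [] (u @ v)"
      if "(subgroup_step V adj S)\<^sup>*\<^sup>* [] u" "(subgroup_step V adj S)\<^sup>*\<^sup>* [] v" for u v
      using that(1) subgroup_steps_append[OF that(2), of u] by simp
  qed simp
  then obtain u where u: "eqv w u" "G u" "(subgroup_step V adj S)\<^sup>*\<^sup>* [] u" by blast
  then have "(word_step V adj)\<^sup>*\<^sup>* u w"
    using \<open>G w\<close> G_in_lists eqv_sym by (simp add: word_steps_iff racg_eq_iff)
  then have "(subgroup_step V adj S)\<^sup>*\<^sup>* u w"
    by (rule rtranclp_mono[THEN predicate2D, rotated]) (auto simp: subgroup_step_def)
  then show "(subgroup_step V adj S)\<^sup>*\<^sup>* [] w" using u(3) by simp
qed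

end

lemma no_cancel_iff:
  assumes "commutation adj"
  shows "no_cancel adj w \<longleftrightarrow> commutation.reduced adj w"
proof -
  interpret commutation adj by fact
  have "(nth_default 0 w i \<noteq> nth_default 0 w j \<or>
      (\<exists>k<j. i < k \<and> \<not> adj (nth_default 0 w i) (nth_default 0 w k))) \<longleftrightarrow>
    (w ! i = w ! j \<longrightarrow> (\<exists>k<j. i < k \<and> \<not> adj (w ! i) (w ! k)))" if ij: "j < length w" "i < j" for i j
  proof -
    have "nth_default 0 w k = w ! k" if "k \<le> j" for k
      using that ij by (simp add: nth_default_nth)
    then have "nth_default 0 w i = w ! i" "nth_default 0 w j = w ! j"
      "(\<exists>k<j. i < k \<and> \<not> adj (w ! i) (nth_default 0 w k)) \<longleftrightarrow> (\<exists>k<j. i < k \<and> \<not> adj (w ! i) (w ! k))"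
      using ij by (auto intro!: ex_cong1)
    then show ?thesis by (simp only: imp_conv_disj)
  qed
  then show ?thesis
    unfolding no_cancel_def reduced_iff_no_cancel by (intro all_cong1 imp_cong HOL.refl)
qed

section \<open>Coded instances, certificates and answers\<close>

abbreviation verts_of :: "nat \<Rightarrow> nat set" where
  "verts_of c \<equiv> set_decode (lft (lft c))"
abbreviation adj_of :: "nat \<Rightarrow> nat \<Rightarrow> nat \<Rightarrow> bool" where
  "adj_of c s t \<equiv> prod_encode (s, t) \<in> set_decode (rgt (lft c))"
abbreviation words_of :: "nat \<Rightarrow> nat list set" where
  "words_of c \<equiv> list_decode ` set_decode (rgt c)"

definition eq_of :: "nat \<Rightarrow> nat list \<Rightarrow> nat list \<Rightarrow> bool" where
  "eq_of c = (word_step (verts_of c) (adj_of c))\<^sup>*\<^sup>*"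

definition mem_of :: "nat \<Rightarrow> nat list \<Rightarrow> bool" where
  "mem_of c = (subgroup_step (verts_of c) (adj_of c) (words_of c))\<^sup>*\<^sup>* []"

text \<open>Forcing 0 outside the states and the vertices makes \<open>dead\<close> hold for every
  code \<open>d\<close>.\<close>

definition table :: "nat \<Rightarrow> nat \<Rightarrow> nat \<Rightarrow> nat \<Rightarrow> nat \<Rightarrow> nat" where
  "table c d N q s =
     (if q = 0 \<or> N < q \<or> s \<notin> verts_of c then 0 else nth_default 0 (list_decode d) (prod_encode (q, s)))"

definition certificate_of :: "nat \<Rightarrow> nat \<Rightarrow> nat \<Rightarrow> nat \<Rightarrow> bool" where
  "certificate_of c d N r \<longleftrightarrow> certificate (verts_of c) (adj_of c) (words_of c) (eq_of c) (mem_of c)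
     (table c d N) N (\<lambda>q. list_decode (nth_default 0 (list_decode r) q))"

lemma semidec_word_step: 
  assumes "recf c" "recl f" "recl g"
  shows "semidec (\<lambda>x. word_step (verts_of (c x)) (adj_of (c x)) (f x) (g x))"
  unfolding word_step_def
  by (intro semidec_intros rec_intros recf_comp[OF assms(1)] recl_comp[OF assms(2)] recl_comp[OF assms(3)])

lemma semidec_eq_of [semidec_intros]:
  assumes "recf c" "recl f" "recl g"
  shows "semidec (\<lambda>x. eq_of (c x) (f x) (g x))"
  unfolding eq_of_def
  by (rule semidec_rtranclp[OF _ assms]) (intro semidec_word_step rec_intros)

lemma semidec_mem_of [semidec_intros]:
  assumes "recf c" "recl f"
  shows "semidec (\<lambda>x. mem_of (c x) (f x))"
  unfolding mem_of_def
proof (rule semidec_rtranclp[OF _ assms(1) recl_Nil assms(2)])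
  show "semidec (\<lambda>z. subgroup_step (verts_of (lft z)) (adj_of (lft z)) (words_of (lft z))
      (list_decode (lft (rgt z))) (list_decode (rgt (rgt z))))"
    unfolding subgroup_step_def by (intro semidec_word_step semidec_intros rec_intros)
qed

lemma recf_table [rec_intros]:
  "recf c \<Longrightarrow> recf d \<Longrightarrow> recf N \<Longrightarrow> recf q \<Longrightarrow> recf s \<Longrightarrow> recf (\<lambda>x. table (c x) (d x) (N x) (q x) (s x))"
  unfolding table_def by (intro rec_intros)

lemma run_rec_nat: "run \<delta> q w = rec_nat q (\<lambda>i p. \<delta> p (nth_default 0 w i)) (length w)"
proof (induction w rule: rev_induct)
  case (snoc s w)
  have "rec_nat q (\<lambda>i p. \<delta> p (nth_default 0 (w @ [s]) i)) n
      = rec_nat q (\<lambda>i p. \<delta> p (nth_default 0 w i)) n" if "n \<le> length w" for n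
    using that by (induction n) (simp_all add: nth_default_append nth_default_nth)
  then show ?case using snoc by (simp add: nth_default_append)
qed simp

lemma recf_run [rec_intros]:
  assumes "recf c" "recf d" "recf N" "recf q" "recl w"
  shows "recf (\<lambda>x. run (table (c x) (d x) (N x)) (q x) (w x))"
  unfolding run_rec_nat
  by (intro rec_intros assms recf_comp[OF assms(1)] recf_comp[OF assms(2)] recf_comp[OF assms(3)]
      recl_comp[OF assms(5)])

lemma dec_no_cancel [rec_intros]:
  assumes "recf c" "recl f"
  shows "dec (\<lambda>x. no_cancel (adj_of (c x)) (f x))"
  unfolding no_cancel_def by (intro rec_intros assms recf_comp[OF assms(1)] recl_comp[OF assms(2)])

lemmas semidec_no_cancel [semidec_intros] = dec_no_cancel[THEN semidec_dec]

lemma semidec_certificate_of [semidec_intros]: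
  assumes "recf c" "recf d" "recf N" "recf r"
  shows "semidec (\<lambda>x. certificate_of (c x) (d x) (N x) (r x))"
  unfolding certificate_of_def certificate_def
  by (intro semidec_intros rec_intros assms recf_comp[OF assms(1)] recf_comp[OF assms(2)]
      recf_comp[OF assms(3)] recf_comp[OF assms(4)])

text \<open>A set of vertices has a code at most that of the whole vertex set, so the quantifier
  over cliques \<open>K\<close> is bounded. One ordering \<open>k\<close> of each is enough, since
  runs are invariant under swaps.\<close>

definition torsion_free_answer :: "nat \<Rightarrow> bool" where
  "torsion_free_answer c \<longleftrightarrow> (\<exists>d N r. certificate_of c d N r \<and>
     (\<forall>q\<in>{1..N}. \<forall>K<Suc (lft (lft c)). K = 0 \<or> (\<exists>s\<in>set_decode K. s \<notin> verts_of c) \<or>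
        (\<exists>s\<in>set_decode K. \<exists>t\<in>set_decode K. s \<noteq> t \<and> \<not> adj_of c s t) \<or>
        (\<exists>k. k \<in> lists (set_decode K) \<and> (\<forall>s\<in>set_decode K. \<exists>i<length k. nth_default 0 k i = s) \<and>
           (\<forall>j<length k. \<forall>i<j. nth_default 0 k i \<noteq> nth_default 0 k j) \<and>
           run (table c d N) q k \<noteq> q)))"

text \<open>Non-triviality of \<open>w\<close> is certified by a nonempty reduced word equal to
  it.\<close>

definition torsion_answer :: "nat \<Rightarrow> bool" where
  "torsion_answer c \<longleftrightarrow> (\<exists>w u. mem_of c w \<and> eq_of c (w @ w) [] \<and> eq_of c w u \<and>
     no_cancel (adj_of c) u \<and> u \<noteq> [])"

text \<open>The values \<open>Suc N\<close> and 0 are those of \<open>enat_encode\<close> for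
  \<open>N\<close> and for infinity.\<close>

definition index_answer :: "nat \<Rightarrow> nat \<Rightarrow> bool" where
  "index_answer c y \<longleftrightarrow> (\<exists>d N r. certificate_of c d N r \<and>
     (y = Suc N \<and> (\<forall>q\<in>{1..N}. \<forall>s\<in>verts_of c. table c d N q s \<noteq> 0) \<or>
      y = 0 \<and> (\<exists>q\<in>{1..N}. \<exists>s\<in>verts_of c. \<exists>t\<in>verts_of c.
        s \<noteq> t \<and> \<not> adj_of c s t \<and> table c d N q s = 0)))"

definition power_answer :: "nat \<Rightarrow> nat list \<Rightarrow> bool" where
  "power_answer c w \<longleftrightarrow> (\<exists>n. mem_of c (concat (replicate (Suc n) w)))"

text \<open>By \<open>power_bounded\<close> the exponents \<open>2 * n\<close> with \<open>n\<close>
  up to \<open>N\<close> suffice. Each non-membership is certified by a reduced word that is not a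
  loop.\<close>

definition no_power_answer :: "nat \<Rightarrow> nat list \<Rightarrow> bool" where
  "no_power_answer c w \<longleftrightarrow> (\<exists>d N r. certificate_of c d N r \<and>
     (\<forall>n\<in>{1..N}. \<exists>u. eq_of c (concat (replicate (2 * n) w)) u \<and> no_cancel (adj_of c) u \<and>
        run (table c d N) 1 u \<noteq> 1))"

definition normal_answer :: "nat \<Rightarrow> bool" where
  "normal_answer c \<longleftrightarrow> (\<forall>s\<in>verts_of c. \<forall>h\<in>words_of c. mem_of c (s # h @ [s]))"

definition not_normal_answer :: "nat \<Rightarrow> bool" where
  "not_normal_answer c \<longleftrightarrow> (\<exists>d N r. certificate_of c d N r \<and>
     (\<exists>s\<in>verts_of c. \<exists>h\<in>words_of c. \<exists>u. eq_of c (s # h @ [s]) u \<and> no_cancel (adj_of c) u \<and>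
        run (table c d N) 1 u \<noteq> 1))"

lemma semidec_answers:
  "semidec torsion_free_answer" "semidec torsion_answer"
  "semidec (\<lambda>z. index_answer (lft z) (rgt z))"
  "semidec (\<lambda>z. power_answer (lft z) (list_decode (rgt z)))"
  "semidec (\<lambda>z. no_power_answer (lft z) (list_decode (rgt z)))"
  "semidec normal_answer" "semidec not_normal_answer"
  unfolding torsion_free_answer_def[abs_def] torsion_answer_def[abs_def] index_answer_def
    power_answer_def no_power_answer_def normal_answer_def[abs_def] not_normal_answer_def[abs_def]
  by (intro semidec_intros rec_intros)+

locale quasiconvex_instance = racg_subgroup \<Gamma> S for \<Gamma> :: "nat pair_pre_digraph" and S +
  assumes quasiconvex: "quasiconvex (racg \<Gamma>) (racg_gens \<Gamma>) (word_subgroup \<Gamma> S)"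
begin

section \<open>Correctness of the answers\<close>

abbreviation code :: nat where "code \<equiv> inst_encode (\<Gamma>, S)"

lemma verts_of_code: "verts_of code = V"
  using pair_finite_verts by simp

lemma adj_of_code: "adj_of code s t \<longleftrightarrow> adj s t"
  using pair_finite_arcs by (auto simp: image_iff)

lemma words_of_code: "words_of code = S"
  using finite_S by (auto simp: image_image)

lemmas code_simps = verts_of_code adj_of_code words_of_code

lemma eq_of_code: "u \<in> lists V \<Longrightarrow> eq_of code u v \<longleftrightarrow> racg_eq \<Gamma> u v"
  unfolding eq_of_def code_simps by (rule word_steps_iff)

lemma mem_of_code: "mem_of code w \<longleftrightarrow> G w"
  unfolding mem_of_def code_simps by (rule subgroup_steps_iff)

lemma no_cancel_code: "no_cancel (adj_of code) w \<longleftrightarrow> reduced w"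
  unfolding code_simps by (rule no_cancel_iff) (rule commutation_axioms)

lemma certificate_code:
  "certificate V adj S (eq_of code) (mem_of code) \<delta> N r \<longleftrightarrow> certificate V adj S (racg_eq \<Gamma>) G \<delta> N r"
proof -
  have "(\<forall>w\<in>S. \<exists>u. eq_of code w u \<and> run \<delta> 1 u = 1) \<longleftrightarrow> (\<forall>w\<in>S. \<exists>u. racg_eq \<Gamma> w u \<and> run \<delta> 1 u = 1)"
    using eq_of_code S_lists by (intro ball_cong HOL.refl) blast
  then show ?thesis unfolding certificate_def mem_of_code by (simp only:)
qed

lemma certificate_of_code:
  assumes "certificate_of code d N r"
  shows "racg_certificate \<Gamma> S (table code d N) N (\<lambda>q. list_decode (nth_default 0 (list_decode r) q))"
proof
  show "table code d N q s = 0" if "q \<notin> {1..N} \<or> s \<notin> V" for q s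
    using that unfolding table_def verts_of_code by auto
  show "certificate V adj S (racg_eq \<Gamma>) G (table code d N) N
      (\<lambda>q. list_decode (nth_default 0 (list_decode r) q))"
    using assms unfolding certificate_of_def code_simps certificate_code .
qed

text \<open>Outside the states both \<open>\<delta>\<close> and \<open>r\<close> have default
  values, so finite lists with default 0 reproduce them exactly.\<close>

lemma certificate_of_code_ex:
  assumes "racg_certificate \<Gamma> S \<delta> N r" "\<forall>q. q \<notin> {1..N} \<longrightarrow> r q = []"
  shows "\<exists>d r'. certificate_of code d N r' \<and> table code d N = \<delta>"
proof -
  interpret racg_certificate \<Gamma> S \<delta> N r by fact
  define B where "B = Suc (Max (prod_encode ` (Q \<times> V)))"
  have B: "prod_encode (q, s) < B" if "q \<in> Q" "s \<in> V" for q s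
    using that finite_V by (auto simp: B_def less_Suc_eq_le intro!: Max_ge)
  obtain d where d: "\<forall>i<B. nth_default 0 (list_decode d) i = \<delta> (lft i) (rgt i)"
    using ex_list_prefix[of B "\<lambda>i. \<delta> (lft i) (rgt i)"] by blast
  have table: "table code d N = \<delta>"
  proof (intro ext)
    fix q s show "table code d N q s = \<delta> q s"
    proof (cases "q \<in> Q \<and> s \<in> V")
      case True
      then have "table code d N q s = nth_default 0 (list_decode d) (prod_encode (q, s))"
        unfolding table_def verts_of_code by auto
      then show ?thesis using d B[of q s] True by simp
    next
      case False
      then have "\<delta> q s = 0" using dead by blast
      moreover have "table code d N q s = 0" using False unfolding table_def verts_of_code by auto
      ultimately show ?thesis by simp
    qed
  qed
  \<comment> \<open>Entry 0 belongs to no state; beyond \<open>N\<close> the default 0 decodes to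
    \<open>[]\<close>.\<close>
  define r' where "r' = list_encode (map (\<lambda>q. list_encode (r q)) [0..<Suc N])"
  have "(\<lambda>q. list_decode (nth_default 0 (list_decode r') q)) = r"
  proof
    fix q show "list_decode (nth_default 0 (list_decode r') q) = r q"
    proof (cases "q < Suc N")
      case True
      then show ?thesis by (simp add: r'_def nth_default_def del: upt_Suc)
    next
      case False
      then have "r q = []" using assms(2) by simp
      then show ?thesis using False by (simp add: r'_def nth_default_def del: upt_Suc)
    qed
  qed
  then have "certificate_of code d N r'"
    using cert unfolding certificate_of_def code_simps certificate_code table by simp
  then show ?thesis using table by blast
qed

lemma certificate_of_code_quasiconvex:
  "\<exists>d N r. certificate_of code d N r"
  using hull_certificate[OF quasiconvex] certificate_of_code_ex by blast

lemma nth_default_enumerates: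
  "(\<forall>s\<in>K. \<exists>i<length k. nth_default 0 k i = s) \<longleftrightarrow> K \<subseteq> set k"
  "(\<forall>j<length k. \<forall>i<j. nth_default 0 k i \<noteq> nth_default 0 k j) \<longleftrightarrow> distinct k"
  for k :: "nat list"
proof -
  have "nth_default 0 k i = k ! i" if "i < length k" for i
    using that by (simp add: nth_default_def)
  then show "(\<forall>s\<in>K. \<exists>i<length k. nth_default 0 k i = s) \<longleftrightarrow> K \<subseteq> set k"
    unfolding subset_iff in_set_conv_nth Ball_def by (metis (no_types))
  show "(\<forall>j<length k. \<forall>i<j. nth_default 0 k i \<noteq> nth_default 0 k j) \<longleftrightarrow> distinct k"
    unfolding distinct_conv_nth
    by (auto simp: nth_default_def) (metis linorder_neqE_nat)
qed

lemma torsion_free_answer_iff: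
  "torsion_free_answer code \<longleftrightarrow> torsion_free (W\<lparr>carrier := H\<rparr>)"
proof
  assume "torsion_free_answer code"
  then obtain d N r where automaton: "certificate_of code d N r" and
    no_loop: "\<forall>q\<in>{1..N}. \<forall>K<Suc (lft (lft code)). K = 0 \<or> (\<exists>s\<in>set_decode K. s \<notin> V) \<or>
        (\<exists>s\<in>set_decode K. \<exists>t\<in>set_decode K. s \<noteq> t \<and> \<not> adj s t) \<or>
        (\<exists>k. k \<in> lists (set_decode K) \<and> set_decode K \<subseteq> set k \<and> distinct k \<and>
          run (table code d N) q k \<noteq> q)"
    unfolding torsion_free_answer_def nth_default_enumerates code_simps by (elim exE conjE) (rule that)
  interpret racg_certificate \<Gamma> S "table code d N" N "\<lambda>q. list_decode (nth_default 0 (list_decode r) q)"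
    using automaton by (rule certificate_of_code)
  show "torsion_free (W\<lparr>carrier := H\<rparr>)"
  proof (rule ccontr)
    assume "\<not> ?thesis"
    then have "\<exists>w. G w \<and> eqv (w @ w) [] \<and> \<not> eqv w []" unfolding torsion_free_iff by blast
    then obtain q k where qk: "q \<in> Q" "clique k" "k \<noteq> []" "set k \<subseteq> V" "run (table code d N) q k = q"
      unfolding torsion_iff_clique_loop by blast
    define K where "K = set_encode (set k)"
    have K: "set_decode K = set k" by (simp add: K_def)
    \<comment> \<open>\<open>set_encode\<close> sums powers of two over the set, so it is monotone
      under inclusion.\<close>
    have "K \<le> set_encode V"
      unfolding K_def set_encode_def using qk(4) finite_V by (intro sum_mono2) auto
    then have "K < Suc (lft (lft code))" by simp
    moreover have "K \<noteq> 0" using K qk(3) by (metis set_decode_zero set_empty)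
    ultimately obtain l where l: "l \<in> lists (set k)" "set k \<subseteq> set l" "distinct l"
      "run (table code d N) q l \<noteq> q"
      using no_loop[rule_format, OF qk(1), of K] qk(2,4) unfolding K clique_def by blast
    then have "trace_eq k l" using qk(2) by (intro clique_trace_eq) auto
    then show False using run_trace_eq qk(5) l(4) by metis
  qed
next
  assume tf: "torsion_free (W\<lparr>carrier := H\<rparr>)"
  obtain d N r where automaton: "certificate_of code d N r" using certificate_of_code_quasiconvex by blast
  interpret racg_certificate \<Gamma> S "table code d N" N "\<lambda>q. list_decode (nth_default 0 (list_decode r) q)"
    using automaton by (rule certificate_of_code)
  have "K = 0 \<or> (\<exists>s\<in>set_decode K. s \<notin> V) \<or>
        (\<exists>s\<in>set_decode K. \<exists>t\<in>set_decode K. s \<noteq> t \<and> \<not> adj s t) \<or>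
        (\<exists>k. k \<in> lists (set_decode K) \<and> set_decode K \<subseteq> set k \<and> distinct k \<and>
          run (table code d N) q k \<noteq> q)" if q: "q \<in> Q" for q K
  proof (rule ccontr)
    assume n: "\<not> ?thesis"
    \<comment> \<open>The negation says that every ordering of the clique is a loop at
      \<open>q\<close>; the sorted one is as good as any.\<close>
    let ?k = "sorted_list_of_set (set_decode K)"
    have k: "set ?k = set_decode K" "distinct ?k" by simp_all
    have "clique ?k" using n k unfolding clique_def by auto
    moreover have "?k \<noteq> []"
    proof
      assume "?k = []"
      then have "set_decode K = {}" using k(1) by simp
      then have "K = 0" by (metis set_decode_inverse set_encode_empty)
      then show False using n by blast
    qed
    moreover have "?k \<in> lists (set_decode K) \<and> set_decode K \<subseteq> set ?k \<and> distinct ?k"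
      using k by (simp add: in_lists_conv_set)
    then have "run (table code d N) q ?k = q" using n by blast
    moreover have "set ?k \<subseteq> V" using n k by blast
    ultimately show False
      using torsion_iff_clique_loop tf q unfolding torsion_free_iff by blast
  qed
  then show "torsion_free_answer code"
    using automaton unfolding torsion_free_answer_def nth_default_enumerates code_simps by blast
qed

lemma torsion_answer_iff: "torsion_answer code \<longleftrightarrow> \<not> torsion_free (W\<lparr>carrier := H\<rparr>)"
proof -
  have "(\<exists>u. eq_of code (w @ w) [] \<and> eq_of code w u \<and> no_cancel (adj_of code) u \<and> u \<noteq> [])
      \<longleftrightarrow> eqv (w @ w) [] \<and> \<not> eqv w []" if "G w" for w
  proof -
    have w: "w \<in> lists V" "w @ w \<in> lists V" using G_in_lists[OF that] by auto
    have "(\<exists>u. racg_eq \<Gamma> w u \<and> reduced u \<and> u \<noteq> []) \<longleftrightarrow> \<not> eqv w []"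
    proof
      assume "\<exists>u. racg_eq \<Gamma> w u \<and> reduced u \<and> u \<noteq> []"
      then obtain u where u: "eqv w u" "reduced u" "u \<noteq> []" by (auto simp: racg_eq_iff)
      then have "\<not> eqv u []" using eqv_reduced[of u "[]"] by simp
      then show "\<not> eqv w []" using u(1) eqv_sym eqv_trans by blast
    next
      assume "\<not> eqv w []"
      moreover have "eqv w (nf w)" by (rule eqv_nf)
      ultimately have "nf w \<noteq> []" by metis
      then show "\<exists>u. racg_eq \<Gamma> w u \<and> reduced u \<and> u \<noteq> []" using racg_eq_nf w(1) reduced_nf by blast
    qed
    moreover have "eq_of code (w @ w) [] \<longleftrightarrow> eqv (w @ w) []"
      unfolding eq_of_code[OF w(2)] using w(2) by (simp add: racg_eq_iff)
    ultimately show ?thesis unfolding eq_of_code[OF w(1)] no_cancel_code by blast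
  qed
  then show ?thesis unfolding torsion_answer_def torsion_free_iff mem_of_code by blast
qed

lemma index_answer_iff: "index_answer code y \<longleftrightarrow> y = enat_encode (subgroup_index W H)"
proof
  assume "index_answer code y"
  then obtain d N r where automaton: "certificate_of code d N r" and
    y: "y = Suc N \<and> (\<forall>q\<in>{1..N}. \<forall>s\<in>V. table code d N q s \<noteq> 0) \<or>
      y = 0 \<and> (\<exists>q\<in>{1..N}. \<exists>s\<in>V. \<exists>t\<in>V. s \<noteq> t \<and> \<not> adj s t \<and> table code d N q s = 0)"
    unfolding index_answer_def code_simps by (elim exE conjE) (rule that)
  interpret racg_certificate \<Gamma> S "table code d N" N "\<lambda>q. list_decode (nth_default 0 (list_decode r) q)"
    using automaton by (rule certificate_of_code)
  from y show "y = enat_encode (subgroup_index W H)"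
  proof
    assume "y = Suc N \<and> (\<forall>q\<in>{1..N}. \<forall>s\<in>V. table code d N q s \<noteq> 0)"
    then show ?thesis using index_total by simp
  next
    assume *: "y = 0 \<and> (\<exists>q\<in>{1..N}. \<exists>s\<in>V. \<exists>t\<in>V. s \<noteq> t \<and> \<not> adj s t \<and> table code d N q s = 0)"
    then have "infinite (rcosets\<^bsub>W\<^esub> H)" using index_infinite by blast
    then show ?thesis using * by (simp add: subgroup_index_def)
  qed
next
  assume y: "y = enat_encode (subgroup_index W H)"
  show "index_answer code y"
  proof (cases "finite (rcosets\<^bsub>W\<^esub> H)")
    case True
    then obtain \<delta> N r where *: "racg_certificate \<Gamma> S \<delta> N r" "\<forall>q. q \<notin> {1..N} \<longrightarrow> r q = []"
      "\<forall>q\<in>{1..N}. \<forall>s\<in>V. \<delta> q s \<noteq> 0" using total_certificate by blast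
    then have "subgroup_index W H = enat N" using racg_certificate.index_total by blast
    then show ?thesis
      using certificate_of_code_ex[OF *(1,2)] *(3) y unfolding index_answer_def code_simps by fastforce
  next
    case False
    obtain d N r where automaton: "certificate_of code d N r" using certificate_of_code_quasiconvex by blast
    interpret racg_certificate \<Gamma> S "table code d N" N "\<lambda>q. list_decode (nth_default 0 (list_decode r) q)"
      using automaton by (rule certificate_of_code)
    \<comment> \<open>Contraposition of \<open>index_finite\<close>: if the index is infinite, every
      certificate misses an edge labelled by a non-central letter.\<close>
    have "\<exists>q\<in>{1..N}. \<exists>s\<in>V. \<exists>t\<in>V. s \<noteq> t \<and> \<not> adj s t \<and> table code d N q s = 0"
      using index_finite False by metis
    moreover have "y = 0" using y False by (simp add: subgroup_index_def)
    ultimately show ?thesis using automaton unfolding index_answer_def code_simps by blast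
  qed
qed

text \<open>Membership can be read off any single reduced word for \<open>w\<close>, so one that is
  not a loop certifies non-membership; \<open>nf w\<close> is always available as such a
  word.\<close>

lemma not_member_iff:
  assumes automaton: "certificate_of code d N r" and w: "w \<in> lists V"
  shows "(\<exists>u. eq_of code w u \<and> no_cancel (adj_of code) u \<and> run (table code d N) 1 u \<noteq> 1) \<longleftrightarrow> \<not> G w"
proof -
  interpret racg_certificate \<Gamma> S "table code d N" N "\<lambda>q. list_decode (nth_default 0 (list_decode r) q)"
    using automaton by (rule certificate_of_code)
  have "racg_eq \<Gamma> w (nf w)" "reduced (nf w)" using w racg_eq_nf reduced_nf by blast+
  moreover have "G w \<longleftrightarrow> run (table code d N) 1 u = 1" if "racg_eq \<Gamma> w u" "reduced u" for u
    using that G_iff_loop racg_eq_iff by blast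
  ultimately show ?thesis unfolding eq_of_code[OF w] no_cancel_code by blast
qed

lemma power_answers_iff:
  assumes w: "w \<in> lists V"
  shows "power_answer code w \<longleftrightarrow> (\<exists>n::nat. n > 0 \<and> cls w [^]\<^bsub>W\<^esub> n \<in> H)"
    and "no_power_answer code w \<longleftrightarrow> \<not> (\<exists>n::nat. n > 0 \<and> cls w [^]\<^bsub>W\<^esub> n \<in> H)"
proof -
  have pow: "(\<exists>n::nat. n > 0 \<and> cls w [^]\<^bsub>W\<^esub> n \<in> H) \<longleftrightarrow> (\<exists>n. G (wpow w (Suc n)))"
    unfolding cls_pow[OF w] by (metis gr0_implies_Suc zero_less_Suc)
  show "power_answer code w \<longleftrightarrow> (\<exists>n::nat. n > 0 \<and> cls w [^]\<^bsub>W\<^esub> n \<in> H)"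
    unfolding pow power_answer_def mem_of_code ..
  have wl: "wpow w n \<in> lists V" for n using w by (auto simp: in_lists_conv_set)
  show "no_power_answer code w \<longleftrightarrow> \<not> (\<exists>n::nat. n > 0 \<and> cls w [^]\<^bsub>W\<^esub> n \<in> H)"
    unfolding pow
  proof
    assume "no_power_answer code w"
    then obtain d N r where automaton: "certificate_of code d N r" and
      *: "\<forall>n\<in>{1..N}. \<exists>u. eq_of code (wpow w (2 * n)) u \<and> no_cancel (adj_of code) u \<and>
        run (table code d N) 1 u \<noteq> 1"
      unfolding no_power_answer_def by (elim exE conjE) (rule that)
    interpret racg_certificate \<Gamma> S "table code d N" N "\<lambda>q. list_decode (nth_default 0 (list_decode r) q)"
      using automaton by (rule certificate_of_code)
    have "\<not> G (wpow w (2 * n))" if "n \<in> Q" for n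
      using *[rule_format, OF that] not_member_iff[OF automaton wl] by blast
    then show "\<not> (\<exists>n. G (wpow w (Suc n)))" using power_bounded[OF w] by blast
  next
    assume n: "\<not> (\<exists>n. G (wpow w (Suc n)))"
    obtain d N r where automaton: "certificate_of code d N r" using certificate_of_code_quasiconvex by blast
    have "\<not> G (wpow w (2 * m))" if "m \<in> {1..N}" for m
    proof -
      have "2 * m = Suc (2 * m - 1)" using that by simp
      then show ?thesis using n by metis
    qed
    then show "no_power_answer code w"
      unfolding no_power_answer_def using automaton not_member_iff[OF automaton wl] by blast
  qed
qed

lemma normal_answers_iff:
  "normal_answer code \<longleftrightarrow> H \<lhd> W" "not_normal_answer code \<longleftrightarrow> \<not> H \<lhd> W"
proof -
  show "normal_answer code \<longleftrightarrow> H \<lhd> W"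
    unfolding normal_answer_def normal_iff code_simps mem_of_code ..
  have l: "s # h @ [s] \<in> lists V" if "s \<in> V" "h \<in> S" for s h
    using that S_lists by auto
  show "not_normal_answer code \<longleftrightarrow> \<not> H \<lhd> W"
  proof
    assume "not_normal_answer code"
    then obtain d N r s h where automaton: "certificate_of code d N r" and sh: "s \<in> V" "h \<in> S"
      "\<exists>u. eq_of code (s # h @ [s]) u \<and> no_cancel (adj_of code) u \<and> run (table code d N) 1 u \<noteq> 1"
      unfolding not_normal_answer_def verts_of_code words_of_code by blast
    then show "\<not> H \<lhd> W" using not_member_iff[OF automaton l[OF sh(1,2)]] normal_iff by blast
  next
    assume "\<not> H \<lhd> W"
    then obtain s h where sh: "s \<in> V" "h \<in> S" "\<not> G (s # h @ [s])" unfolding normal_iff by blast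
    obtain d N r where automaton: "certificate_of code d N r" using certificate_of_code_quasiconvex by blast
    then show "not_normal_answer code"
      unfolding not_normal_answer_def verts_of_code words_of_code
      using sh not_member_iff[OF automaton l[OF sh(1,2)]] by blast
  qed
qed

end

lemma quasiconvex_instanceI:
  assumes "(\<Gamma>, S) \<in> quasiconvex_instances"
  shows "quasiconvex_instance \<Gamma> S"
proof -
  have *: "pair_graph \<Gamma>" "finite S" "S \<subseteq> lists (pverts \<Gamma>)"
    "quasiconvex (racg \<Gamma>) (racg_gens \<Gamma>) (word_subgroup \<Gamma> S)"
    using assms by (simp_all add: quasiconvex_instances_def)
  interpret pair_graph \<Gamma> by fact
  show ?thesis by unfold_locales (use * in auto)
qed

theorem theorem5:
  shows "computable_on quasiconvex_instances inst_encode of_bool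
           (\<lambda>(\<Gamma>, S). torsion_free ((racg \<Gamma>)\<lparr>carrier := word_subgroup \<Gamma> S\<rparr>))
       \<and> computable_on quasiconvex_instances inst_encode enat_encode
           (\<lambda>(\<Gamma>, S). subgroup_index (racg \<Gamma>) (word_subgroup \<Gamma> S))
       \<and> computable_on (SIGMA (\<Gamma>, S) : quasiconvex_instances. lists (pverts \<Gamma>))
           inst_word_encode of_bool
           (\<lambda>((\<Gamma>, S), w). \<exists>n::nat. n > 0 \<and> racg_word \<Gamma> w [^]\<^bsub>racg \<Gamma>\<^esub> n \<in> word_subgroup \<Gamma> S)
       \<and> computable_on quasiconvex_instances inst_encode of_bool
           (\<lambda>(\<Gamma>, S). word_subgroup \<Gamma> S \<lhd> racg \<Gamma>)"
proof (intro conjI)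
  show "computable_on quasiconvex_instances inst_encode of_bool
           (\<lambda>(\<Gamma>, S). torsion_free ((racg \<Gamma>)\<lparr>carrier := word_subgroup \<Gamma> S\<rparr>))"
    by (rule computable_on_bool[OF semidec_answers(1,2)])
      (clarify, drule quasiconvex_instanceI,
        simp only: quasiconvex_instance.torsion_free_answer_iff quasiconvex_instance.torsion_answer_iff case_prod_conv)+
  show "computable_on quasiconvex_instances inst_encode enat_encode
           (\<lambda>(\<Gamma>, S). subgroup_index (racg \<Gamma>) (word_subgroup \<Gamma> S))"
    by (rule computable_on_semidec[OF semidec_answers(3)])
      (clarify, drule quasiconvex_instanceI,
        simp only: quasiconvex_instance.index_answer_iff case_prod_conv prod_encode_inverse fst_conv snd_conv)
  show "computable_on (SIGMA (\<Gamma>, S) : quasiconvex_instances. lists (pverts \<Gamma>))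
           inst_word_encode of_bool
           (\<lambda>((\<Gamma>, S), w). \<exists>n::nat. n > 0 \<and> racg_word \<Gamma> w [^]\<^bsub>racg \<Gamma>\<^esub> n \<in> word_subgroup \<Gamma> S)"
  proof (rule computable_on_bool[OF semidec_answers(4,5)])
    fix x assume "x \<in> (SIGMA (\<Gamma>, S) : quasiconvex_instances. lists (pverts \<Gamma>))"
    then obtain \<Gamma> S w where x: "x = ((\<Gamma>, S), w)" "(\<Gamma>, S) \<in> quasiconvex_instances" "w \<in> lists (pverts \<Gamma>)"
      by (elim SigmaE) (auto simp del: in_lists_conv_set)
    interpret quasiconvex_instance \<Gamma> S using x(2) by (rule quasiconvex_instanceI)
    show "power_answer (lft (inst_word_encode x)) (list_decode (rgt (inst_word_encode x))) \<longleftrightarrow>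
        (case x of (I, w) \<Rightarrow> (case I of (\<Gamma>, S) \<Rightarrow> \<lambda>w. \<exists>n::nat. n > 0 \<and>
          racg_word \<Gamma> w [^]\<^bsub>racg \<Gamma>\<^esub> n \<in> word_subgroup \<Gamma> S) w)"
      using power_answers_iff(1)[OF x(3)]
      by (simp only: x(1) case_prod_conv inst_word_encode.simps prod_encode_inverse list_encode_inverse fst_conv snd_conv)
    show "no_power_answer (lft (inst_word_encode x)) (list_decode (rgt (inst_word_encode x))) \<longleftrightarrow>
        \<not> (case x of (I, w) \<Rightarrow> (case I of (\<Gamma>, S) \<Rightarrow> \<lambda>w. \<exists>n::nat. n > 0 \<and>
          racg_word \<Gamma> w [^]\<^bsub>racg \<Gamma>\<^esub> n \<in> word_subgroup \<Gamma> S) w)"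
      using power_answers_iff(2)[OF x(3)]
      by (simp only: x(1) case_prod_conv inst_word_encode.simps prod_encode_inverse list_encode_inverse fst_conv snd_conv)
  qed
  show "computable_on quasiconvex_instances inst_encode of_bool (\<lambda>(\<Gamma>, S). word_subgroup \<Gamma> S \<lhd> racg \<Gamma>)"
    by (rule computable_on_bool[OF semidec_answers(6,7)])
      (clarify, drule quasiconvex_instanceI,
        simp only: quasiconvex_instance.normal_answers_iff case_prod_conv)+
qed

end
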